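(* Let $\Sigma$ be a $d$-dimensional simplicial complex that admits a PL embedding into $\mathbb{R}^{d+1}$. Then $H_d(\Sigma;\mathbb{Z}_2)$ has a $2$-complete basis.
   Context: Simplicial complexes are finite. A simplicial complex $\Sigma$ admits a linear embedding into $\mathbb{R}^k$ if it has a geometric realisation in $\mathbb{R}^k$; it is PL embeddable into $\mathbb{R}^k$ (admits a PL embedding into $\mathbb{R}^k$) if some subdivision of its geometric realisation $\|\Sigma\|$ admits a linear embedding into $\mathbb{R}^k$. $H_d(\Sigma;\mathbb{Z}_2)$ is simplicial homology with $\mathbb{Z}_2$ coefficients; since $\dim\Sigma=d$, its elements are exactly the $d$-cycles. For a $d$-chain $c=\sum_\sigma \epsilon_\sigma\sigma$ (sum over the $d$-dimensional faces $\sigma$ of $\Sigma$, $\epsilon_\sigma\in\mathbb{Z}_2$), the support $\mathrm{supp}(c)$ is the set of $d$-faces $\sigma$ with $\epsilon_\sigma=1$. A basis $\mathcal{B}$ of the vector space $H_d(\Sigma;\mathbb{Z}_2)$ is $m$-complete if every $d$-dimensional face of $\Sigma$ lies in the support of at most $m$ elements of $\mathcal{B}$. *)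

theory Defs
  imports "HOL-Analysis.Analysis" "HOL-Library.Z2"
begin

section \<open>Abstract simplicial complexes and their realisations\<close>

text \<open>The empty set is a face of every nonempty complex, in accordance with
  \<^const>\<open>simplicial_complex\<close>, where the empty simplex belongs to every nonempty
  geometric complex.\<close>

definition abstract_complex :: "'v set set \<Rightarrow> bool" where
  "abstract_complex K \<longleftrightarrow>
     finite K \<and> (\<forall>\<sigma>\<in>K. finite \<sigma>) \<and> (\<forall>\<sigma>\<in>K. \<forall>\<tau>. \<tau> \<subseteq> \<sigma> \<longrightarrow> \<tau> \<in> K)"

definition faces :: "'v set set \<Rightarrow> nat \<Rightarrow> 'v set set" where
  "faces K n = {\<sigma> \<in> K. card \<sigma> = n + 1}"

definition has_dimension :: "'v set set \<Rightarrow> nat \<Rightarrow> bool" where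
  "has_dimension K d \<longleftrightarrow> faces K d \<noteq> {} \<and> (\<forall>\<sigma>\<in>K. card \<sigma> \<le> d + 1)"

definition complex_isomorphic :: "'v set set \<Rightarrow> 'w set set \<Rightarrow> bool" where
  "complex_isomorphic K L \<longleftrightarrow> (\<exists>f. inj_on f (\<Union>K) \<and> L = (\<lambda>\<sigma>. f ` \<sigma>) ` K)"

definition vertex_scheme :: "'a::euclidean_space set set \<Rightarrow> 'a set set" where
  "vertex_scheme C = (\<lambda>S. {v. v extreme_point_of S}) ` C"

definition geometric_realisation :: "'v set set \<Rightarrow> 'a::euclidean_space set set \<Rightarrow> bool" where
  "geometric_realisation K C \<longleftrightarrow>
     simplicial_complex C \<and> complex_isomorphic K (vertex_scheme C)"

definition linearly_embeddable :: "'v set set \<Rightarrow> 'a::euclidean_space itself \<Rightarrow> bool" where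
  "linearly_embeddable K (_ :: 'a itself) \<longleftrightarrow>
     (\<exists>C :: 'a set set. geometric_realisation K C)"

definition subdivision_of :: "'a::euclidean_space set set \<Rightarrow> 'a set set \<Rightarrow> bool" where
  "subdivision_of C' C \<longleftrightarrow>
     simplicial_complex C' \<and> \<Union>C' = \<Union>C \<and> (\<forall>S\<in>C'. \<exists>T\<in>C. S \<subseteq> T)"

text \<open>The standard realisation: the vertices are sent to the standard basis vectors.\<close>

definition standard_realisation :: "'v::finite set set \<Rightarrow> (real ^ 'v) set set" where
  "standard_realisation K = (\<lambda>\<sigma>. convex hull ((\<lambda>v. axis v 1) ` \<sigma>)) ` K"

definition pl_embeddable :: "'v::finite set set \<Rightarrow> 'a::euclidean_space itself \<Rightarrow> bool" where
  "pl_embeddable K (T :: 'a itself) \<longleftrightarrow>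
     (\<exists>C. subdivision_of C (standard_realisation K) \<and> linearly_embeddable (vertex_scheme C) T)"

lemma affine_independent_axes: "\<not> affine_dependent ((\<lambda>v. axis v (1::real)) ` (\<sigma> :: 'v::finite set))"
proof -
  have "(\<lambda>v. axis v (1::real)) ` \<sigma> \<subseteq> Basis"
    by (auto simp: Basis_vec_def)
  then have "independent ((\<lambda>v. axis v (1::real)) ` \<sigma>)"
    using independent_Basis independent_mono by blast
  then show ?thesis
    using affine_dependent_imp_dependent by blast
qed

lemma geometric_realisation_standard:
  fixes K :: "'v::finite set set"
  assumes "abstract_complex K"
  shows "geometric_realisation K (standard_realisation K)"
proof -
  let ?e = "\<lambda>v::'v. axis v (1::real)"
  let ?h = "\<lambda>\<sigma>. convex hull (?e ` \<sigma>)"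
  have inj: "inj ?e"
    by (auto intro!: injI simp: axis_eq_axis)
  have down: "\<tau> \<in> K" if "\<sigma> \<in> K" "\<tau> \<subseteq> \<sigma>" for \<sigma> \<tau>
    using assms that by (auto simp: abstract_complex_def)
  have face: "F face_of ?h \<sigma> \<longleftrightarrow> (\<exists>\<tau>\<subseteq>\<sigma>. F = ?h \<tau>)" for F \<sigma>
    by (auto simp: face_of_convex_hull_affine_independent[OF affine_independent_axes] subset_image_iff)
  have int: "?h \<sigma> \<inter> ?h \<tau> = ?h (\<sigma> \<inter> \<tau>)" for \<sigma> \<tau>
    using convex_hull_Int[of "?e ` \<sigma>" "?e ` \<tau>"] affine_independent_axes[of "\<sigma> \<union> \<tau>"]
    by (simp add: image_Un image_Int[OF inj])
  have "simplicial_complex (standard_realisation K)"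
    unfolding simplicial_complex_def
  proof (intro conjI)
    show "finite (standard_realisation K)"
      by (simp add: standard_realisation_def)
    have "\<exists>n. n simplex ?h \<sigma>" for \<sigma>
      by (rule exI[of _ "int (card (?e ` \<sigma>)) - 1"], rule simplex_convex_hull)
         (use affine_independent_axes[of \<sigma>] in simp)
    then show "\<forall>S\<in>standard_realisation K. \<exists>n. n simplex S"
      by (auto simp: standard_realisation_def)
    show "\<forall>F S. S \<in> standard_realisation K \<and> F face_of S \<longrightarrow> F \<in> standard_realisation K"
      using down by (auto simp: standard_realisation_def face)
    show "\<forall>S S'. S \<in> standard_realisation K \<and> S' \<in> standard_realisation K \<longrightarrow> S \<inter> S' face_of S"
      unfolding standard_realisation_def by (clarsimp simp only: int face) blast
  qed
  moreover have "vertex_scheme (standard_realisation K) = (\<lambda>\<sigma>. ?e ` \<sigma>) ` K"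
    by (simp add: vertex_scheme_def standard_realisation_def image_image
        extreme_point_of_convex_hull_affine_independent[OF affine_independent_axes])
  ultimately show ?thesis
    unfolding geometric_realisation_def complex_isomorphic_def
    using inj inj_on_subset by blast
qed


section \<open>Simplicial homology with coefficients in \<open>\<int>\<^sub>2\<close>\<close>

text \<open>A chain is a vector indexed by all sets of vertices that vanishes off the
  relevant faces.\<close>

definition chains :: "'v::finite set set \<Rightarrow> nat \<Rightarrow> (bit ^ 'v set) set" where
  "chains K n = {c. \<forall>\<sigma>. c $ \<sigma> \<noteq> 0 \<longrightarrow> \<sigma> \<in> faces K n}"

definition chain_support :: "bit ^ ('v::finite set) \<Rightarrow> 'v set set" where
  "chain_support c = {\<sigma>. c $ \<sigma> = 1}"

text \<open>The coefficient at the empty face is 0, so that every 0-chain is a cycle: the homology is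
  not reduced.\<close>

definition bdry :: "'v::finite set set \<Rightarrow> nat \<Rightarrow> bit ^ 'v set \<Rightarrow> bit ^ 'v set" where
  "bdry K n c =
     (\<chi> \<tau>. if \<tau> \<noteq> {} \<and> card \<tau> = n then \<Sum>\<sigma> | \<sigma> \<in> faces K n \<and> \<tau> \<subseteq> \<sigma>. c $ \<sigma> else 0)"

definition cycles :: "'v::finite set set \<Rightarrow> nat \<Rightarrow> (bit ^ 'v set) set" where
  "cycles K n = {c \<in> chains K n. bdry K n c = 0}"

definition boundaries :: "'v::finite set set \<Rightarrow> nat \<Rightarrow> (bit ^ 'v set) set" where
  "boundaries K n = bdry K (Suc n) ` chains K (Suc n)"

lemma boundaries_top:
  assumes "has_dimension K d"
  shows "boundaries K d = {0}"
proof -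
  have "faces K (Suc d) = {}"
    using assms by (auto simp: has_dimension_def faces_def)
  then have "chains K (Suc d) = {0}" "bdry K (Suc d) 0 = 0"
    by (auto simp: chains_def bdry_def vec_eq_iff)
  then show ?thesis
    by (simp add: boundaries_def)
qed

text \<open>By the preceding lemma the homology of a complex of dimension \<open>d\<close> in degree \<open>d\<close>, that is,
  cycles modulo boundaries, is the space of \<open>d\<close>-cycles.\<close>

definition top_homology_basis :: "'v::finite set set \<Rightarrow> nat \<Rightarrow> (bit ^ 'v set) set \<Rightarrow> bool" where
  "top_homology_basis K d B \<longleftrightarrow> vec.independent B \<and> vec.span B = cycles K d"

definition complete_basis ::
  "nat \<Rightarrow> 'v::finite set set \<Rightarrow> nat \<Rightarrow> (bit ^ 'v set) set \<Rightarrow> bool" where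
  "complete_basis m K d B \<longleftrightarrow>
     top_homology_basis K d B \<and> (\<forall>\<sigma> \<in> faces K d. card {c \<in> B. \<sigma> \<in> chain_support c} \<le> m)"

end

theory Submission
  imports Defs
begin

text \<open>The argument is that of MacLane's planarity criterion, one dimension up. Suppose first that a
  complex of dimension \<open>d\<close> lies linearly in a Euclidean space of dimension \<open>d + 1\<close>. Its complement falls
  into connected regions, and each \<open>d\<close>-simplex \<open>\<sigma>\<close> has a region \<open>P \<sigma>\<close> on one side and a region \<open>Q \<sigma>\<close> on
  the other, possibly the same. The heart of the proof is that the \<open>d\<close>-cycles modulo 2 are exactly
  the cuts of the dual graph: a chain \<open>c\<close> is a cycle if and only if there is a function \<open>f\<close> from regions to
  \<open>\<int>\<^sub>2\<close> such that \<open>c \<sigma> = f (P \<sigma>) + f (Q \<sigma>)\<close> for all \<open>\<sigma>\<close> (\<open>cycles_are_cuts\<close>). Hence the cycles are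
  spanned by the cuts of single regions, that is, by the boundaries of the regions, and a
  simplex lies in the support of at most two of these, the boundaries of the regions on its two sides.
  Any basis extracted from this spanning set is 2-complete
  (\<open>complete_basis_if_cut_representation\<close>).

  Every cycle is a cut (\<open>cycle_imp_cut\<close>) because it bounds its cone. Let \<open>x0\<close> be a generic point and let
  \<open>f x\<close> be the number, modulo 2 and weighted by \<open>c\<close>, of the \<open>(d + 1)\<close>-simplices \<open>conv ({x0} \<union> \<sigma>)\<close> that
  contain \<open>x\<close>. When \<open>x\<close> moves along a generic segment, the indicator of a \<open>(d + 1)\<close>-simplex changes once
  for every facet that is crossed (\<open>simplex_crossing\<close>). The facets through \<open>x0\<close> contribute nothing in
  total, since \<open>c\<close> is a cycle; so \<open>f\<close> changes exactly by \<open>c \<sigma>\<close> when \<open>\<sigma>\<close> is crossed, and it is constant on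
  regions.

  Every cut is a cycle (\<open>cut_imp_cycle\<close>) because of small loops. A small quadrilateral that links a
  \<open>(d - 1)\<close>-simplex \<open>\<tau>\<close> crosses every \<open>d\<close>-simplex containing \<open>\<tau>\<close> exactly once and nothing else. Along
  the loop the jumps of \<open>f\<close> add up to 0, and their sum is the boundary coefficient of the cut at \<open>\<tau>\<close>.

  A PL embedding is a linear embedding of a subdivision, so it remains to compare the cycles of a complex
  with those of a subdivision (\<open>cycle_on_refine\<close>, \<open>cycle_on_coarsen\<close>). The point is that a cycle of the
  subdivision takes the same value on all the pieces of a \<open>d\<close>-simplex: two pieces can be joined by a
  segment that avoids the simplices of dimension below \<open>d - 1\<close>, and inside a \<open>d\<close>-simplex a piece of
  dimension \<open>d - 1\<close> lies in exactly two pieces of dimension \<open>d\<close>. Therefore the description of cycles as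
  cuts passes from the subdivision to the complex itself.

  All this needs \<open>d > 0\<close>: for \<open>d = 0\<close> there are no faces \<open>\<tau>\<close> to test and every chain is a cycle, since the
  homology is not reduced. The single points are then a basis.\<close>

section \<open>General position and locally constant functions\<close>

lemma affine_line_mem:
  fixes x y :: "'a::real_vector"
  assumes "affine G" "(1 - s) *\<^sub>R x + s *\<^sub>R y \<in> G" "(1 - t) *\<^sub>R x + t *\<^sub>R y \<in> G" "s \<noteq> t"
  shows "(1 - r) *\<^sub>R x + r *\<^sub>R y \<in> G"
proof -
  define u where "u = (t - r) / (t - s)"
  have "t - s \<noteq> 0" using assms by simp
  then have r: "u * s + (1 - u) * t = r"
  proof -
    have "u * (t - s) = t - r" using \<open>t - s \<noteq> 0\<close> by (simp add: u_def)
    then show ?thesis by (simp add: algebra_simps)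
  qed
  have "u *\<^sub>R ((1 - s) *\<^sub>R x + s *\<^sub>R y) + (1 - u) *\<^sub>R ((1 - t) *\<^sub>R x + t *\<^sub>R y) \<in> G"
    using assms by (simp add: affine_def)
  also have "u *\<^sub>R ((1 - s) *\<^sub>R x + s *\<^sub>R y) + (1 - u) *\<^sub>R ((1 - t) *\<^sub>R x + t *\<^sub>R y)
      = (1 - (u * s + (1 - u) * t)) *\<^sub>R x + (u * s + (1 - u) * t) *\<^sub>R y"
    by (simp add: algebra_simps)
  finally show ?thesis unfolding r .
qed

text \<open>How general position of \<open>y\<close> with respect to \<open>x\<close> is used: a common point of the segment and the
  hull of \<open>T\<close> would span a line through \<open>x\<close> that contains \<open>y\<close>.\<close>

lemma affine_hull_misses_segment:
  fixes x y :: "'a::real_vector"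
  assumes "x \<notin> affine hull T" "y \<notin> affine hull (insert x T)"
  shows "affine hull T \<inter> closed_segment x y = {}"
proof (rule ccontr)
  assume "affine hull T \<inter> closed_segment x y \<noteq> {}"
  then obtain s where s: "(1 - s) *\<^sub>R x + s *\<^sub>R y \<in> affine hull T"
    unfolding closed_segment_def by blast
  then have "s \<noteq> 0" using assms(1) by auto
  moreover have "(1 - s) *\<^sub>R x + s *\<^sub>R y \<in> affine hull (insert x T)"
    using s hull_mono[of T "insert x T" affine] by blast
  moreover have "(1 - 0) *\<^sub>R x + 0 *\<^sub>R y \<in> affine hull (insert x T)" by (simp add: hull_inc)
  ultimately have "(1 - 1) *\<^sub>R x + 1 *\<^sub>R y \<in> affine hull (insert x T)"
    using affine_line_mem[OF affine_affine_hull] by blast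
  then show False using assms(2) by simp
qed

lemma finite_if_subsingleton:
  assumes "\<And>s t. s \<in> T \<Longrightarrow> t \<in> T \<Longrightarrow> s = t"
  shows "finite T"
proof (cases "T = {}")
  case False
  then obtain s where "s \<in> T" by blast
  then have "T = {s}" using assms by blast
  then show ?thesis by simp
qed simp

text \<open>The only source of generic points. Induction on the family: if the point found so far lies on the
  new subspace, move it towards a point off that subspace; each subspace then contains at most one point
  of the segment.\<close>

lemma general_position:
  fixes S :: "'a::real_vector set"
  assumes "finite F" "convex S" "S \<noteq> {}" "\<And>G. G \<in> F \<Longrightarrow> affine G" "\<And>G. G \<in> F \<Longrightarrow> \<not> S \<subseteq> G"
  shows "\<exists>y\<in>S. \<forall>G\<in>F. y \<notin> G"
  using assms
proof (induction F)
  case empty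
  then show ?case by auto
next
  case (insert G F)
  have "\<exists>y\<in>S. \<forall>G\<in>F. y \<notin> G"
    by (rule insert.IH) (use insert.prems in blast)+
  then obtain y where y: "y \<in> S" "\<forall>G\<in>F. y \<notin> G" by blast
  obtain z where z: "z \<in> S" "z \<notin> G" using insert.prems(4)[of G] by blast
  let ?p = "\<lambda>t::real. (1 - t) *\<^sub>R y + t *\<^sub>R z"
  have fin: "finite {t. ?p t \<in> G'}" if G': "G' \<in> insert G F" for G'
  proof -
    have "s = t" if "?p s \<in> G'" "?p t \<in> G'" for s t
    proof (rule ccontr)
      assume "s \<noteq> t"
      then have "?p r \<in> G'" for r
        using affine_line_mem[OF insert.prems(3)[OF G'] that] by blast
      from this[of 0] this[of 1] have "y \<in> G'" "z \<in> G'" by simp_all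
      then show False using y(2) z(2) G' by blast
    qed
    then show ?thesis by (intro finite_if_subsingleton) simp
  qed
  have "finite (\<Union>G'\<in>insert G F. {t. ?p t \<in> G'})"
    using fin insert.hyps by blast
  moreover have "infinite {0..1::real}" by simp
  ultimately obtain t where t: "t \<in> {0..1}" "t \<notin> (\<Union>G'\<in>insert G F. {t. ?p t \<in> G'})"
    by (meson finite_subset subsetI)
  then have "?p t \<in> S" using insert.prems(1) y(1) z(1) by (simp add: convex_alt)
  with t show ?case by blast
qed

text \<open>The functions in this development (parities of crossings, coefficients of chains) are only meaningful
  at generic points. They are first extended to all of \<open>S\<close> by their nearby values.\<close>

lemma locally_constant_on_dense_imp_constant:
  fixes f :: "'a::metric_space \<Rightarrow> 'b"
  assumes "connected S"
    and dense: "\<And>p e. p \<in> S \<Longrightarrow> 0 < e \<Longrightarrow> \<exists>z. z \<in> G \<inter> S \<inter> ball p e"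
    and loc: "\<And>p. p \<in> S \<Longrightarrow> \<exists>e>0. \<forall>x\<in>G \<inter> S \<inter> ball p e. \<forall>y\<in>G \<inter> S \<inter> ball p e. f x = f y"
    and xy: "x \<in> G \<inter> S" "y \<in> G \<inter> S"
  shows "f x = f y"
proof -
  obtain e where e: "\<And>p. p \<in> S \<Longrightarrow> e p > 0"
      "\<And>p x y. p \<in> S \<Longrightarrow> x \<in> G \<inter> S \<inter> ball p (e p) \<Longrightarrow> y \<in> G \<inter> S \<inter> ball p (e p) \<Longrightarrow> f x = f y"
    using loc by (metis (lifting))
  have "\<forall>p\<in>S. \<exists>z. z \<in> G \<inter> S \<inter> ball p (e p)"
    by (intro ballI dense e(1))
  from bchoice[OF this] obtain z where z0: "\<forall>p\<in>S. z p \<in> G \<inter> S \<inter> ball p (e p)" ..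
  note z = z0[rule_format]
  have eq: "f (z p) = f w" if "p \<in> S" "w \<in> G \<inter> S \<inter> ball p (e p)" for p w
    by (rule e(2)[OF that(1) z[OF that(1)] that(2)])
  have "(\<lambda>p. f (z p)) constant_on S"
  proof (rule locally_constant_imp_constant[OF \<open>connected S\<close>])
    fix p assume p: "p \<in> S"
    have "f (z q) = f (z p)" if "q \<in> S \<inter> ball p (e p)" for q
    proof -
      have q: "q \<in> S" "dist p q < e p" using that by auto
      have "0 < min (e q) (e p - dist p q)" using q e(1)[OF q(1)] by auto
      then obtain w where w: "w \<in> G \<inter> S \<inter> ball q (min (e q) (e p - dist p q))"
        using dense[OF q(1)] by blast
      have "dist p w < e p" using w dist_triangle[of p w q] by auto
      then have "f (z p) = f w" using eq[OF p, of w] w by auto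
      moreover have "f (z q) = f w" using eq[OF q(1), of w] w by auto
      ultimately show ?thesis by simp
    qed
    moreover have "p \<in> S \<inter> ball p (e p)" using p e(1)[OF p] by simp
    ultimately show "\<exists>T. openin (top_of_set S) T \<and> p \<in> T \<and> (\<forall>q\<in>T. f (z q) = f (z p))"
      using openin_open_Int[OF open_ball, of S p "e p"] by blast
  qed
  moreover have "f (z x) = f x" "f (z y) = f y"
    using eq[of x x] eq[of y y] xy e(1) by auto
  ultimately show ?thesis
    using xy unfolding constant_on_def by (metis IntD2)
qed

text \<open>The mod 2 fundamental theorem of calculus: adding to \<open>g\<close> the jumps already passed makes it locally
  constant on the interval.\<close>

lemma jump_sum:
  fixes g :: "real \<Rightarrow> bit" and t :: "'i \<Rightarrow> real"
  assumes fin: "finite I" and inj: "inj_on t I" and t01: "\<And>i. i \<in> I \<Longrightarrow> 0 < t i \<and> t i < 1"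
    and jump: "\<And>i. i \<in> I \<Longrightarrow> \<exists>e>0. \<exists>l r. l + r = J i \<and>
        (\<forall>s\<in>{0..1}. \<bar>s - t i\<bar> < e \<longrightarrow> (s < t i \<longrightarrow> g s = l) \<and> (t i < s \<longrightarrow> g s = r))"
    and cont: "\<And>p. p \<in> {0..1} - t ` I \<Longrightarrow> \<exists>e>0. \<forall>s\<in>{0..1}. \<bar>s - p\<bar> < e \<longrightarrow> g s = g p"
  shows "g 0 + g 1 = (\<Sum>i\<in>I. J i)"
proof -
  \<comment> \<open>At each \<open>t i\<close> both summands change by \<open>J i\<close>, so \<open>h\<close> has no jumps.\<close>
  define h where "h s = g s + (\<Sum>i\<in>{i\<in>I. t i < s}. J i)" for s
  have bit2: "a + b = c" if "a = b + c" for a b c :: bit using that by (cases b; cases c) auto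
  have bit3: "a + (b + a + c) = b + c" for a b c :: bit by (cases a; cases b; cases c) auto
  have gap: "\<exists>e>0. \<forall>i\<in>I. t i \<noteq> p \<longrightarrow> e \<le> \<bar>t i - p\<bar>" for p
  proof -
    let ?D = "insert 1 ((\<lambda>i. \<bar>t i - p\<bar>) ` {i\<in>I. t i \<noteq> p})"
    have "finite ?D" using fin by auto
    then have "Min ?D > 0" "\<forall>d\<in>?D. Min ?D \<le> d"
      by (auto simp: Min_gr_iff)
    then show ?thesis by (intro exI[of _ "Min ?D"]) auto
  qed
  have "h 0 = h 1"
  proof (rule locally_constant_on_dense_imp_constant[where S = "{0..1}" and G = "- (t ` I)"])
    fix p e :: real assume p: "p \<in> {0..1}" "0 < e"
    have "p islimpt {0..1::real}"
      by (rule connected_imp_perfect) (use p in \<open>auto simp: atLeastAtMost_singleton_iff\<close>)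
    then have "infinite ({0..1} \<inter> ball p e)" using p by (simp add: islimpt_eq_infinite_ball)
    then have "infinite ({0..1} \<inter> ball p e - t ` I)" using fin by simp
    then show "\<exists>z. z \<in> - t ` I \<inter> {0..1} \<inter> ball p e"
      using infinite_imp_nonempty by blast
  next
    fix p :: real assume p: "p \<in> {0..1}"
    obtain e1 where e1: "e1 > 0" "\<forall>i\<in>I. t i \<noteq> p \<longrightarrow> e1 \<le> \<bar>t i - p\<bar>" using gap by blast
    show "\<exists>e>0. \<forall>x\<in>- t ` I \<inter> {0..1} \<inter> ball p e. \<forall>y\<in>- t ` I \<inter> {0..1} \<inter> ball p e. h x = h y"
    proof (cases "p \<in> t ` I")
      case False
      then obtain e2 where e2: "e2 > 0" "\<forall>s\<in>{0..1}. \<bar>s - p\<bar> < e2 \<longrightarrow> g s = g p"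
        using cont p by blast
      have "h x = h p" if "x \<in> {0..1} \<inter> ball p (min e1 e2)" for x
      proof -
        have "\<bar>x - p\<bar> < e1" "\<bar>x - p\<bar> < e2" using that by (auto simp: dist_real_def)
        then have "{i\<in>I. t i < x} = {i\<in>I. t i < p}"
        proof -
          have "t i < x \<longleftrightarrow> t i < p" if "i \<in> I" for i
          proof -
            have "t i \<noteq> p" using False that by blast
            then have "e1 \<le> \<bar>t i - p\<bar>" using e1 that by blast
            then show ?thesis using \<open>\<bar>x - p\<bar> < e1\<close> by linarith
          qed
          then show ?thesis by blast
        qed
        moreover have "g x = g p" using e2 that \<open>\<bar>x - p\<bar> < e2\<close> by auto
        ultimately show ?thesis by (simp add: h_def)
      qed
      then show ?thesis using e1 e2 by (intro exI[of _ "min e1 e2"]) auto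
    next
      case True
      then obtain i where i: "i \<in> I" "p = t i" by blast
      obtain e2 l r where e2: "e2 > 0" "l + r = J i"
        "\<And>s. s \<in> {0..1} \<Longrightarrow> \<bar>s - p\<bar> < e2 \<Longrightarrow> s < p \<Longrightarrow> g s = l"
        "\<And>s. s \<in> {0..1} \<Longrightarrow> \<bar>s - p\<bar> < e2 \<Longrightarrow> p < s \<Longrightarrow> g s = r"
        using jump[OF i(1)] unfolding i(2) by (elim exE conjE) blast
      let ?s = "(\<Sum>i\<in>{i\<in>I. t i < p}. J i)"
      have "h x = l + ?s" if "x \<in> - t ` I \<inter> {0..1} \<inter> ball p (min e1 e2)" for x
      proof -
        have d: "\<bar>x - p\<bar> < e1" "\<bar>x - p\<bar> < e2" using that by (auto simp: dist_real_def)
        have "x \<noteq> p" using that i by auto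
        then consider "x < p" | "p < x" by linarith
        then show ?thesis
        proof cases
          case 1
          have "{i\<in>I. t i < x} = {i\<in>I. t i < p}"
          proof -
            have "t j < x \<longleftrightarrow> t j < p" if "j \<in> I" for j
            proof (cases "t j = p")
              case False
              then have "e1 \<le> \<bar>t j - p\<bar>" using e1 that by blast
              then show ?thesis using d 1 by linarith
            qed (use 1 in simp)
            then show ?thesis by blast
          qed
          moreover have "g x = l" using e2(3) that d 1 by auto
          ultimately show ?thesis by (simp add: h_def)
        next
          case 2
          have "{j\<in>I. t j < x} = insert i {j\<in>I. t j < p}"
          proof (intro equalityI subsetI)
            fix j assume j: "j \<in> {j\<in>I. t j < x}"
            show "j \<in> insert i {j\<in>I. t j < p}"
            proof (cases "t j = p")
              case True
              then show ?thesis using inj i j by (auto dest: inj_onD)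
            next
              case False
              then have "e1 \<le> \<bar>t j - p\<bar>" using e1 j by blast
              then show ?thesis using d 2 j by auto
            qed
          qed (use 2 i in auto)
          moreover have "finite {j\<in>I. t j < p}" "i \<notin> {j\<in>I. t j < p}" using fin i by auto
          ultimately have "(\<Sum>i\<in>{i\<in>I. t i < x}. J i) = J i + ?s" by simp
          moreover have "g x = r" using e2(4) that d 2 by auto
          moreover have "r + (l + r + ?s) = l + ?s" by (rule bit3)
          ultimately show ?thesis by (simp only: h_def e2(2)[symmetric])
        qed
      qed
      then show ?thesis using e1 e2 by (intro exI[of _ "min e1 e2"]) auto
    qed
  next
    have "t i \<noteq> 0" "t i \<noteq> 1" if "i \<in> I" for i using t01[OF that] by auto
    then have "0 \<notin> t ` I" "1 \<notin> t ` I" by (metis imageE)+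
    then show "0 \<in> - t ` I \<inter> {0..1}" "1 \<in> - t ` I \<inter> {0..1}" by auto
  qed simp
  moreover have "{i\<in>I. t i < 0} = {}" "{i\<in>I. t i < 1} = I" by (auto dest: t01)
  ultimately have "g 0 = g 1 + (\<Sum>i\<in>I. J i)" by (simp only: h_def sum.empty add_0_right)
  then show ?thesis by (rule bit2)
qed

section \<open>A segment crossing the boundary of a simplex\<close>

lemma affine_independent_coords_unique:
  fixes S :: "'a::real_vector set"
  assumes "\<not> affine_dependent S" "finite S" "sum u S = sum w S"
    and "(\<Sum>v\<in>S. u v *\<^sub>R v) = (\<Sum>v\<in>S. w v *\<^sub>R v)" "v \<in> S"
  shows "u v = w v"
proof (rule ccontr)
  assume "u v \<noteq> w v"
  moreover have "sum (\<lambda>v. u v - w v) S = 0"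
    using assms(3) by (simp add: sum_subtractf)
  moreover have "(\<Sum>v\<in>S. (u v - w v) *\<^sub>R v) = 0"
    using assms(4) by (simp add: sum_subtractf scaleR_left_diff_distrib)
  ultimately have "affine_dependent S"
    using assms(2,5) by (subst affine_dependent_explicit_finite) (auto intro!: exI[of _ "\<lambda>v. u v - w v"])
  with assms(1) show False by blast
qed

text \<open>The coordinates turn statements about faces of a simplex into sign conditions, and by the first
  property they are affine functions along every segment.\<close>

lemma barycentric_coordinates:
  fixes S :: "'a::euclidean_space set"
  assumes S: "\<not> affine_dependent S" and full: "affine hull S = UNIV"
  obtains \<beta> :: "'a \<Rightarrow> 'a \<Rightarrow> real" where
    "\<And>v x y s. v \<in> S \<Longrightarrow> \<beta> v ((1 - s) *\<^sub>R x + s *\<^sub>R y) = (1 - s) * \<beta> v x + s * \<beta> v y"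
    "\<And>T x. T \<subseteq> S \<Longrightarrow> x \<in> affine hull T \<longleftrightarrow> (\<forall>v\<in>S - T. \<beta> v x = 0)"
    "\<And>T x. T \<subseteq> S \<Longrightarrow> x \<in> convex hull T \<longleftrightarrow> (\<forall>v\<in>S. 0 \<le> \<beta> v x) \<and> (\<forall>v\<in>S - T. \<beta> v x = 0)"
    "\<And>x. (\<Sum>v\<in>S. \<beta> v x) = 1"
proof -
  have fin: "finite S" using S by (rule aff_independent_finite)
  have "\<exists>u. sum u S = 1 \<and> (\<Sum>v\<in>S. u v *\<^sub>R v) = x" for x
    using full affine_hull_finite[OF fin] by blast
  then obtain U where U: "\<And>x. sum (U x) S = 1" "\<And>x. (\<Sum>v\<in>S. U x v *\<^sub>R v) = x"
    by metis
  have uniq: "u v = U x v" if "sum u S = 1" "(\<Sum>v\<in>S. u v *\<^sub>R v) = x" "v \<in> S" for u x v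
    by (rule affine_independent_coords_unique[OF S fin]) (use U that in auto)
  have extend: "\<exists>w. sum w S = sum u T \<and> (\<Sum>v\<in>S. w v *\<^sub>R v) = (\<Sum>v\<in>T. u v *\<^sub>R v) \<and>
      (\<forall>v\<in>T. w v = u v) \<and> (\<forall>v\<in>S-T. w v = 0)" if "T \<subseteq> S" for T and u :: "'a \<Rightarrow> real"
  proof (intro exI conjI)
    let ?w = "\<lambda>v. if v \<in> T then u v else 0"
    show "sum ?w S = sum u T"
      using that fin by (intro sum.mono_neutral_cong_right) auto
    show "(\<Sum>v\<in>S. ?w v *\<^sub>R v) = (\<Sum>v\<in>T. u v *\<^sub>R v)"
      using that fin by (intro sum.mono_neutral_cong_right) auto
  qed auto
  have restrict: "sum (U x) T = 1 \<and> (\<Sum>v\<in>T. U x v *\<^sub>R v) = x"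
    if "T \<subseteq> S" "\<forall>v\<in>S-T. U x v = 0" for T x
  proof
    show "sum (U x) T = 1"
      unfolding U(1)[of x, symmetric] using that fin by (intro sum.mono_neutral_left) auto
    have "(\<Sum>v\<in>T. U x v *\<^sub>R v) = (\<Sum>v\<in>S. U x v *\<^sub>R v)"
      using that fin by (intro sum.mono_neutral_left) auto
    then show "(\<Sum>v\<in>T. U x v *\<^sub>R v) = x" by (simp only: U(2))
  qed
  show ?thesis
  proof
    fix v x y and s :: real assume v: "v \<in> S"
    show "U ((1 - s) *\<^sub>R x + s *\<^sub>R y) v = (1 - s) * U x v + s * U y v"
    proof (rule uniq[symmetric, OF _ _ v])
      show "(\<Sum>v\<in>S. (1 - s) * U x v + s * U y v) = 1"
        by (simp add: sum.distrib sum_distrib_left[symmetric] U(1))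
      show "(\<Sum>v\<in>S. ((1 - s) * U x v + s * U y v) *\<^sub>R v) = (1 - s) *\<^sub>R x + s *\<^sub>R y"
        by (simp add: scaleR_left_distrib sum.distrib flip: scaleR_scaleR scaleR_sum_right)
          (simp only: U(2))
    qed
  next
    fix T x assume T: "T \<subseteq> S"
    have finT: "finite T" using T fin finite_subset by blast
    show "x \<in> affine hull T \<longleftrightarrow> (\<forall>v\<in>S - T. U x v = 0)"
    proof
      assume "x \<in> affine hull T"
      then obtain u where u: "sum u T = 1" "(\<Sum>v\<in>T. u v *\<^sub>R v) = x"
        using affine_hull_finite[OF finT] by blast
      from extend[OF T, of u] obtain w where
        "sum w S = 1" "(\<Sum>v\<in>S. w v *\<^sub>R v) = x" "\<forall>v\<in>S-T. w v = 0" unfolding u by blast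
      then show "\<forall>v\<in>S - T. U x v = 0" using uniq by (metis DiffD1)
    next
      assume "\<forall>v\<in>S - T. U x v = 0"
      from restrict[OF T this] show "x \<in> affine hull T"
        unfolding affine_hull_finite[OF finT] by blast
    qed
    show "x \<in> convex hull T \<longleftrightarrow> (\<forall>v\<in>S. 0 \<le> U x v) \<and> (\<forall>v\<in>S - T. U x v = 0)"
    proof
      assume "x \<in> convex hull T"
      then obtain u where u: "sum u T = 1" "(\<Sum>v\<in>T. u v *\<^sub>R v) = x" "\<forall>v\<in>T. 0 \<le> u v"
        using convex_hull_finite[OF finT] by blast
      from extend[OF T, of u] obtain w where w:
        "sum w S = 1" "(\<Sum>v\<in>S. w v *\<^sub>R v) = x" "\<forall>v\<in>S-T. w v = 0" "\<forall>v\<in>T. w v = u v"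
        unfolding u(1,2) by blast
      then have "\<forall>v\<in>S. 0 \<le> w v" using u(3) by (metis Diff_iff order_refl)
      then show "(\<forall>v\<in>S. 0 \<le> U x v) \<and> (\<forall>v\<in>S - T. U x v = 0)"
        using uniq[OF w(1,2)] w(3) by (metis DiffD1)
    next
      assume "(\<forall>v\<in>S. 0 \<le> U x v) \<and> (\<forall>v\<in>S - T. U x v = 0)"
      moreover from this restrict[OF T] have "sum (U x) T = 1 \<and> (\<Sum>v\<in>T. U x v *\<^sub>R v) = x" by blast
      ultimately show "x \<in> convex hull T"
        unfolding convex_hull_finite[OF finT] using T by blast
    qed
  qed (use U in auto)
qed

text \<open>In barycentric coordinates along the segment, the indicator of the simplex changes only where a
  coordinate vanishes while the others are nonnegative. There all others are positive, because the segment
  misses the faces of codimension two, and the vanishing coordinate changes sign, because it does not vanish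
  at the ends.\<close>

lemma simplex_crossing:
  fixes S :: "'a::euclidean_space set"
  assumes S: "\<not> affine_dependent S" and full: "affine hull S = UNIV"
    and miss: "\<And>T. T \<subseteq> S \<Longrightarrow> card T + 2 \<le> card S \<Longrightarrow> convex hull T \<inter> closed_segment x y = {}"
    and x: "\<And>v. v \<in> S \<Longrightarrow> x \<notin> affine hull (S - {v})"
    and y: "\<And>v. v \<in> S \<Longrightarrow> y \<notin> affine hull (S - {v})"
  shows "of_bool (x \<in> convex hull S) + of_bool (y \<in> convex hull S) =
    (\<Sum>v\<in>{v\<in>S. convex hull (S - {v}) \<inter> closed_segment x y \<noteq> {}}. 1 :: bit)"
proof -
  obtain \<beta> where \<beta>: "\<And>v x y s. v \<in> S \<Longrightarrow> \<beta> v ((1 - s) *\<^sub>R x + s *\<^sub>R y) = (1 - s) * \<beta> v x + s * \<beta> v y"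
    and aff: "\<And>T x. T \<subseteq> S \<Longrightarrow> x \<in> affine hull T \<longleftrightarrow> (\<forall>v\<in>S - T. \<beta> v x = 0)"
    and conv: "\<And>T x. T \<subseteq> S \<Longrightarrow> x \<in> convex hull T \<longleftrightarrow> (\<forall>v\<in>S. 0 \<le> \<beta> v x) \<and> (\<forall>v\<in>S - T. \<beta> v x = 0)"
    and "\<And>x. (\<Sum>v\<in>S. \<beta> v x) = 1"
    by (rule barycentric_coordinates[OF S full]; rule that)
  have fin: "finite S" using S by (rule aff_independent_finite)
  define p where "p s = (1 - s) *\<^sub>R x + s *\<^sub>R y" for s
  define k where "k v = \<beta> v y - \<beta> v x" for v
  have b: "\<beta> v (p s) = \<beta> v x + s * k v" if "v \<in> S" for v s
    using \<beta>[OF that, of s x y] by (simp add: p_def k_def algebra_simps)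
  have p01: "p 0 = x" "p 1 = y" by (auto simp: p_def)
  have ends: "\<beta> v x \<noteq> 0" "\<beta> v y \<noteq> 0" if "v \<in> S" for v
    using x[OF that] y[OF that] aff[of "S - {v}"] that by auto
  have seg: "p s \<in> closed_segment x y" if "s \<in> {0..1}" for s
    using that unfolding p_def closed_segment_def by auto
  have facet: "p s \<in> convex hull (S - {v}) \<longleftrightarrow> (\<forall>w\<in>S. 0 \<le> \<beta> w (p s)) \<and> \<beta> v (p s) = 0" if "v \<in> S" for v s
    using conv[of "S - {v}" "p s"] that by auto
  define I where "I = {v\<in>S. convex hull (S - {v}) \<inter> closed_segment x y \<noteq> {}}"
  have "\<exists>t\<in>{0..1}. p t \<in> convex hull (S - {v})" if "v \<in> I" for v
    using that unfolding I_def closed_segment_def p_def by auto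
  then obtain t where t: "\<And>v. v \<in> I \<Longrightarrow> t v \<in> {0..1}" "\<And>v. v \<in> I \<Longrightarrow> p (t v) \<in> convex hull (S - {v})"
    by metis
  have IS: "v \<in> S" if "v \<in> I" for v using that by (simp add: I_def)
  have zero: "\<beta> v (p (t v)) = 0" if "v \<in> I" for v
    using t(2)[OF that] facet[OF IS[OF that]] by blast
  have nz: "k v \<noteq> 0" if "v \<in> I" for v
    using zero[OF that] b[OF IS[OF that], of "t v"] ends[OF IS[OF that]] by auto
  \<comment> \<open>A second vanishing coordinate would put the crossing point on a face of codimension two.\<close>
  have pos: "0 < \<beta> w (p (t v))" if "v \<in> I" "w \<in> S" "w \<noteq> v" for v w
  proof -
    have "0 \<le> \<beta> w (p (t v))" using t(2)[OF that(1)] facet[OF IS[OF that(1)]] that by blast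
    moreover have "\<beta> w (p (t v)) \<noteq> 0"
    proof
      assume "\<beta> w (p (t v)) = 0"
      then have "p (t v) \<in> convex hull (S - {v, w})"
        using conv[of "S - {v, w}" "p (t v)"] t(2)[OF that(1)] facet[OF IS[OF that(1)]] by auto
      moreover have "card (S - {v, w}) + 2 \<le> card S"
        using card_Diff_subset[of "{v, w}" S] card_mono[of S "{v, w}"] that fin IS by auto
      ultimately show False using miss[of "S - {v, w}"] seg[OF t(1)[OF that(1)]] by blast
    qed
    ultimately show ?thesis by simp
  qed
  define g :: "real \<Rightarrow> bit" where "g s = of_bool (\<forall>v\<in>S. 0 \<le> \<beta> v (p s))" for s
  have cont: "continuous_on UNIV (\<lambda>s. \<beta> v (p s))" if "v \<in> S" for v
    unfolding b[OF that] by (intro continuous_intros)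
  have near: "\<exists>e>0. \<forall>s. \<bar>s - q\<bar> < e \<longrightarrow> (\<forall>w\<in>W. 0 < \<beta> w (p s))"
    if "W \<subseteq> S" "\<forall>w\<in>W. 0 < \<beta> w (p q)" for W q
  proof -
    have "open (\<Inter>w\<in>W. {s. 0 < \<beta> w (p s)})"
      using that fin finite_subset[of W S]
      by (intro open_INT ballI open_Collect_less cont) auto
    moreover have "q \<in> (\<Inter>w\<in>W. {s. 0 < \<beta> w (p s)})" using that by auto
    ultimately obtain e where "e > 0" "\<forall>s. dist s q < e \<longrightarrow> s \<in> (\<Inter>w\<in>W. {s. 0 < \<beta> w (p s)})"
      unfolding open_dist by blast
    then show ?thesis by (intro exI[of _ e]) (auto simp: dist_real_def)
  qed
  have "g 0 + g 1 = (\<Sum>v\<in>I. 1)"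
  proof (rule jump_sum[where t = t])
    show "finite I" using fin by (simp add: I_def)
    show "inj_on t I"
    proof (rule inj_onI, rule ccontr)
      fix v w assume vw: "v \<in> I" "w \<in> I" "t v = t w" "v \<noteq> w"
      then show False using pos[OF vw(1) IS[OF vw(2)]] zero[OF vw(2)] by auto
    qed
    show "0 < t v \<and> t v < 1" if "v \<in> I" for v
    proof -
      have "t v \<noteq> 0" "t v \<noteq> 1"
        using zero[OF that] ends[OF IS[OF that]] p01 by metis+
      then show ?thesis using t(1)[OF that] by auto
    qed
    show "\<exists>e>0. \<exists>l r. l + r = (1::bit) \<and> (\<forall>s\<in>{0..1}. \<bar>s - t v\<bar> < e \<longrightarrow> (s < t v \<longrightarrow> g s = l) \<and> (t v < s \<longrightarrow> g s = r))"
      if v: "v \<in> I" for v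
    proof -
      obtain e where e: "e > 0" "\<And>s w. \<bar>s - t v\<bar> < e \<Longrightarrow> w \<in> S - {v} \<Longrightarrow> 0 < \<beta> w (p s)"
        using near[of "S - {v}" "t v"] pos[OF v] by auto
      \<comment> \<open>Near the crossing only the coordinate of \<open>v\<close> decides membership, and it is linear with slope \<open>k v\<close>.\<close>
      have bv: "\<beta> v (p s) = (s - t v) * k v" for s
        using b[OF IS[OF v], of s] b[OF IS[OF v], of "t v"] zero[OF v] by (simp add: algebra_simps)
      have gs: "g s = of_bool (0 \<le> (s - t v) * k v)" if "\<bar>s - t v\<bar> < e" for s
      proof -
        have "(\<forall>w\<in>S. 0 \<le> \<beta> w (p s)) \<longleftrightarrow> 0 \<le> \<beta> v (p s)"
          using e(2)[OF that] IS[OF v] by (metis Diff_iff less_imp_le singletonD)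
        then show ?thesis by (simp add: g_def bv)
      qed
      show ?thesis
      proof (cases "0 < k v")
        case True
        then show ?thesis using e(1) gs
          by (intro exI[of _ e] conjI exI[of _ 0] exI[of _ 1]) (auto simp: zero_le_mult_iff)
      next
        case False
        then have "k v < 0" using nz[OF v] by simp
        then show ?thesis using e(1) gs
          by (intro exI[of _ e] conjI exI[of _ 1] exI[of _ 0]) (auto simp: zero_le_mult_iff)
      qed
    qed
    show "\<exists>e>0. \<forall>s\<in>{0..1}. \<bar>s - q\<bar> < e \<longrightarrow> g s = g q" if q: "q \<in> {0..1} - t ` I" for q
    proof (cases "\<exists>w\<in>S. \<beta> w (p q) < 0")
      case True
      then obtain w where w: "w \<in> S" "\<beta> w (p q) < 0" by blast
      have "open {s. \<beta> w (p s) < 0}" by (intro open_Collect_less cont w continuous_intros)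
      then obtain e where e: "e > 0" "\<forall>s. dist s q < e \<longrightarrow> \<beta> w (p s) < 0"
        unfolding open_dist using w(2) by blast
      have "g s = 0" if "\<beta> w (p s) < 0" for s
      proof -
        have "\<not> (\<forall>v\<in>S. 0 \<le> \<beta> v (p s))" using that w(1) not_le by blast
        then show ?thesis by (simp only: g_def of_bool_eq)
      qed
      with w(2) e show ?thesis by (intro exI[of _ e]) (auto simp: dist_real_def)
    next
      case False
      have "0 < \<beta> w (p q)" if w: "w \<in> S" for w
      proof -
        have "\<beta> w (p q) \<noteq> 0"
        proof
          assume 0: "\<beta> w (p q) = 0"
          then have "p q \<in> convex hull (S - {w})" using facet[OF w] False by force
          then have "w \<in> I" using w seg[of q] q by (auto simp: I_def)
          moreover from this have "q * k w = t w * k w"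
            using zero[of w] 0 b[OF w, of q] b[OF w, of "t w"] by linarith
          ultimately have "w \<in> I" "q = t w" using nz by auto
          then show False using q by blast
        qed
        then show ?thesis using False w by force
      qed
      then obtain e where "e > 0" "\<forall>s. \<bar>s - q\<bar> < e \<longrightarrow> (\<forall>w\<in>S. 0 < \<beta> w (p s))"
        using near[of S q] by blast
      moreover have "g s = 1" if "\<forall>w\<in>S. 0 < \<beta> w (p s)" for s
        using that by (auto simp: g_def less_imp_le)
      ultimately show ?thesis by (intro exI[of _ e]) auto
    qed
  qed
  moreover have "g 0 = of_bool (x \<in> convex hull S)" "g 1 = of_bool (y \<in> convex hull S)"
    using conv[of S x] conv[of S y] by (auto simp: g_def p01)
  ultimately show ?thesis unfolding I_def by simp
qed

section \<open>Geometric complexes given by their vertex sets\<close>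

text \<open>Working with vertex sets instead of convex polytopes makes faces and intersections into plain set
  theory; \<open>geometric_complex_vertex_scheme\<close> is the bridge.\<close>

definition geometric_complex :: "'a::euclidean_space set set \<Rightarrow> bool" where
  "geometric_complex A \<longleftrightarrow> finite A \<and> (\<forall>\<sigma>\<in>A. \<not> affine_dependent \<sigma>) \<and>
     (\<forall>\<sigma>\<in>A. \<forall>\<tau>. \<tau> \<subseteq> \<sigma> \<longrightarrow> \<tau> \<in> A) \<and>
     (\<forall>\<sigma>\<in>A. \<forall>\<tau>\<in>A. convex hull \<sigma> \<inter> convex hull \<tau> \<subseteq> convex hull (\<sigma> \<inter> \<tau>))"

definition body :: "'a::euclidean_space set set \<Rightarrow> 'a set" where
  "body A = (\<Union>\<sigma>\<in>A. convex hull \<sigma>)"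

lemma geometric_complexD:
  assumes "geometric_complex A"
  shows "finite A" "\<sigma> \<in> A \<Longrightarrow> \<not> affine_dependent \<sigma>" "\<sigma> \<in> A \<Longrightarrow> finite \<sigma>"
    "\<sigma> \<in> A \<Longrightarrow> \<tau> \<subseteq> \<sigma> \<Longrightarrow> \<tau> \<in> A"
    "\<sigma> \<in> A \<Longrightarrow> \<tau> \<in> A \<Longrightarrow> x \<in> convex hull \<sigma> \<Longrightarrow> x \<in> convex hull \<tau> \<Longrightarrow> x \<in> convex hull (\<sigma> \<inter> \<tau>)"
proof -
  have A: "finite A" "\<forall>\<sigma>\<in>A. \<not> affine_dependent \<sigma>" "\<forall>\<sigma>\<in>A. \<forall>\<tau>. \<tau> \<subseteq> \<sigma> \<longrightarrow> \<tau> \<in> A"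
     "\<forall>\<sigma>\<in>A. \<forall>\<tau>\<in>A. convex hull \<sigma> \<inter> convex hull \<tau> \<subseteq> convex hull (\<sigma> \<inter> \<tau>)"
    using assms unfolding geometric_complex_def by blast+
  show "finite A" by (rule A)
  show "\<sigma> \<in> A \<Longrightarrow> \<not> affine_dependent \<sigma>" using A(2) by blast
  then show "\<sigma> \<in> A \<Longrightarrow> finite \<sigma>" by (blast intro: aff_independent_finite)
  show "\<sigma> \<in> A \<Longrightarrow> \<tau> \<subseteq> \<sigma> \<Longrightarrow> \<tau> \<in> A" using A(3) by blast
  show "\<sigma> \<in> A \<Longrightarrow> \<tau> \<in> A \<Longrightarrow> x \<in> convex hull \<sigma> \<Longrightarrow> x \<in> convex hull \<tau> \<Longrightarrow> x \<in> convex hull (\<sigma> \<inter> \<tau>)"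
    using A(4) by blast
qed

lemma simplicial_complex_vertices:
  assumes "simplicial_complex C" "S \<in> C"
  shows "\<not> affine_dependent {v. v extreme_point_of S}" "convex hull {v. v extreme_point_of S} = S"
proof -
  obtain n where "n simplex S" using assms by (auto simp: simplicial_complex_def)
  then obtain V where V: "\<not> affine_dependent V" "S = convex hull V" by (auto simp: simplex_def)
  then have "{v. v extreme_point_of S} = V"
    by (simp add: extreme_point_of_convex_hull_affine_independent)
  then show "\<not> affine_dependent {v. v extreme_point_of S}" "convex hull {v. v extreme_point_of S} = S"
    using V by auto
qed

lemma geometric_complex_vertex_scheme:
  fixes C :: "'a::euclidean_space set set"
  assumes C: "simplicial_complex C"
  shows "geometric_complex (vertex_scheme C)"
proof -
  define V where "V S = {v. v extreme_point_of S}" for S :: "'a set"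
  have vs: "vertex_scheme C = V ` C" by (simp add: vertex_scheme_def V_def)
  have V: "\<not> affine_dependent (V S)" "convex hull (V S) = S" if "S \<in> C" for S
    using simplicial_complex_vertices[OF C that] by (simp_all add: V_def)
  have face: "\<exists>\<rho>\<subseteq>V S. F = convex hull \<rho>" if "S \<in> C" "F face_of S" for F S
    using face_of_convex_hull_affine_independent[OF V(1)[OF that(1)], of F] that V(2)[OF that(1)] by auto
  have Vhull: "V (convex hull \<rho>) = \<rho>" if "\<rho> \<subseteq> V S" "S \<in> C" for \<rho> S
    using extreme_point_of_convex_hull_affine_independent[of \<rho>] affine_dependent_subset[OF _ that(1)] V(1)[OF that(2)]
    by (auto simp: V_def)
  have "\<tau> \<in> V ` C" if S: "S \<in> C" and \<tau>: "\<tau> \<subseteq> V S" for S \<tau>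
  proof -
    have "convex hull \<tau> face_of convex hull (V S)"
      using face_of_convex_hull_affine_independent[OF V(1)[OF S]] \<tau> by blast
    then have "convex hull \<tau> face_of S" by (simp only: V(2)[OF S])
    then have "convex hull \<tau> \<in> C" using C S unfolding simplicial_complex_def by blast
    then show ?thesis using Vhull[OF \<tau> S] by (metis imageI)
  qed
  moreover have "S \<inter> S' \<subseteq> convex hull (V S \<inter> V S')" if SS: "S \<in> C" "S' \<in> C" for S S'
  proof -
    have "S \<inter> S' face_of S" "S \<inter> S' face_of S'"
      using C SS unfolding simplicial_complex_def by (blast, metis Int_commute)
    then obtain \<rho> \<rho>' where "\<rho> \<subseteq> V S" "S \<inter> S' = convex hull \<rho>" "\<rho>' \<subseteq> V S'" "S \<inter> S' = convex hull \<rho>'"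
      using face SS by meson
    moreover from this have "\<rho> = \<rho>'" using Vhull SS by metis
    ultimately show ?thesis by (simp add: hull_mono)
  qed
  ultimately show ?thesis
    using C unfolding geometric_complex_def vs simplicial_complex_def by (auto simp: V)
qed

lemma body_vertex_scheme:
  assumes "simplicial_complex C"
  shows "body (vertex_scheme C) = \<Union>C"
  using simplicial_complex_vertices(2)[OF assms] by (auto simp: body_def vertex_scheme_def)

lemma simplex_carrier:
  fixes \<sigma> :: "'a::euclidean_space set"
  assumes "\<not> affine_dependent \<sigma>" "x \<in> convex hull \<sigma>"
  shows "\<exists>\<tau>\<subseteq>\<sigma>. x \<in> rel_interior (convex hull \<tau>)"
proof -
  have fin: "finite \<sigma>" using assms aff_independent_finite by blast
  then obtain u where u: "\<forall>v\<in>\<sigma>. 0 \<le> u v" "sum u \<sigma> = 1" "(\<Sum>v\<in>\<sigma>. u v *\<^sub>R v) = x"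
    using assms(2) by (auto simp: convex_hull_finite)
  define \<tau> where "\<tau> = {v\<in>\<sigma>. 0 < u v}"
  have \<tau>: "\<tau> \<subseteq> \<sigma>" "\<forall>v\<in>\<sigma>-\<tau>. u v = 0" using u(1) by (auto simp: \<tau>_def less_le)
  have "\<not> affine_dependent \<tau>" using assms(1) \<tau>(1) affine_dependent_subset by blast
  moreover have "sum u \<tau> = 1"
    unfolding u(2)[symmetric] using \<tau> fin by (intro sum.mono_neutral_left) auto
  moreover have "(\<Sum>v\<in>\<tau>. u v *\<^sub>R v) = x"
    unfolding u(3)[symmetric] using \<tau> fin by (intro sum.mono_neutral_left) auto
  ultimately have "x \<in> rel_interior (convex hull \<tau>)"
    by (auto simp: rel_interior_convex_hull_explicit \<tau>_def intro!: exI[of _ u])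
  with \<tau>(1) show ?thesis by blast
qed

lemma body_carrier:
  assumes "geometric_complex A" "x \<in> body A"
  obtains \<tau> where "\<tau> \<in> A" "x \<in> rel_interior (convex hull \<tau>)"
  using assms simplex_carrier geometric_complexD(2,4)[OF assms(1)] unfolding body_def by (metis UN_E)

text \<open>This is how incidences are read off from points: the simplex whose relative interior contains \<open>x\<close> is a
  face of every simplex that contains \<open>x\<close>.\<close>

lemma carrier_subset:
  assumes A: "geometric_complex A" and \<sigma>: "\<sigma> \<in> A" and \<tau>: "\<tau> \<in> A"
    and x: "x \<in> rel_interior (convex hull \<tau>)" "x \<in> convex hull \<sigma>"
  shows "\<tau> \<subseteq> \<sigma>"
proof -
  have ind: "\<not> affine_dependent \<tau>" using A \<tau> by (rule geometric_complexD)
  have "x \<in> convex hull (\<sigma> \<inter> \<tau>)"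
    using geometric_complexD(5)[OF A \<sigma> \<tau> x(2)] x(1) rel_interior_subset by blast
  moreover have "convex hull (\<sigma> \<inter> \<tau>) face_of convex hull \<tau>"
    using face_of_convex_hull_affine_independent[OF ind] by blast
  ultimately have "convex hull (\<sigma> \<inter> \<tau>) = convex hull \<tau>"
    using face_of_disjoint_rel_interior x(1) by blast
  moreover have "\<not> affine_dependent (\<sigma> \<inter> \<tau>)"
    using ind affine_dependent_subset inf_le2 by blast
  ultimately have "\<sigma> \<inter> \<tau> = \<tau>"
    using extreme_point_of_convex_hull_affine_independent ind by (metis subsetI subset_antisym)
  then show ?thesis by blast
qed

text \<open>The star of a point: the simplices that do not contain the carrier of \<open>x\<close> form a closed set avoiding \<open>x\<close>.\<close>

lemma near_carrier:
  assumes A: "geometric_complex A" and "\<tau> \<in> A" and x: "x \<in> rel_interior (convex hull \<tau>)"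
  obtains e where "e > 0" "\<And>\<sigma> y. \<sigma> \<in> A \<Longrightarrow> y \<in> convex hull \<sigma> \<Longrightarrow> dist x y < e \<Longrightarrow> \<tau> \<subseteq> \<sigma>"
proof -
  let ?U = "- (\<Union>\<sigma>\<in>{\<sigma>\<in>A. \<not> \<tau> \<subseteq> \<sigma>}. convex hull \<sigma>)"
  have "closed (convex hull \<sigma>)" if "\<sigma> \<in> A" for \<sigma>
    using geometric_complexD(3)[OF A that] by (simp add: finite_imp_compact_convex_hull compact_imp_closed)
  then have "open ?U" using geometric_complexD(1)[OF A] by (intro open_Compl closed_UN) auto
  moreover have "x \<in> ?U" using carrier_subset[OF A _ assms(2) x] by blast
  ultimately obtain e where e: "e > 0" "ball x e \<subseteq> ?U" by (rule openE)
  show ?thesis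
  proof (rule that[OF e(1)])
    fix \<sigma> y assume "\<sigma> \<in> A" "y \<in> convex hull \<sigma>" "dist x y < e"
    then show "\<tau> \<subseteq> \<sigma>" using e(2) by (auto simp: subset_iff)
  qed
qed

lemma closed_body:
  assumes "geometric_complex A"
  shows "closed (body A)"
  unfolding body_def using geometric_complexD(1,3)[OF assms]
  by (intro closed_UN ballI) (auto simp: finite_imp_compact_convex_hull compact_imp_closed)

lemma hull_subset_body: "\<sigma> \<in> A \<Longrightarrow> convex hull \<sigma> \<subseteq> body A"
  unfolding body_def by blast

lemma rel_interior_subset_body: "\<sigma> \<in> A \<Longrightarrow> rel_interior (convex hull \<sigma>) \<subseteq> body A"
  by (rule subset_trans[OF rel_interior_subset hull_subset_body])

lemma aff_dim_face:
  assumes "geometric_complex A" "\<sigma> \<in> A"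
  shows "aff_dim \<sigma> = int (card \<sigma>) - 1"
  using aff_dim_affine_independent[OF geometric_complexD(2)[OF assms]] by simp

lemma not_in_affine_hull_insert:
  assumes "geometric_complex A" "insert v \<tau> \<in> A" "v \<notin> \<tau>"
  shows "v \<notin> affine hull \<tau>"
  using geometric_complexD(2)[OF assms(1,2)] assms(3) affine_dependent_def[of "insert v \<tau>"]
  by (metis Diff_insert_absorb insertI1)

lemma affine_diff_mem:
  fixes b :: "'a::real_vector"
  assumes "affine G" "b \<in> G" "x \<in> G" "y \<in> G"
  shows "b + r *\<^sub>R (x - b) + s *\<^sub>R (y - b) \<in> G"
proof -
  have "(1 - r - s) *\<^sub>R b + r *\<^sub>R x + s *\<^sub>R y \<in> G"
    using assms(1) mem_affine_3[OF assms, of "1 - r - s" r s] by simp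
  also have "(1 - r - s) *\<^sub>R b + r *\<^sub>R x + s *\<^sub>R y = b + r *\<^sub>R (x - b) + s *\<^sub>R (y - b)"
    by (simp add: algebra_simps)
  finally show ?thesis .
qed

text \<open>Coordinates in the span of \<open>T\<close> and \<open>q\<close>: a direction \<open>l\<close> along \<open>T\<close> and a multiple of the direction from \<open>b\<close>
  to \<open>q\<close>.\<close>

lemma affine_hull_insert_coords:
  fixes b :: "'a::real_vector"
  assumes b: "b \<in> affine hull T" and y: "y \<in> affine hull (insert q T)"
  obtains l s where "b + l \<in> affine hull T" "y - b = l + s *\<^sub>R (q - b)"
proof -
  have "affine hull (insert q T) \<subseteq> {y. \<exists>l s. b + l \<in> affine hull T \<and> y - b = l + s *\<^sub>R (q - b)}" (is "_ \<subseteq> ?H")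
  proof (rule hull_minimal)
    show "insert q T \<subseteq> ?H"
    proof (intro subsetI CollectI)
      fix x assume "x \<in> insert q T"
      then show "\<exists>l s. b + l \<in> affine hull T \<and> x - b = l + s *\<^sub>R (q - b)"
      proof
        assume "x = q"
        then show ?thesis using b by (intro exI[of _ 0] exI[of _ 1]) auto
      next
        assume "x \<in> T"
        then show ?thesis by (intro exI[of _ "x - b"] exI[of _ 0]) (auto simp: hull_inc)
      qed
    qed
    show "affine ?H" unfolding affine_def[of ?H]
    proof (intro ballI allI impI CollectI)
      fix x y and u v :: real assume "x \<in> ?H" "y \<in> ?H" and uv: "u + v = 1"
      then obtain l s l' s' where l: "b + l \<in> affine hull T" "x - b = l + s *\<^sub>R (q - b)"
        "b + l' \<in> affine hull T" "y - b = l' + s' *\<^sub>R (q - b)" by blast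
      have "b + (u *\<^sub>R l + v *\<^sub>R l') \<in> affine hull T"
        using affine_diff_mem[OF affine_affine_hull b l(1,3), of u v] by (simp add: add.assoc)
      moreover have "u *\<^sub>R x + v *\<^sub>R y - b = u *\<^sub>R (x - b) + v *\<^sub>R (y - b)"
      proof -
        have "b = u *\<^sub>R b + v *\<^sub>R b" using uv by (simp flip: scaleR_left_distrib)
        then show ?thesis by (simp add: algebra_simps)
      qed
      then have "u *\<^sub>R x + v *\<^sub>R y - b = (u *\<^sub>R l + v *\<^sub>R l') + (u * s + v * s') *\<^sub>R (q - b)"
        unfolding l by (simp add: scaleR_add_right scaleR_add_left algebra_simps)
      ultimately show "\<exists>l s. b + l \<in> affine hull T \<and> u *\<^sub>R x + v *\<^sub>R y - b = l + s *\<^sub>R (q - b)" by blast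
    qed
  qed
  with y show ?thesis using that by blast
qed

text \<open>Near a relative interior point \<open>x\<close> of \<open>\<tau>\<close>, the simplex on \<open>\<tau>\<close> and \<open>v\<close> looks like a half-space bounded by
  \<open>\<tau>\<close>; so a short step in any direction into this half-space stays in the simplex.\<close>

lemma rel_interior_ray:
  fixes x :: "'a::euclidean_space"
  assumes x: "x \<in> rel_interior (convex hull \<tau>)" and l: "x + l \<in> affine hull \<tau>" and s: "0 \<le> s"
  obtains e where "e > 0" "\<And>r. 0 \<le> r \<Longrightarrow> r \<le> e \<Longrightarrow> x + r *\<^sub>R (l + s *\<^sub>R (v - x)) \<in> convex hull (insert v \<tau>)"
proof -
  obtain d where d: "d > 0" "ball x d \<inter> affine hull \<tau> \<subseteq> convex hull \<tau>" "x \<in> convex hull \<tau>"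
    using x unfolding mem_rel_interior_ball by auto
  \<comment> \<open>The end point is the midpoint of a point of \<open>\<tau>\<close> and a point of the segment from \<open>x\<close> to \<open>v\<close>, both reached
    with twice the step.\<close>
  define e where "e = min (d / (4 * (norm l + 1))) (1 / (2 * (s + 1)))"
  have pos: "0 < norm l + 1" using norm_ge_zero[of l] by linarith
  have e: "e > 0" using d(1) s pos unfolding e_def by simp
  show ?thesis
  proof (rule that[OF e])
    fix r :: real assume r: "0 \<le> r" "r \<le> e"
    have "2 * r * norm l \<le> 2 * e * norm l" using r by (intro mult_right_mono) auto
    also have "\<dots> < 4 * e * (norm l + 1)" 
    proof -
      have "0 \<le> e * norm l" using e by simp
      moreover have "4 * e * (norm l + 1) = 4 * (e * norm l) + 4 * e" "2 * e * norm l = 2 * (e * norm l)"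
        by (simp_all add: algebra_simps)
      ultimately show ?thesis using e by linarith
    qed
    also have "\<dots> \<le> 4 * (d / (4 * (norm l + 1))) * (norm l + 1)"
      using pos unfolding e_def by (intro mult_right_mono mult_left_mono) auto
    also have "\<dots> = d" using pos by (simp add: field_simps)
    finally have "x + (2 * r) *\<^sub>R l \<in> ball x d" using r by (simp add: dist_norm)
    moreover have "x + (2 * r) *\<^sub>R l \<in> affine hull \<tau>"
      using affine_diff_mem[OF affine_affine_hull _ l l, of x "2 * r" 0] d(3)
        convex_hull_subset_affine_hull by auto
    ultimately have 1: "x + (2 * r) *\<^sub>R l \<in> convex hull (insert v \<tau>)"
      using d(2) hull_mono[of \<tau> "insert v \<tau>" convex] by blast
    have "2 * r * s \<le> 2 * (1 / (2 * (s + 1))) * s"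
      using r s unfolding e_def by (intro mult_right_mono mult_left_mono) auto
    also have "\<dots> \<le> 1" using s by (simp add: field_simps)
    finally have "2 * r * s \<le> 1" .
    then have 2: "(1 - 2 * r * s) *\<^sub>R x + (2 * r * s) *\<^sub>R v \<in> convex hull (insert v \<tau>)"
      using d(3) hull_mono[of \<tau> "insert v \<tau>" convex] r s
      by (intro convexD[OF convex_convex_hull]) (auto simp: hull_inc)
    have "(1/2) *\<^sub>R (x + (2 * r) *\<^sub>R l) + (1/2) *\<^sub>R ((1 - 2 * r * s) *\<^sub>R x + (2 * r * s) *\<^sub>R v) \<in> convex hull (insert v \<tau>)"
      by (rule convexD[OF convex_convex_hull 1 2]) auto
    also have "(1/2) *\<^sub>R (x + (2 * r) *\<^sub>R l) + (1/2) *\<^sub>R ((1 - 2 * r * s) *\<^sub>R x + (2 * r * s) *\<^sub>R v)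
        = x + r *\<^sub>R (l + s *\<^sub>R (v - x))"
      by (simp add: algebra_simps flip: scaleR_left_distrib)
    finally show "x + r *\<^sub>R (l + s *\<^sub>R (v - x)) \<in> convex hull (insert v \<tau>)" .
  qed
qed

section \<open>The simplices around a face of codimension one\<close>

definition cofaces :: "'v set set \<Rightarrow> nat \<Rightarrow> 'v set \<Rightarrow> 'v set set" where
  "cofaces K d \<tau> = {\<sigma> \<in> faces K d. \<tau> \<subseteq> \<sigma>}"

text \<open>Chains as functions on vertex sets of an arbitrary type, so that complexes in different Euclidean spaces
  can be compared. The face \<open>\<tau> = {}\<close> is left out in agreement with \<^const>\<open>bdry\<close>.\<close>

definition cycle_on :: "'v set set \<Rightarrow> nat \<Rightarrow> ('v set \<Rightarrow> bit) \<Rightarrow> bool" where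
  "cycle_on K d c \<longleftrightarrow> (\<forall>\<tau>\<in>K. \<tau> \<noteq> {} \<and> card \<tau> = d \<longrightarrow> (\<Sum>\<sigma>\<in>cofaces K d \<tau>. c \<sigma>) = 0)"

text \<open>The vector \<open>u\<close>, attached at a point \<open>b\<close> of \<open>\<tau>\<close>, points from \<open>\<tau>\<close> into the side of the simplex with the
  additional vertex \<open>v\<close>, up to a vector parallel to \<open>\<tau>\<close>.\<close>

definition heads_into :: "'a::euclidean_space set \<Rightarrow> 'a \<Rightarrow> 'a \<Rightarrow> 'a \<Rightarrow> bool" where
  "heads_into \<tau> b v u \<longleftrightarrow> (\<exists>l s. 0 < s \<and> b + l \<in> affine hull \<tau> \<and> u = l + s *\<^sub>R (v - b))"

lemma affine_scale_mem:
  fixes b :: "'a::real_vector"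
  assumes "affine G" "b \<in> G" "b + r *\<^sub>R u \<in> G" "r \<noteq> 0"
  shows "b + s *\<^sub>R u \<in> G"
  using affine_diff_mem[OF assms(1,2,3,3), of "s / r" 0] assms(4) by simp

lemma heads_into_not_mem:
  assumes "heads_into \<tau> b v u" "b \<in> affine hull \<tau>" "v \<notin> affine hull \<tau>"
  shows "b + u \<notin> affine hull \<tau>"
proof
  assume u: "b + u \<in> affine hull \<tau>"
  obtain l s where ls: "0 < s" "b + l \<in> affine hull \<tau>" "u = l + s *\<^sub>R (v - b)"
    using assms(1) unfolding heads_into_def by blast
  have "b + (1/s) *\<^sub>R (b + u - b) + (-1/s) *\<^sub>R (b + l - b) \<in> affine hull \<tau>"
    by (rule affine_diff_mem[OF affine_affine_hull assms(2) u ls(2)])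
  also have "b + (1/s) *\<^sub>R (b + u - b) + (-1/s) *\<^sub>R (b + l - b) = v"
    using ls(1) by (simp add: ls(3) algebra_simps)
  finally show False using assms(3) by blast
qed

lemma heads_into_opposite:
  assumes "heads_into \<tau> b v u" "heads_into \<tau> b v (- u)" "b \<in> affine hull \<tau>"
  shows "v \<in> affine hull \<tau>"
proof -
  obtain l s l' s' where ls: "0 < s" "b + l \<in> affine hull \<tau>" "u = l + s *\<^sub>R (v - b)"
    "0 < s'" "b + l' \<in> affine hull \<tau>" "- u = l' + s' *\<^sub>R (v - b)"
    using assms(1,2) unfolding heads_into_def by blast
  have "(s + s') *\<^sub>R (v - b) = - l - l'" using ls(3,6) by (simp add: algebra_simps)
  then have "(1 / (s + s')) *\<^sub>R (s + s') *\<^sub>R (v - b) = (1 / (s + s')) *\<^sub>R (- l - l')" by (simp only:)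
  then have v: "v - b = (1 / (s + s')) *\<^sub>R (- l - l')" using ls by simp
  have "b + (- (1/(s+s'))) *\<^sub>R (b + l - b) + (- (1/(s+s'))) *\<^sub>R (b + l' - b) \<in> affine hull \<tau>"
    by (rule affine_diff_mem[OF affine_affine_hull assms(3) ls(2,5)])
  also have "b + (- (1/(s+s'))) *\<^sub>R (b + l - b) + (- (1/(s+s'))) *\<^sub>R (b + l' - b) = b + (v - b)"
    unfolding v by (simp add: algebra_simps)
  finally show ?thesis by simp
qed

lemma heads_into_if_mem:
  assumes b: "b \<in> affine hull \<tau>" and u: "b + u \<notin> affine hull \<tau>" and r: "0 < r"
    and y: "b + r *\<^sub>R u \<in> convex hull (insert v \<tau>)"
  shows "heads_into \<tau> b v u"
proof -
  have "\<tau> \<noteq> {}" using b by auto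
  then obtain s w b' where sw: "0 \<le> s" "0 \<le> w" "s + w = 1" "b' \<in> convex hull \<tau>"
    "b + r *\<^sub>R u = s *\<^sub>R v + w *\<^sub>R b'"
    using y unfolding convex_hull_insert[OF \<open>\<tau> \<noteq> {}\<close>] by blast
  have b': "b' \<in> affine hull \<tau>" using sw(4) convex_hull_subset_affine_hull by blast
  have w: "w = 1 - s" using sw(3) by simp
  have ru: "r *\<^sub>R u = s *\<^sub>R (v - b) + w *\<^sub>R (b' - b)"
    using sw(5) unfolding w by (simp add: algebra_simps)
  have "s \<noteq> 0"
  proof
    assume "s = 0"
    then have "b + r *\<^sub>R u \<in> affine hull \<tau>" using sw(5) b' w by simp
    then show False using affine_scale_mem[OF affine_affine_hull b, of r u 1] r u by auto
  qed
  have "u = (1/r) *\<^sub>R (r *\<^sub>R u)" using r by simp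
  also have "\<dots> = (w/r) *\<^sub>R (b' - b) + (s/r) *\<^sub>R (v - b)" unfolding ru by (simp add: algebra_simps)
  finally have "u = (w/r) *\<^sub>R (b' - b) + (s/r) *\<^sub>R (v - b)" .
  moreover have "b + (w/r) *\<^sub>R (b' - b) \<in> affine hull \<tau>"
    using affine_diff_mem[OF affine_affine_hull b b' b', of "w/r" 0] by simp
  moreover have "0 < s / r" using sw(1) \<open>s \<noteq> 0\<close> r by simp
  ultimately show ?thesis unfolding heads_into_def by blast
qed

text \<open>Two cofaces entered by the same direction would overlap beyond \<open>\<tau>\<close>, which a complex does not allow.\<close>

lemma heads_into_unique:
  assumes A: "geometric_complex A" and v: "insert v \<tau> \<in> A" "v \<notin> \<tau>" and v': "insert v' \<tau> \<in> A"
    and b: "b \<in> rel_interior (convex hull \<tau>)"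
    and u: "heads_into \<tau> b v u" and u': "heads_into \<tau> b v' u"
  shows "v = v'"
proof (rule ccontr)
  assume "v \<noteq> v'"
  have baff: "b \<in> affine hull \<tau>"
    using b rel_interior_subset convex_hull_subset_affine_hull by blast
  obtain l s where ls: "0 < s" "b + l \<in> affine hull \<tau>" "u = l + s *\<^sub>R (v - b)"
    using u unfolding heads_into_def by blast
  obtain l' s' where ls': "0 < s'" "b + l' \<in> affine hull \<tau>" "u = l' + s' *\<^sub>R (v' - b)"
    using u' unfolding heads_into_def by blast
  obtain e where e: "e > 0" "\<And>r. 0 \<le> r \<Longrightarrow> r \<le> e \<Longrightarrow> b + r *\<^sub>R u \<in> convex hull (insert v \<tau>)"
    using rel_interior_ray[OF b ls(2), of s v] ls(1) unfolding ls(3)[symmetric] by (metis less_imp_le)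
  obtain e' where e': "e' > 0" "\<And>r. 0 \<le> r \<Longrightarrow> r \<le> e' \<Longrightarrow> b + r *\<^sub>R u \<in> convex hull (insert v' \<tau>)"
    using rel_interior_ray[OF b ls'(2), of s' v'] ls'(1) unfolding ls'(3)[symmetric] by (metis less_imp_le)
  define r where "r = min e e'"
  have r: "0 < r" "r \<le> e" "r \<le> e'" using e(1) e'(1) by (auto simp: r_def)
  have "b + r *\<^sub>R u \<in> convex hull (insert v \<tau> \<inter> insert v' \<tau>)"
    using geometric_complexD(5)[OF A v(1) v'] e(2)[of r] e'(2)[of r] r by simp
  moreover have "insert v \<tau> \<inter> insert v' \<tau> = \<tau>" using v(2) \<open>v \<noteq> v'\<close> by blast
  ultimately have "b + r *\<^sub>R u \<in> affine hull \<tau>" using convex_hull_subset_affine_hull by auto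
  then have "b + 1 *\<^sub>R u \<in> affine hull \<tau>"
    using affine_scale_mem[OF affine_affine_hull baff] r(1) by blast
  then show False
    using heads_into_not_mem[OF u baff not_in_affine_hull_insert[OF A v]] by simp
qed

lemma coface_insert:
  assumes "finite \<tau>" "card \<tau> = d" "\<tau> \<subseteq> \<rho>" "\<rho> \<noteq> \<tau>" "card \<rho> \<le> d + 1" "finite \<rho>"
  obtains v where "v \<notin> \<tau>" "\<rho> = insert v \<tau>"
proof -
  obtain v where v: "v \<in> \<rho>" "v \<notin> \<tau>" using assms by blast
  have "insert v \<tau> = \<rho>"
    using assms v by (intro card_seteq) auto
  with v show ?thesis using that by blast
qed

lemma mem_cofaces_iff:
  assumes A: "geometric_complex A" and \<tau>: "\<tau> \<in> A" "card \<tau> = d"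
  shows "\<rho> \<in> cofaces A d \<tau> \<longleftrightarrow> (\<exists>v. v \<notin> \<tau> \<and> \<rho> = insert v \<tau> \<and> insert v \<tau> \<in> A)"
proof
  assume \<rho>: "\<rho> \<in> cofaces A d \<tau>"
  then have *: "\<rho> \<in> A" "card \<rho> = d + 1" "\<tau> \<subseteq> \<rho>" by (auto simp: cofaces_def faces_def)
  then have "\<rho> \<noteq> \<tau>" using \<tau>(2) by auto
  then obtain v where "v \<notin> \<tau>" "\<rho> = insert v \<tau>"
    by (rule coface_insert[OF geometric_complexD(3)[OF A \<tau>(1)] \<tau>(2) *(3)])
      (use * geometric_complexD(3)[OF A] in auto)
  with * show "\<exists>v. v \<notin> \<tau> \<and> \<rho> = insert v \<tau> \<and> insert v \<tau> \<in> A" by blast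
next
  assume "\<exists>v. v \<notin> \<tau> \<and> \<rho> = insert v \<tau> \<and> insert v \<tau> \<in> A"
  then show "\<rho> \<in> cofaces A d \<tau>"
    using \<tau> geometric_complexD(3)[OF A \<tau>(1)] by (auto simp: cofaces_def faces_def)
qed

text \<open>If the complex covers a short ray leaving \<open>\<tau>\<close>, then a simplex that meets the ray near \<open>b\<close> contains \<open>\<tau>\<close>
  and is larger than \<open>\<tau>\<close>.\<close>

lemma coface_heading_exists:
  assumes A: "geometric_complex A" and dim: "\<And>\<rho>. \<rho> \<in> A \<Longrightarrow> card \<rho> \<le> d + 1"
    and \<tau>: "\<tau> \<in> A" "card \<tau> = d" and b: "b \<in> rel_interior (convex hull \<tau>)"
    and u: "b + u \<notin> affine hull \<tau>" and e: "0 < e" "\<And>r. 0 < r \<Longrightarrow> r \<le> e \<Longrightarrow> b + r *\<^sub>R u \<in> body A"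
  obtains v r where "v \<notin> \<tau>" "insert v \<tau> \<in> A" "heads_into \<tau> b v u"
    "0 < r" "r \<le> e" "b + r *\<^sub>R u \<in> convex hull (insert v \<tau>)"
proof -
  have baff: "b \<in> affine hull \<tau>"
    using b rel_interior_subset convex_hull_subset_affine_hull by blast
  obtain e' where e': "e' > 0" "\<And>\<sigma> y. \<sigma> \<in> A \<Longrightarrow> y \<in> convex hull \<sigma> \<Longrightarrow> dist b y < e' \<Longrightarrow> \<tau> \<subseteq> \<sigma>"
    using near_carrier[OF A \<tau>(1) b] by blast
  define r where "r = min e (e' / (2 * (norm u + 1)))"
  have pos: "0 < norm u + 1" using norm_ge_zero[of u] by linarith
  have r: "0 < r" "r \<le> e" using e(1) e'(1) pos by (auto simp: r_def)
  have "r * norm u \<le> e' / (2 * (norm u + 1)) * norm u"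
    unfolding r_def by (intro mult_right_mono) auto
  also have "\<dots> < e'" using e'(1) pos by (simp add: field_simps add_nonneg_pos)
  finally have near: "dist b (b + r *\<^sub>R u) < e'" using r by (simp add: dist_norm)
  obtain \<rho> where \<rho>: "\<rho> \<in> A" "b + r *\<^sub>R u \<in> convex hull \<rho>"
    using e(2)[OF r] unfolding body_def by blast
  have sub: "\<tau> \<subseteq> \<rho>" using e'(2)[OF \<rho> near] .
  have "b + r *\<^sub>R u \<notin> affine hull \<tau>"
    using affine_scale_mem[OF affine_affine_hull baff, of r u 1] r(1) u by auto
  then have "\<rho> \<noteq> \<tau>" using \<rho>(2) convex_hull_subset_affine_hull by blast
  then obtain v where v: "v \<notin> \<tau>" "\<rho> = insert v \<tau>"
    using coface_insert[OF _ \<tau>(2) sub] dim[OF \<rho>(1)] geometric_complexD(3)[OF A] \<tau>(1) \<rho>(1) by metis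
  show ?thesis
    using that[of v r] v \<rho> r heads_into_if_mem[OF baff u r(1)] by simp
qed

lemma rel_interior_small_step:
  fixes b :: "'a::euclidean_space"
  assumes b: "b \<in> rel_interior D" and u: "b + u \<in> affine hull D"
  obtains e where "0 < e" "\<And>r. \<bar>r\<bar> \<le> e \<Longrightarrow> b + r *\<^sub>R u \<in> D"
proof -
  obtain e where e: "e > 0" "ball b e \<inter> affine hull D \<subseteq> D" "b \<in> D"
    using b unfolding mem_rel_interior_ball by auto
  have pos: "0 < norm u + 1" using norm_ge_zero[of u] by linarith
  show ?thesis
  proof (rule that[of "e / (2 * (norm u + 1))"])
    show "0 < e / (2 * (norm u + 1))" using e pos by simp
    fix r :: real assume r: "\<bar>r\<bar> \<le> e / (2 * (norm u + 1))"
    have "\<bar>r\<bar> * norm u \<le> e / (2 * (norm u + 1)) * norm u" using r by (intro mult_right_mono) auto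
    also have "\<dots> < e" using e(1) pos by (simp add: field_simps add_nonneg_pos)
    finally have "b + r *\<^sub>R u \<in> ball b e" by (simp add: dist_norm)
    moreover have "b + r *\<^sub>R u \<in> affine hull D"
      using affine_diff_mem[OF affine_affine_hull hull_inc[OF e(3)] u u, of r 0] by simp
    ultimately show "b + r *\<^sub>R u \<in> D" using e(2) by blast
  qed
qed

text \<open>Inside a flat \<open>d\<close>-dimensional piece \<open>D\<close> of the complex there are just two directions transversal to
  \<open>\<tau>\<close>, and each of them is occupied by exactly one coface.\<close>

lemma two_cofaces_inside:
  assumes A: "geometric_complex A" and dim: "\<And>\<rho>. \<rho> \<in> A \<Longrightarrow> card \<rho> \<le> d + 1"
    and \<tau>: "\<tau> \<in> A" "card \<tau> = d" and b: "b \<in> rel_interior (convex hull \<tau>)" "b \<in> rel_interior D"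
    and D: "aff_dim D = int d" "D \<subseteq> body A"
    and flat: "\<And>\<rho>. \<rho> \<in> A \<Longrightarrow> \<tau> \<subseteq> \<rho> \<Longrightarrow> \<rho> \<subseteq> affine hull D"
  obtains \<rho> \<rho>' where "\<rho> \<noteq> \<rho>'" "cofaces A d \<tau> = {\<rho>, \<rho>'}"
proof -
  have baff: "b \<in> affine hull \<tau>"
    using b(1) rel_interior_subset convex_hull_subset_affine_hull by blast
  have dim\<tau>: "aff_dim \<tau> = int d - 1" using aff_dim_face[OF A \<tau>(1)] \<tau>(2) by simp
  have "\<not> D \<subseteq> affine hull \<tau>"
    using aff_dim_subset[of D "affine hull \<tau>"] dim\<tau> D(1) by auto
  then obtain q where q: "q \<in> D" "q \<notin> affine hull \<tau>" by blast
  have "aff_dim (insert q \<tau>) = aff_dim (affine hull D)"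
    using dim\<tau> D(1) q(2) by (simp add: aff_dim_insert)
  moreover have "insert q \<tau> \<subseteq> affine hull D" using flat[OF \<tau>(1)] q(1) by (simp add: hull_inc)
  ultimately have hull: "affine hull D = affine hull (insert q \<tau>)"
    using aff_dim_eq_full_gen[of "insert q \<tau>" "affine hull D"] by simp
  \<comment> \<open>The two transversal directions are \<open>u\<close> and \<open>- u\<close>.\<close>
  define u where "u = q - b"
  have u: "b + u \<notin> affine hull \<tau>" "b + - u \<notin> affine hull \<tau>"
    using q(2) affine_scale_mem[OF affine_affine_hull baff, of "-1" u 1] by (auto simp: u_def)
  have "b + u \<in> affine hull D" using q(1) by (simp add: u_def hull_inc)
  then obtain e where e: "0 < e" "\<And>r. \<bar>r\<bar> \<le> e \<Longrightarrow> b + r *\<^sub>R u \<in> D"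
    using rel_interior_small_step[OF b(2)] by metis
  obtain v where v: "v \<notin> \<tau>" "insert v \<tau> \<in> A" "heads_into \<tau> b v u"
  proof (rule coface_heading_exists[OF A dim \<tau> b(1) u(1) e(1)])
    show "b + r *\<^sub>R u \<in> body A" if "0 < r" "r \<le> e" for r
      using e(2)[of r] that D(2) by auto
  qed
  obtain w where w: "w \<notin> \<tau>" "insert w \<tau> \<in> A" "heads_into \<tau> b w (- u)"
  proof (rule coface_heading_exists[OF A dim \<tau> b(1) u(2) e(1)])
    show "b + r *\<^sub>R (- u) \<in> body A" if "0 < r" "r \<le> e" for r
      using e(2)[of "- r"] that D(2) by auto
  qed
  have "insert v \<tau> \<noteq> insert w \<tau>"
  proof
    assume "insert v \<tau> = insert w \<tau>"
    then have "v = w" using v(1) w(1) by blast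
    then show False
      using heads_into_opposite[OF v(3) _ baff] w(3) not_in_affine_hull_insert[OF A v(2,1)] by blast
  qed
  moreover have "cofaces A d \<tau> = {insert v \<tau>, insert w \<tau>}"
  proof (intro equalityI subsetI)
    fix \<rho> assume "\<rho> \<in> cofaces A d \<tau>"
    then obtain x where x: "x \<notin> \<tau>" "\<rho> = insert x \<tau>" "insert x \<tau> \<in> A"
      using mem_cofaces_iff[OF A \<tau>] by blast
    have "x \<in> affine hull (insert q \<tau>)" using flat[OF x(3)] hull by auto
    then obtain l s where ls: "b + l \<in> affine hull \<tau>" "x - b = l + s *\<^sub>R (q - b)"
      using affine_hull_insert_coords[OF baff] by blast
    have "s \<noteq> 0"
    proof
      assume "s = 0"
      then have "x = b + l" using ls(2) by (simp add: algebra_simps)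
      then show False using ls(1) not_in_affine_hull_insert[OF A x(3,1)] by simp
    qed
    have l: "b + (r::real) *\<^sub>R l \<in> affine hull \<tau>" for r
      using affine_diff_mem[OF affine_affine_hull baff ls(1) ls(1), of r 0] by simp
    have "u = (- (1/s)) *\<^sub>R l + (1/s) *\<^sub>R (x - b)" "- u = (1/s) *\<^sub>R l + (- (1/s)) *\<^sub>R (x - b)"
      unfolding ls(2) u_def using \<open>s \<noteq> 0\<close> by (simp_all add: algebra_simps)
    then have "heads_into \<tau> b x u \<or> heads_into \<tau> b x (- u)"
      using \<open>s \<noteq> 0\<close> l unfolding heads_into_def
      by (cases "s > 0") (metis zero_less_divide_1_iff, metis linorder_neqE_linordered_idom neg_0_less_iff_less divide_less_0_1_iff)
    then have "x = v \<or> x = w"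
      using heads_into_unique[OF A x(3,1) _ b(1)] v(2,3) w(2,3) by blast
    then show "\<rho> \<in> {insert v \<tau>, insert w \<tau>}" using x(2) by blast
  qed (use mem_cofaces_iff[OF A \<tau>] v w in blast)
  ultimately show ?thesis by (rule that)
qed

section \<open>Cycles of a subdivision\<close>

text \<open>The finer complex is \<open>A\<close>; its simplices are called the pieces of those of \<open>B\<close> below.\<close>

locale subdivided_complex =
  fixes A B :: "'a::euclidean_space set set" and d :: nat
  assumes A: "geometric_complex A" and B: "geometric_complex B"
    and dimB: "\<And>\<sigma>. \<sigma> \<in> B \<Longrightarrow> card \<sigma> \<le> d + 1"
    and same_body: "body A = body B"
    and refines: "\<And>\<rho>. \<rho> \<in> A \<Longrightarrow> \<exists>\<sigma>\<in>B. convex hull \<rho> \<subseteq> convex hull \<sigma>"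
begin

lemma card_le_if_hull_subset:
  assumes "\<rho> \<in> A" "\<sigma> \<in> B" "convex hull \<rho> \<subseteq> convex hull \<sigma>"
  shows "card \<rho> \<le> card \<sigma>"
  using aff_dim_subset[OF assms(3)] aff_dim_face[OF A assms(1)] aff_dim_face[OF B assms(2)]
  by (simp add: aff_dim_convex_hull)

lemma dimA: "\<rho> \<in> A \<Longrightarrow> card \<rho> \<le> d + 1"
  using refines card_le_if_hull_subset dimB le_trans by meson

lemma hull_subset_carrier:
  assumes \<tau>: "\<tau> \<in> A" "b \<in> rel_interior (convex hull \<tau>)"
    and \<mu>: "\<mu> \<in> B" "b \<in> rel_interior (convex hull \<mu>)"
  shows "convex hull \<tau> \<subseteq> convex hull \<mu>"
proof -
  obtain \<sigma> where \<sigma>: "\<sigma> \<in> B" "convex hull \<tau> \<subseteq> convex hull \<sigma>" using refines[OF \<tau>(1)] by blast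
  have "\<mu> \<subseteq> \<sigma>"
    using carrier_subset[OF B \<sigma>(1) \<mu>] \<tau>(2) \<sigma>(2) rel_interior_subset by blast
  then have "convex hull \<mu> face_of convex hull \<sigma>"
    using face_of_convex_hull_affine_independent[OF geometric_complexD(2)[OF B \<sigma>(1)]] by blast
  moreover have "convex hull \<mu> \<inter> rel_interior (convex hull \<tau>) \<noteq> {}"
    using \<tau>(2) \<mu>(2) rel_interior_subset by blast
  ultimately show ?thesis using subset_of_face_of[OF _ \<sigma>(2)] by blast
qed

text \<open>A generic point of \<open>\<mu>\<close> avoids the pieces of smaller dimension.\<close>

lemma fine_simplex_inside:
  assumes \<mu>: "\<mu> \<in> B" "\<mu> \<noteq> {}"
  obtains \<rho> b where "\<rho> \<in> A" "card \<rho> = card \<mu>"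
    "b \<in> rel_interior (convex hull \<rho>)" "b \<in> rel_interior (convex hull \<mu>)"
proof -
  let ?F = "(\<lambda>\<rho>. affine hull \<rho>) ` {\<rho>\<in>A. card \<rho> < card \<mu>}"
  have "\<exists>y\<in>rel_interior (convex hull \<mu>). \<forall>G\<in>?F. y \<notin> G"
  proof (rule general_position)
    show "finite ?F" using geometric_complexD(1)[OF A] by simp
    show "convex (rel_interior (convex hull \<mu>))" by (simp add: convex_rel_interior)
    show "rel_interior (convex hull \<mu>) \<noteq> {}" using \<mu>(2) by (simp add: rel_interior_eq_empty)
    fix G assume "G \<in> ?F"
    then obtain \<rho> where \<rho>: "\<rho> \<in> A" "card \<rho> < card \<mu>" "G = affine hull \<rho>" by blast
    then show "affine G" by simp
    have "aff_dim (rel_interior (convex hull \<mu>)) = int (card \<mu>) - 1"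
      using aff_dim_face[OF B \<mu>(1)] by (simp add: rel_interior_aff_dim aff_dim_convex_hull)
    moreover have "aff_dim G = int (card \<rho>) - 1" using aff_dim_face[OF A \<rho>(1)] \<rho>(3) by simp
    ultimately show "\<not> rel_interior (convex hull \<mu>) \<subseteq> G"
      using aff_dim_subset[of "rel_interior (convex hull \<mu>)" G] \<rho>(2) by auto
  qed
  then obtain y where y: "y \<in> rel_interior (convex hull \<mu>)"
    "\<And>\<rho>. \<rho> \<in> A \<Longrightarrow> card \<rho> < card \<mu> \<Longrightarrow> y \<notin> affine hull \<rho>" by blast
  have "y \<in> body A" using y(1) rel_interior_subset_body[OF \<mu>(1)] same_body by auto
  then obtain \<rho> where \<rho>: "\<rho> \<in> A" "y \<in> rel_interior (convex hull \<rho>)" using body_carrier[OF A] by blast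
  have "y \<in> affine hull \<rho>" using \<rho>(2) rel_interior_subset convex_hull_subset_affine_hull by blast
  then have "card \<mu> \<le> card \<rho>" using y(2)[OF \<rho>(1)] by (meson not_le)
  moreover have "card \<rho> \<le> card \<mu>"
    using card_le_if_hull_subset[OF \<rho>(1) \<mu>(1)] hull_subset_carrier[OF \<rho> \<mu>(1) y(1)] by blast
  ultimately show ?thesis using that \<rho> y(1) by force
qed

lemma top_carrier_unique:
  assumes \<rho>: "\<rho> \<in> faces A d" and \<sigma>: "\<sigma> \<in> B" "convex hull \<rho> \<subseteq> convex hull \<sigma>"
    and \<sigma>': "\<sigma>' \<in> B" "convex hull \<rho> \<subseteq> convex hull \<sigma>'"
  shows "\<sigma> = \<sigma>'"
proof -
  have \<rho>A: "\<rho> \<in> A" "card \<rho> = d + 1" using \<rho> by (auto simp: faces_def)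
  have "convex hull \<rho> \<subseteq> convex hull (\<sigma> \<inter> \<sigma>')"
    using geometric_complexD(5)[OF B \<sigma>(1) \<sigma>'(1)] \<sigma>(2) \<sigma>'(2) by blast
  moreover have int: "\<sigma> \<inter> \<sigma>' \<in> B" using geometric_complexD(4)[OF B \<sigma>(1)] by blast
  ultimately have "d + 1 \<le> card (\<sigma> \<inter> \<sigma>')" using card_le_if_hull_subset[OF \<rho>A(1)] \<rho>A(2) by metis
  then have "card \<sigma> \<le> card (\<sigma> \<inter> \<sigma>')" "card \<sigma>' \<le> card (\<sigma> \<inter> \<sigma>')" using dimB \<sigma>(1) \<sigma>'(1) le_trans by blast+
  then have "\<sigma> \<inter> \<sigma>' = \<sigma>" "\<sigma> \<inter> \<sigma>' = \<sigma>'"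
    using card_seteq[of \<sigma> "\<sigma> \<inter> \<sigma>'"] card_seteq[of \<sigma>' "\<sigma> \<inter> \<sigma>'"] geometric_complexD(3)[OF B] \<sigma>(1) \<sigma>'(1) by auto
  then show ?thesis by simp
qed

text \<open>For a piece of full dimension \<open>d\<close> the simplex of \<open>B\<close> that contains it is unique.\<close>

definition coarse :: "'a set \<Rightarrow> 'a set" where
  "coarse \<rho> = (THE \<sigma>. \<sigma> \<in> B \<and> convex hull \<rho> \<subseteq> convex hull \<sigma>)"

lemma coarse_eqI:
  assumes "\<rho> \<in> faces A d" "\<sigma> \<in> B" "convex hull \<rho> \<subseteq> convex hull \<sigma>"
  shows "coarse \<rho> = \<sigma>"
  unfolding coarse_def
  by (rule the_equality) (use assms in simp, rule top_carrier_unique[OF assms(1)], use assms in simp_all)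

lemma coarse:
  assumes "\<rho> \<in> faces A d"
  shows "coarse \<rho> \<in> faces B d" "convex hull \<rho> \<subseteq> convex hull (coarse \<rho>)"
proof -
  have \<rho>: "\<rho> \<in> A" "card \<rho> = d + 1" using assms by (auto simp: faces_def)
  obtain \<sigma> where \<sigma>: "\<sigma> \<in> B" "convex hull \<rho> \<subseteq> convex hull \<sigma>" using refines \<rho>(1) by blast
  have "card \<sigma> = d + 1"
    using card_le_if_hull_subset[OF \<rho>(1) \<sigma>] \<rho>(2) dimB[OF \<sigma>(1)] by simp
  then show "coarse \<rho> \<in> faces B d" "convex hull \<rho> \<subseteq> convex hull (coarse \<rho>)"
    using \<sigma> coarse_eqI[OF assms \<sigma>] by (auto simp: faces_def)
qed

lemma coarse_surj:
  assumes "\<sigma> \<in> faces B d"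
  obtains \<rho> where "\<rho> \<in> faces A d" "coarse \<rho> = \<sigma>"
proof -
  have \<sigma>: "\<sigma> \<in> B" "card \<sigma> = d + 1" using assms by (auto simp: faces_def)
  then have "\<sigma> \<noteq> {}" by auto
  then obtain \<rho> b where \<rho>: "\<rho> \<in> A" "card \<rho> = card \<sigma>"
      "b \<in> rel_interior (convex hull \<rho>)" "b \<in> rel_interior (convex hull \<sigma>)"
    using fine_simplex_inside[OF \<sigma>(1)] by blast
  then have "\<rho> \<in> faces A d" using \<sigma>(2) by (simp add: faces_def)
  then show ?thesis
    using that coarse_eqI[OF _ \<sigma>(1) hull_subset_carrier[OF \<rho>(1,3) \<sigma>(1) \<rho>(4)]] by blast
qed

lemma coarse_coface:
  assumes "\<rho> \<in> cofaces A d \<tau>" "b \<in> convex hull \<tau>" "\<mu> \<in> B" "b \<in> rel_interior (convex hull \<mu>)"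
  shows "\<mu> \<subseteq> coarse \<rho>"
proof -
  have \<rho>: "\<rho> \<in> faces A d" "\<tau> \<subseteq> \<rho>" using assms(1) by (auto simp: cofaces_def)
  then have "b \<in> convex hull (coarse \<rho>)"
    using coarse(2)[OF \<rho>(1)] hull_mono[OF \<rho>(2)] assms(2) by blast
  then show ?thesis
    using carrier_subset[OF B _ assms(3,4)] coarse(1)[OF \<rho>(1)] by (auto simp: faces_def)
qed

text \<open>The flat piece is \<open>\<sigma>\<close> itself: since \<open>\<sigma>\<close> has maximal dimension, everything in \<open>A\<close> that contains \<open>b\<close> stays
  inside \<open>\<sigma>\<close>.\<close>

lemma two_cofaces_in_top_simplex:
  assumes \<tau>: "\<tau> \<in> A" "card \<tau> = d" "b \<in> rel_interior (convex hull \<tau>)"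
    and \<sigma>: "\<sigma> \<in> faces B d" "b \<in> rel_interior (convex hull \<sigma>)"
  obtains \<rho> \<rho>' where "\<rho> \<noteq> \<rho>'" "cofaces A d \<tau> = {\<rho>, \<rho>'}" "coarse \<rho> = \<sigma>" "coarse \<rho>' = \<sigma>"
proof -
  have \<sigma>B: "\<sigma> \<in> B" "card \<sigma> = d + 1" using \<sigma>(1) by (auto simp: faces_def)
  have "aff_dim (convex hull \<sigma>) = int d"
    using aff_dim_face[OF B \<sigma>B(1)] \<sigma>B(2) by (simp add: aff_dim_convex_hull)
  moreover have "convex hull \<sigma> \<subseteq> body A" using hull_subset_body[OF \<sigma>B(1)] same_body by simp
  moreover have "\<rho> \<subseteq> affine hull (convex hull \<sigma>)" if \<rho>: "\<rho> \<in> A" "\<tau> \<subseteq> \<rho>" for \<rho>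
  proof -
    obtain \<sigma>' where \<sigma>': "\<sigma>' \<in> B" "convex hull \<rho> \<subseteq> convex hull \<sigma>'" using refines[OF \<rho>(1)] by blast
    have "b \<in> convex hull \<sigma>'" using \<tau>(3) rel_interior_subset hull_mono[OF \<rho>(2)] \<sigma>'(2) by blast
    then have "\<sigma> \<subseteq> \<sigma>'" using carrier_subset[OF B \<sigma>'(1) \<sigma>B(1) \<sigma>(2)] by blast
    then have "\<sigma> = \<sigma>'"
      using card_seteq[of \<sigma>' \<sigma>] geometric_complexD(3)[OF B \<sigma>'(1)] dimB[OF \<sigma>'(1)] \<sigma>B(2) by simp
    then show ?thesis using \<sigma>'(2) hull_subset[of \<rho> convex] hull_subset[of "convex hull \<sigma>" affine] by blast
  qed
  ultimately obtain \<rho> \<rho>' where \<rho>: "\<rho> \<noteq> \<rho>'" "cofaces A d \<tau> = {\<rho>, \<rho>'}"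
    using two_cofaces_inside[OF A dimA \<tau> \<sigma>(2)] by metis
  have "coarse \<kappa> = \<sigma>" if "\<kappa> \<in> cofaces A d \<tau>" for \<kappa>
  proof -
    have "\<sigma> \<subseteq> coarse \<kappa>"
      using coarse_coface[OF that _ \<sigma>B(1) \<sigma>(2)] \<tau>(3) rel_interior_subset by blast
    moreover have "coarse \<kappa> \<in> faces B d" using coarse(1) that by (simp add: cofaces_def)
    ultimately show ?thesis
      using card_seteq[of "coarse \<kappa>" \<sigma>] geometric_complexD(3)[OF B] \<sigma>B(2) by (auto simp: faces_def)
  qed
  then show ?thesis using that[OF \<rho>] \<rho>(2) by blast
qed

text \<open>If \<open>\<tau>\<close> has full dimension in \<open>\<mu>\<close>, the two have the same affine hull, so heading into a coface has the same
  meaning for both. A \<open>d\<close>-simplex of \<open>B\<close> on \<open>\<mu>\<close> corresponds to the piece entered when moving from \<open>\<mu>\<close> towards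
  its remaining vertex.\<close>

lemma coarse_bij_cofaces:
  assumes \<tau>: "\<tau> \<in> A" "card \<tau> = d" "b \<in> rel_interior (convex hull \<tau>)"
    and \<mu>: "\<mu> \<in> B" "card \<mu> = d" "b \<in> rel_interior (convex hull \<mu>)"
  shows "bij_betw coarse (cofaces A d \<tau>) (cofaces B d \<mu>)"
proof -
  have b: "b \<in> convex hull \<tau>" "b \<in> affine hull \<tau>" "b \<in> affine hull \<mu>"
    using \<tau>(3) \<mu>(3) rel_interior_subset convex_hull_subset_affine_hull by blast+
  have "convex hull \<tau> \<subseteq> convex hull \<mu>" by (rule hull_subset_carrier[OF \<tau>(1,3) \<mu>(1,3)])
  then have "\<tau> \<subseteq> affine hull \<mu>"
    using hull_subset[of \<tau> convex] convex_hull_subset_affine_hull by blast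
  moreover have "aff_dim \<tau> = aff_dim (affine hull \<mu>)"
    using aff_dim_face[OF A \<tau>(1)] aff_dim_face[OF B \<mu>(1)] \<tau>(2) \<mu>(2) by simp
  ultimately have aff: "affine hull \<tau> = affine hull \<mu>"
    using aff_dim_eq_full_gen[of \<tau> "affine hull \<mu>"] by simp
  have heads: "heads_into \<mu> b v u \<longleftrightarrow> heads_into \<tau> b v u" for v u by (simp add: heads_into_def aff)
  have coarse_mem: "coarse \<rho> \<in> cofaces B d \<mu>" if "\<rho> \<in> cofaces A d \<tau>" for \<rho>
    using coarse_coface[OF that b(1) \<mu>(1,3)] coarse(1) that by (auto simp: cofaces_def)
  show ?thesis
  proof (rule bij_betw_imageI)
    show "inj_on coarse (cofaces A d \<tau>)"
    proof (rule inj_onI)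
      fix \<rho> \<rho>' assume \<rho>: "\<rho> \<in> cofaces A d \<tau>" "\<rho>' \<in> cofaces A d \<tau>" "coarse \<rho> = coarse \<rho>'"
      obtain q where q: "q \<notin> \<mu>" "coarse \<rho> = insert q \<mu>" "insert q \<mu> \<in> B"
        using coarse_mem[OF \<rho>(1)] mem_cofaces_iff[OF B \<mu>(1,2)] by blast
      \<comment> \<open>The vertex \<open>v\<close> lies on the same side of \<open>\<mu>\<close> as \<open>q\<close>; so, conversely, \<open>q\<close> lies on the side of \<open>v\<close>.\<close>
      have *: "heads_into \<tau> b v (q - b)"
        if "v \<notin> \<tau>" "insert v \<tau> \<in> cofaces A d \<tau>" "coarse (insert v \<tau>) = insert q \<mu>" for v
      proof -
        have vA: "insert v \<tau> \<in> A" using that(2) by (simp add: cofaces_def faces_def)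
        have v: "v \<notin> affine hull \<mu>" using not_in_affine_hull_insert[OF A vA that(1)] aff by simp
        have "v \<in> convex hull (insert q \<mu>)"
          using coarse(2)[of "insert v \<tau>"] that(2,3) hull_subset[of "insert v \<tau>" convex]
          by (auto simp: cofaces_def)
        then have "heads_into \<mu> b q (v - b)"
          using heads_into_if_mem[OF b(3), of "v - b" 1 q] v by simp
        then obtain l s where ls: "0 < s" "b + l \<in> affine hull \<mu>" "v - b = l + s *\<^sub>R (q - b)"
          unfolding heads_into_def by blast
        have "q - b = (- (1/s)) *\<^sub>R l + (1/s) *\<^sub>R (v - b)" unfolding ls(3) using ls(1) by (simp add: algebra_simps)
        moreover have "b + (- (1/s)) *\<^sub>R l \<in> affine hull \<mu>"
          using affine_diff_mem[OF affine_affine_hull b(3) ls(2,2), of "- (1/s)" 0] by simp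
        moreover have "0 < 1 / s" using ls(1) by simp
        ultimately show ?thesis unfolding heads_into_def aff by blast
      qed
      obtain v where v: "v \<notin> \<tau>" "\<rho> = insert v \<tau>" "insert v \<tau> \<in> A"
        using \<rho>(1) unfolding mem_cofaces_iff[OF A \<tau>(1,2)] by blast
      obtain v' where v': "v' \<notin> \<tau>" "\<rho>' = insert v' \<tau>" "insert v' \<tau> \<in> A"
        using \<rho>(2) unfolding mem_cofaces_iff[OF A \<tau>(1,2)] by blast
      have "heads_into \<tau> b v (q - b)" "heads_into \<tau> b v' (q - b)"
        using *[of v] *[of v'] v v' \<rho> q(2) by auto
      then have "v = v'" by (rule heads_into_unique[OF A v(3,1) v'(3) \<tau>(3)])
      then show "\<rho> = \<rho>'" using v(2) v'(2) by simp
    qed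
    show "coarse ` cofaces A d \<tau> = cofaces B d \<mu>"
    proof (intro equalityI subsetI)
      fix \<sigma> assume "\<sigma> \<in> cofaces B d \<mu>"
      then obtain q where q: "q \<notin> \<mu>" "\<sigma> = insert q \<mu>" "insert q \<mu> \<in> B"
        using mem_cofaces_iff[OF B \<mu>(1,2)] by blast
      have q': "b + (q - b) \<notin> affine hull \<tau>"
        using not_in_affine_hull_insert[OF B q(3,1)] aff by simp
      have inbody: "b + r *\<^sub>R (q - b) \<in> body A" if "0 < r" "r \<le> 1" for r
      proof -
        have "(1 - r) *\<^sub>R b + r *\<^sub>R q \<in> convex hull (insert q \<mu>)"
          using that \<mu>(3) rel_interior_subset hull_mono[of \<mu> "insert q \<mu>" convex]
          by (intro convexD[OF convex_convex_hull]) (auto simp: hull_inc)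
        moreover have "(1 - r) *\<^sub>R b + r *\<^sub>R q = b + r *\<^sub>R (q - b)" by (simp add: algebra_simps)
        ultimately show ?thesis using hull_subset_body[OF q(3)] same_body by auto
      qed
      obtain v r where v: "v \<notin> \<tau>" "insert v \<tau> \<in> A" "heads_into \<tau> b v (q - b)"
        "0 < r" "r \<le> 1" "b + r *\<^sub>R (q - b) \<in> convex hull (insert v \<tau>)"
        by (rule coface_heading_exists[OF A dimA \<tau> q' zero_less_one inbody])
      have cof: "insert v \<tau> \<in> cofaces A d \<tau>" using mem_cofaces_iff[OF A \<tau>(1,2)] v by blast
      then obtain q2 where q2: "q2 \<notin> \<mu>" "coarse (insert v \<tau>) = insert q2 \<mu>" "insert q2 \<mu> \<in> B"
        using coarse_mem mem_cofaces_iff[OF B \<mu>(1,2)] by metis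
      have "b + r *\<^sub>R (q - b) \<in> convex hull (insert q2 \<mu>)"
        using coarse(2)[of "insert v \<tau>"] cof v(6) q2(2) by (auto simp: cofaces_def)
      \<comment> \<open>The piece found lies in a coface of \<open>\<mu>\<close> that is entered by the same ray as \<open>\<sigma>\<close>, hence in \<open>\<sigma>\<close>.\<close>
      then have "heads_into \<mu> b q2 (q - b)"
        using heads_into_if_mem[OF b(3) _ v(4)] q' aff by auto
      moreover have "heads_into \<mu> b q (q - b)"
        using b(3) unfolding heads_into_def by (intro exI[of _ 0] exI[of _ 1]) auto
      ultimately have "q2 = q"
        using heads_into_unique[OF B q2(3,1) q(3) \<mu>(3)] by blast
      then show "\<sigma> \<in> coarse ` cofaces A d \<tau>" using cof q2(2) q(2) by blast
    qed (use coarse_mem in blast)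
  qed
qed

text \<open>A face \<open>\<tau>\<close> of \<open>A\<close> lies in the relative interior either of a \<open>d\<close>-simplex, where its two cofaces cancel, or of a
  \<open>(d - 1)\<close>-simplex of \<open>B\<close>, which has the same cofaces up to \<^term>\<open>coarse\<close>.\<close>

lemma cycle_on_refine:
  assumes c: "cycle_on B d c" and d: "0 < d"
  shows "cycle_on A d (c \<circ> coarse)"
  unfolding cycle_on_def
proof (intro ballI impI)
  fix \<tau> assume \<tau>: "\<tau> \<in> A" "\<tau> \<noteq> {} \<and> card \<tau> = d"
  have "rel_interior (convex hull \<tau>) \<noteq> {}" using \<tau>(2) by (simp add: rel_interior_eq_empty)
  then obtain b where b: "b \<in> rel_interior (convex hull \<tau>)" by blast
  then have "b \<in> body B" using rel_interior_subset_body[OF \<tau>(1)] same_body by auto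
  then obtain \<mu> where \<mu>: "\<mu> \<in> B" "b \<in> rel_interior (convex hull \<mu>)" using body_carrier[OF B] by blast
  have "d \<le> card \<mu>"
    using card_le_if_hull_subset[OF \<tau>(1) \<mu>(1) hull_subset_carrier[OF \<tau>(1) b \<mu>]] \<tau>(2) by simp
  then consider "card \<mu> = d" | "card \<mu> = d + 1" using dimB[OF \<mu>(1)] by linarith
  then show "(\<Sum>\<rho>\<in>cofaces A d \<tau>. (c \<circ> coarse) \<rho>) = 0"
  proof cases
    case 1
    then have "(\<Sum>\<rho>\<in>cofaces A d \<tau>. c (coarse \<rho>)) = (\<Sum>\<sigma>\<in>cofaces B d \<mu>. c \<sigma>)"
      using coarse_bij_cofaces[OF \<tau>(1) _ b \<mu>(1) _ \<mu>(2)] \<tau>(2) by (intro sum.reindex_bij_betw) blast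
    also have "\<dots> = 0" using c \<mu>(1) 1 d unfolding cycle_on_def by fastforce
    finally show ?thesis by simp
  next
    case 2
    then have "\<mu> \<in> faces B d" using \<mu>(1) by (simp add: faces_def)
    from \<tau>(2) have card\<tau>: "card \<tau> = d" by simp
    obtain \<rho> \<rho>' where "\<rho> \<noteq> \<rho>'" "cofaces A d \<tau> = {\<rho>, \<rho>'}" "coarse \<rho> = \<mu>" "coarse \<rho>' = \<mu>"
      by (rule two_cofaces_in_top_simplex[OF \<tau>(1) card\<tau> b \<open>\<mu> \<in> faces B d\<close> \<mu>(2)])
    then show ?thesis by (cases "c \<mu>") auto
  qed
qed

text \<open>Two pieces of a \<open>d\<close>-simplex are joined by a segment in general position. It meets only pieces of
  dimension \<open>d\<close> and \<open>d - 1\<close>, the latter in isolated points, where the cycle condition says that the two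
  adjacent pieces have the same coefficient.\<close>

lemma cycle_on_constant_in_coarse:
  assumes c: "cycle_on A d c" and d: "0 < d" and \<rho>1: "\<rho>1 \<in> faces A d" and \<rho>2: "\<rho>2 \<in> faces A d"
    and eq: "coarse \<rho>1 = coarse \<rho>2"
  shows "c \<rho>1 = c \<rho>2"
proof (cases "\<rho>1 = \<rho>2")
  case False
  define \<sigma> where "\<sigma> = coarse \<rho>1"
  have \<sigma>: "\<sigma> \<in> faces B d" "\<sigma> \<in> B" "card \<sigma> = d + 1"
    using coarse(1)[OF \<rho>1] by (auto simp: \<sigma>_def faces_def)
  have A12: "\<rho>1 \<in> A" "\<rho>2 \<in> A" "card \<rho>1 = d + 1" "card \<rho>2 = d + 1"
    using \<rho>1 \<rho>2 by (auto simp: faces_def)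
  have dims: "aff_dim (convex hull \<rho>) = int d" if "\<rho> \<in> A" "card \<rho> = d + 1" for \<rho>
    using aff_dim_face[OF A that(1)] that(2) by (simp add: aff_dim_convex_hull)
  have relint: "rel_interior (convex hull \<rho>) \<subseteq> rel_interior (convex hull \<sigma>)"
    if "\<rho> \<in> A" "card \<rho> = d + 1" "convex hull \<rho> \<subseteq> convex hull \<sigma>" for \<rho>
  proof (rule subset_rel_interior[OF that(3)])
    have "aff_dim (convex hull \<sigma>) = int d"
      using aff_dim_face[OF B \<sigma>(2)] \<sigma>(3) by (simp add: aff_dim_convex_hull)
    then show "affine hull (convex hull \<rho>) = affine hull (convex hull \<sigma>)"
      using aff_dim_eq_full_gen[OF that(3)] dims[OF that(1,2)] by metis
  qed
  have general: "\<exists>x\<in>rel_interior (convex hull \<rho>). \<forall>G\<in>F. x \<notin> G"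
    if "\<rho> \<in> A" "card \<rho> = d + 1" "finite F" "\<And>G. G \<in> F \<Longrightarrow> affine G \<and> aff_dim G < int d" for \<rho> F
  proof (rule general_position)
    show "convex (rel_interior (convex hull \<rho>))" by (simp add: convex_rel_interior)
    show "rel_interior (convex hull \<rho>) \<noteq> {}" using that(2) by (auto simp: rel_interior_eq_empty)
    fix G assume "G \<in> F"
    then show "affine G" using that(4) by blast
    show "\<not> rel_interior (convex hull \<rho>) \<subseteq> G"
      using aff_dim_subset[of "rel_interior (convex hull \<rho>)" G] that(4)[OF \<open>G \<in> F\<close>] dims[OF that(1,2)]
      by (auto simp: rel_interior_aff_dim)
  qed (rule that)
  \<comment> \<open>The point \<open>x\<close> avoids the hulls of all smaller pieces, so the segment meets each of them at most once.\<close>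
  let ?F1 = "(\<lambda>\<tau>. affine hull \<tau>) ` {\<tau>\<in>A. card \<tau> \<le> d}"
  have "\<exists>x\<in>rel_interior (convex hull \<rho>1). \<forall>G\<in>?F1. x \<notin> G"
    by (rule general[OF A12(1,3)]) (use geometric_complexD(1)[OF A] aff_dim_face[OF A] in auto)
  then obtain x where x: "x \<in> rel_interior (convex hull \<rho>1)"
    "\<And>\<tau>. \<tau> \<in> A \<Longrightarrow> card \<tau> \<le> d \<Longrightarrow> x \<notin> affine hull \<tau>" by blast
  \<comment> \<open>With this choice of \<open>y\<close> the segment misses all pieces of dimension below \<open>d - 1\<close>.\<close>
  let ?F2 = "(\<lambda>\<eta>. affine hull (insert x \<eta>)) ` {\<eta>\<in>A. card \<eta> < d}"
  have "\<exists>y\<in>rel_interior (convex hull \<rho>2). \<forall>G\<in>?F2. y \<notin> G"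
    by (rule general[OF A12(2,4)])
      (use geometric_complexD(1)[OF A] aff_dim_face[OF A] in \<open>auto simp: aff_dim_insert\<close>)
  then obtain y where y: "y \<in> rel_interior (convex hull \<rho>2)"
    "\<And>\<eta>. \<eta> \<in> A \<Longrightarrow> card \<eta> < d \<Longrightarrow> y \<notin> affine hull (insert x \<eta>)" by blast
  let ?S = "closed_segment x y"
  have miss: "affine hull \<eta> \<inter> ?S = {}" if "\<eta> \<in> A" "card \<eta> < d" for \<eta>
    using affine_hull_misses_segment x(2)[OF that(1)] y(2)[OF that] that(2) by (meson less_imp_le)
  have S\<sigma>: "?S \<subseteq> rel_interior (convex hull \<sigma>)"
  proof (rule closed_segment_subset)
    show "x \<in> rel_interior (convex hull \<sigma>)"
      using x(1) relint[OF A12(1,3)] coarse(2)[OF \<rho>1] by (auto simp: \<sigma>_def)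
    show "y \<in> rel_interior (convex hull \<sigma>)"
      using y(1) relint[OF A12(2,4)] coarse(2)[OF \<rho>2] by (auto simp: \<sigma>_def eq)
  qed (simp add: convex_rel_interior)
  have carrier: "\<exists>\<rho>\<in>A. z \<in> rel_interior (convex hull \<rho>)" if "z \<in> ?S" for z
  proof -
    have "z \<in> body A" using S\<sigma> that rel_interior_subset_body[OF \<sigma>(2)] same_body by auto
    then show ?thesis using body_carrier[OF A] by metis
  qed
  have uniq: "\<rho> = \<rho>'" if "\<rho> \<in> A" "\<rho>' \<in> A" "z \<in> rel_interior (convex hull \<rho>)" "z \<in> rel_interior (convex hull \<rho>')" for z \<rho> \<rho>'
    using carrier_subset[OF A that(1,2,4)] carrier_subset[OF A that(2,1,3)] that(3,4) rel_interior_subset by blast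
  \<comment> \<open>The coefficient of the piece in whose relative interior \<open>z\<close> lies; it is used only on \<open>G\<close>, the points
    inside pieces of dimension \<open>d\<close>.\<close>
  define f where "f z = c (SOME \<rho>. \<rho> \<in> A \<and> z \<in> rel_interior (convex hull \<rho>))" for z
  have f: "f z = c \<rho>" if "\<rho> \<in> A" "z \<in> rel_interior (convex hull \<rho>)" for z \<rho>
  proof -
    have "(SOME \<rho>. \<rho> \<in> A \<and> z \<in> rel_interior (convex hull \<rho>)) = \<rho>"
      by (rule some_equality) (use that uniq in blast)+
    then show ?thesis by (simp add: f_def)
  qed
  define G where "G = {z. \<exists>\<rho>\<in>faces A d. z \<in> rel_interior (convex hull \<rho>)}"
  have xy: "x \<noteq> y" using uniq[OF A12(1,2) x(1)] y(1) False by blast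
  have low: "\<exists>\<tau>\<in>A. card \<tau> = d \<and> z \<in> rel_interior (convex hull \<tau>)" if "z \<in> ?S" "z \<notin> G" for z
  proof -
    obtain \<tau> where \<tau>: "\<tau> \<in> A" "z \<in> rel_interior (convex hull \<tau>)" using carrier \<open>z \<in> ?S\<close> by blast
    have "z \<in> affine hull \<tau>" using \<tau>(2) rel_interior_subset convex_hull_subset_affine_hull by blast
    then have "\<not> card \<tau> < d" using miss[OF \<tau>(1)] that(1) by blast
    moreover have "card \<tau> \<noteq> d + 1" using that(2) \<tau> by (auto simp: G_def faces_def)
    ultimately have "card \<tau> = d" using dimA[OF \<tau>(1)] by linarith
    with \<tau> show ?thesis by blast
  qed
  have "f x = f y"
  proof (rule locally_constant_on_dense_imp_constant[where S = ?S and G = G])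
    fix p and e :: real assume p: "p \<in> ?S" "0 < e"
    have "p islimpt ?S"
    proof (rule connected_imp_perfect)
      show "?S \<noteq> {w}" for w using xy ends_in_segment by (metis singletonD)
    qed (use p in auto)
    then have "infinite (?S \<inter> ball p e)" using p(2) by (simp add: islimpt_eq_infinite_ball)
    moreover have "finite (\<Union>\<tau>\<in>{\<tau>\<in>A. card \<tau> = d}. affine hull \<tau> \<inter> ?S)"
    proof (rule finite_UN_I)
      show "finite {\<tau>\<in>A. card \<tau> = d}" using geometric_complexD(1)[OF A] by simp
      fix \<tau> assume "\<tau> \<in> {\<tau>\<in>A. card \<tau> = d}"
      then have \<tau>: "x \<notin> affine hull \<tau>" using x(2) by blast
      show "finite (affine hull \<tau> \<inter> ?S)"
      proof (rule finite_if_subsingleton)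
        fix a b assume a: "a \<in> affine hull \<tau> \<inter> ?S" and b: "b \<in> affine hull \<tau> \<inter> ?S"
        obtain s t where st: "a = (1 - s) *\<^sub>R x + s *\<^sub>R y" "b = (1 - t) *\<^sub>R x + t *\<^sub>R y"
          using a b unfolding closed_segment_def by blast
        show "a = b"
        proof (rule ccontr)
          assume "a \<noteq> b"
          then have "s \<noteq> t" using st by blast
          then have "(1 - 0) *\<^sub>R x + 0 *\<^sub>R y \<in> affine hull \<tau>"
            using affine_line_mem[OF affine_affine_hull, of s x y \<tau> t 0] a b st by blast
          then show False using \<tau> by simp
        qed
      qed
    qed
    ultimately have "infinite (?S \<inter> ball p e - (\<Union>\<tau>\<in>{\<tau>\<in>A. card \<tau> = d}. affine hull \<tau> \<inter> ?S))"
      by (metis Diff_infinite_finite)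
    then have "\<exists>z. z \<in> ?S \<inter> ball p e - (\<Union>\<tau>\<in>{\<tau>\<in>A. card \<tau> = d}. affine hull \<tau> \<inter> ?S)"
      unfolding ex_in_conv by (rule infinite_imp_nonempty)
    then obtain z where "z \<in> ?S \<inter> ball p e - (\<Union>\<tau>\<in>{\<tau>\<in>A. card \<tau> = d}. affine hull \<tau> \<inter> ?S)" ..
    then have z: "z \<in> ?S" "z \<in> ball p e" "\<And>\<tau>. \<tau> \<in> A \<Longrightarrow> card \<tau> = d \<Longrightarrow> z \<notin> affine hull \<tau>"
      by auto
    have "z \<in> G"
    proof (rule ccontr)
      assume "z \<notin> G"
      then obtain \<tau> where "\<tau> \<in> A" "card \<tau> = d" "z \<in> rel_interior (convex hull \<tau>)" using low z(1) by blast
      then show False using z(3) rel_interior_subset convex_hull_subset_affine_hull by blast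
    qed
    with z show "\<exists>z. z \<in> G \<inter> ?S \<inter> ball p e" by blast
  next
    fix p assume p: "p \<in> ?S"
    show "\<exists>e>0. \<forall>a\<in>G \<inter> ?S \<inter> ball p e. \<forall>b\<in>G \<inter> ?S \<inter> ball p e. f a = f b"
    proof -
      obtain \<tau> K where \<tau>: "\<tau> \<in> A" "p \<in> rel_interior (convex hull \<tau>)"
        and K: "\<And>\<rho>. \<rho> \<in> cofaces A d \<tau> \<Longrightarrow> c \<rho> = K"
      proof (cases "p \<in> G")
        case True
        then obtain \<rho> where \<rho>: "\<rho> \<in> faces A d" "p \<in> rel_interior (convex hull \<rho>)" by (auto simp: G_def)
        have "\<kappa> = \<rho>" if "\<kappa> \<in> cofaces A d \<rho>" for \<kappa>
          using that \<rho>(1) card_seteq[of \<kappa> \<rho>] geometric_complexD(3)[OF A]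
          by (auto simp: cofaces_def faces_def)
        then show ?thesis using \<rho> by (intro that[of \<rho> "c \<rho>"]) (auto simp: faces_def)
      next
        case False
        then obtain \<tau> where \<tau>: "\<tau> \<in> A" "card \<tau> = d" "p \<in> rel_interior (convex hull \<tau>)" using low p by blast
        have "p \<in> rel_interior (convex hull \<sigma>)" using S\<sigma> p by blast
        then obtain \<rho> \<rho>' where \<rho>: "\<rho> \<noteq> \<rho>'" "cofaces A d \<tau> = {\<rho>, \<rho>'}"
          by (rule two_cofaces_in_top_simplex[OF \<tau> \<sigma>(1)])
        have "\<tau> \<noteq> {}" using \<tau>(2) d by auto
        then have "(\<Sum>\<rho>\<in>cofaces A d \<tau>. c \<rho>) = 0" using c \<tau>(1,2) unfolding cycle_on_def by blast
        then have "c \<rho> + c \<rho>' = 0" using \<rho> by simp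
        then have "c \<rho>' = c \<rho>" by (cases "c \<rho>"; cases "c \<rho>'") auto
        then show ?thesis using \<tau>(1,3) \<rho>(2) by (intro that[of \<tau> "c \<rho>"]) auto
      qed
      obtain e where e: "e > 0" "\<And>\<kappa> z. \<kappa> \<in> A \<Longrightarrow> z \<in> convex hull \<kappa> \<Longrightarrow> dist p z < e \<Longrightarrow> \<tau> \<subseteq> \<kappa>"
        using near_carrier[OF A \<tau>] by blast
      have "f z = K" if z: "z \<in> G" "z \<in> ball p e" for z
      proof -
        obtain \<rho> where \<rho>: "\<rho> \<in> faces A d" "z \<in> rel_interior (convex hull \<rho>)" using z(1) by (auto simp: G_def)
        then have "\<rho> \<in> A" by (simp add: faces_def)
        moreover have "z \<in> convex hull \<rho>" using \<rho>(2) rel_interior_subset by blast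
        ultimately have "\<tau> \<subseteq> \<rho>" using e(2) z(2) by auto
        then have "c \<rho> = K" using K \<rho>(1) by (simp add: cofaces_def)
        then show ?thesis using f[OF \<open>\<rho> \<in> A\<close> \<rho>(2)] by simp
      qed
      then show ?thesis using e(1) by (intro exI[of _ e]) simp
    qed
  next
    show "x \<in> G \<inter> ?S" "y \<in> G \<inter> ?S" using x(1) y(1) \<rho>1 \<rho>2 by (auto simp: G_def)
  qed simp
  then show ?thesis using f[OF A12(1) x(1)] f[OF A12(2) y(1)] by simp
qed simp

text \<open>For the boundary at a face \<open>\<mu>\<close> of \<open>B\<close> it suffices to look at one piece of \<open>\<mu>\<close> of the same dimension.\<close>

lemma cycle_on_coarsen:
  assumes c: "cycle_on A d c" and d: "0 < d"
  obtains c' where "cycle_on B d c'" "\<And>\<rho>. \<rho> \<in> faces A d \<Longrightarrow> c \<rho> = c' (coarse \<rho>)"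
proof -
  define c' where "c' \<sigma> = c (SOME \<rho>. \<rho> \<in> faces A d \<and> coarse \<rho> = \<sigma>)" for \<sigma>
  have c': "c \<rho> = c' (coarse \<rho>)" if "\<rho> \<in> faces A d" for \<rho>
  proof -
    have "(SOME \<rho>'. \<rho>' \<in> faces A d \<and> coarse \<rho>' = coarse \<rho>) \<in> faces A d \<and>
        coarse (SOME \<rho>'. \<rho>' \<in> faces A d \<and> coarse \<rho>' = coarse \<rho>) = coarse \<rho>"
      by (rule someI[of _ \<rho>]) (simp add: that)
    then show ?thesis unfolding c'_def using cycle_on_constant_in_coarse[OF c d that] by metis
  qed
  have "cycle_on B d c'" unfolding cycle_on_def
  proof (intro ballI impI)
    fix \<mu> assume \<mu>: "\<mu> \<in> B" "\<mu> \<noteq> {} \<and> card \<mu> = d"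
    then obtain \<tau> b where \<tau>: "\<tau> \<in> A" "card \<tau> = card \<mu>"
      "b \<in> rel_interior (convex hull \<tau>)" "b \<in> rel_interior (convex hull \<mu>)"
      using fine_simplex_inside[OF \<mu>(1)] by metis
    have "(\<Sum>\<sigma>\<in>cofaces B d \<mu>. c' \<sigma>) = (\<Sum>\<rho>\<in>cofaces A d \<tau>. c' (coarse \<rho>))"
      using coarse_bij_cofaces[OF \<tau>(1) _ \<tau>(3) \<mu>(1) _ \<tau>(4)] \<mu>(2) \<tau>(2)
      by (intro sum.reindex_bij_betw[symmetric]) auto
    also have "\<dots> = (\<Sum>\<rho>\<in>cofaces A d \<tau>. c \<rho>)"
      by (intro sum.cong) (auto simp: cofaces_def c')
    also have "\<dots> = 0" using c \<tau>(1,2) \<mu>(2) d unfolding cycle_on_def by (metis card.empty less_irrefl)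
    finally show "(\<Sum>\<sigma>\<in>cofaces B d \<mu>. c' \<sigma>) = 0" .
  qed
  then show ?thesis using c' by (rule that)
qed

end

section \<open>The regions beside the simplices of a hypersurface\<close>

definition region :: "'a::euclidean_space set set \<Rightarrow> 'a \<Rightarrow> 'a set" where
  "region A z = connected_component_set (- body A) z"

lemma region_eq:
  assumes "connected T" "T \<subseteq> - body A" "x \<in> T" "y \<in> T"
  shows "region A x = region A y"
proof -
  have "connected_component (- body A) x y"
    unfolding connected_component_def using assms by blast
  then show ?thesis unfolding region_def by (metis connected_component_eq mem_Collect_eq)
qed

text \<open>All that is needed about the two sides of \<open>\<sigma>\<close>: near each relative interior point the complex is just the
  hyperplane of \<open>\<sigma>\<close>, the positive side belongs to the region \<open>P\<close>, and the negative side to \<open>Q\<close>. The regions do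
  not depend on the point.\<close>

definition sides :: "'a::euclidean_space set set \<Rightarrow> 'a set \<Rightarrow> 'a \<Rightarrow> real \<Rightarrow> 'a set \<Rightarrow> 'a set \<Rightarrow> bool" where
  "sides A \<sigma> a \<beta> P Q \<longleftrightarrow> a \<noteq> 0 \<and> affine hull \<sigma> = {z. a \<bullet> z = \<beta>} \<and>
     (\<forall>p\<in>rel_interior (convex hull \<sigma>). \<exists>e>0. \<forall>z\<in>ball p e.
        (\<forall>\<rho>\<in>A. z \<in> convex hull \<rho> \<longrightarrow> \<rho> = \<sigma>) \<and>
        (a \<bullet> z = \<beta> \<longrightarrow> z \<in> convex hull \<sigma>) \<and>
        (\<beta> < a \<bullet> z \<longrightarrow> z \<notin> body A \<and> region A z = P) \<and>
        (a \<bullet> z < \<beta> \<longrightarrow> z \<notin> body A \<and> region A z = Q))"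

lemma sidesD:
  assumes "sides A \<sigma> a \<beta> P Q" "p \<in> rel_interior (convex hull \<sigma>)"
  obtains e where "0 < e" "\<forall>z\<in>ball p e. \<forall>\<rho>\<in>A. z \<in> convex hull \<rho> \<longrightarrow> \<rho> = \<sigma>"
    "\<forall>z\<in>ball p e. a \<bullet> z = \<beta> \<longrightarrow> z \<in> convex hull \<sigma>"
    "\<forall>z\<in>ball p e. \<beta> < a \<bullet> z \<longrightarrow> z \<notin> body A \<and> region A z = P"
    "\<forall>z\<in>ball p e. a \<bullet> z < \<beta> \<longrightarrow> z \<notin> body A \<and> region A z = Q"
proof -
  have "\<exists>e>0. \<forall>z\<in>ball p e. (\<forall>\<rho>\<in>A. z \<in> convex hull \<rho> \<longrightarrow> \<rho> = \<sigma>) \<and>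
        (a \<bullet> z = \<beta> \<longrightarrow> z \<in> convex hull \<sigma>) \<and>
        (\<beta> < a \<bullet> z \<longrightarrow> z \<notin> body A \<and> region A z = P) \<and>
        (a \<bullet> z < \<beta> \<longrightarrow> z \<notin> body A \<and> region A z = Q)"
    using assms(1)[unfolded sides_def, THEN conjunct2, THEN conjunct2] assms(2) by (rule bspec)
  then obtain e where "0 < e" and e: "\<forall>z\<in>ball p e. (\<forall>\<rho>\<in>A. z \<in> convex hull \<rho> \<longrightarrow> \<rho> = \<sigma>) \<and>
        (a \<bullet> z = \<beta> \<longrightarrow> z \<in> convex hull \<sigma>) \<and>
        (\<beta> < a \<bullet> z \<longrightarrow> z \<notin> body A \<and> region A z = P) \<and>
        (a \<bullet> z < \<beta> \<longrightarrow> z \<notin> body A \<and> region A z = Q)" by (elim exE conjE)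
  then show ?thesis using that[OF \<open>0 < e\<close>] unfolding ball_conj_distrib by (elim conjE)
qed

locale hypersurface_complex =
  fixes A :: "'a::euclidean_space set set" and d :: nat
  assumes A: "geometric_complex A"
    and dim: "\<And>\<sigma>. \<sigma> \<in> A \<Longrightarrow> card \<sigma> \<le> d + 1"
    and DIM: "DIM('a) = d + 1"
    and d: "0 < d"
begin

lemma finite_faces: "finite (faces A d)"
  using geometric_complexD(1)[OF A] by (simp add: faces_def)

lemma faceD: "\<sigma> \<in> faces A d \<Longrightarrow> \<sigma> \<in> A \<and> card \<sigma> = d + 1 \<and> finite \<sigma>"
  using geometric_complexD(3)[OF A] by (auto simp: faces_def)

lemma near_top_simplex:
  assumes \<sigma>: "\<sigma> \<in> faces A d" and p: "p \<in> rel_interior (convex hull \<sigma>)"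
  shows "\<exists>e>0. \<forall>z\<in>ball p e. (\<forall>\<rho>\<in>A. z \<in> convex hull \<rho> \<longrightarrow> \<rho> = \<sigma>) \<and>
    (z \<in> affine hull \<sigma> \<longrightarrow> z \<in> convex hull \<sigma>)"
proof -
  have \<sigma>A: "\<sigma> \<in> A" "card \<sigma> = d + 1" using faceD[OF \<sigma>] by auto
  obtain e1 where e1: "e1 > 0" "\<And>\<rho> y. \<rho> \<in> A \<Longrightarrow> y \<in> convex hull \<rho> \<Longrightarrow> dist p y < e1 \<Longrightarrow> \<sigma> \<subseteq> \<rho>"
    using near_carrier[OF A \<sigma>A(1) p] by blast
  obtain e2 where e2: "e2 > 0" "ball p e2 \<inter> affine hull (convex hull \<sigma>) \<subseteq> convex hull \<sigma>"
    using p unfolding mem_rel_interior_ball by auto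
  have "\<rho> = \<sigma>" if "\<rho> \<in> A" "z \<in> convex hull \<rho>" "dist p z < e1" for z \<rho>
    using card_seteq[of \<rho> \<sigma>] geometric_complexD(3)[OF A that(1)] e1(2)[OF that] dim[OF that(1)] \<sigma>A(2) by simp
  then show ?thesis using e1(1) e2 by (intro exI[of _ "min e1 e2"]) (auto simp: subset_iff)
qed

text \<open>The half-balls on the positive side lie in the complement of the complex, and half-balls at nearby points
  overlap. So their region is locally constant along the relative interior of \<open>\<sigma>\<close>, which is connected.\<close>

lemma region_beside:
  assumes \<sigma>: "\<sigma> \<in> faces A d" and a: "a \<noteq> 0" and hyp: "affine hull \<sigma> = {z. a \<bullet> z = \<beta>}"
  shows "\<exists>P. \<forall>p\<in>rel_interior (convex hull \<sigma>). \<exists>e>0. \<forall>z\<in>ball p e.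
     \<beta> < a \<bullet> z \<longrightarrow> z \<notin> body A \<and> region A z = P"
proof -
  let ?S = "rel_interior (convex hull \<sigma>)"
  have "\<forall>p\<in>?S. \<exists>e>0. \<forall>z\<in>ball p e. \<forall>\<rho>\<in>A. z \<in> convex hull \<rho> \<longrightarrow> \<rho> = \<sigma>"
    using near_top_simplex[OF \<sigma>] by meson
  from bchoice[OF this] obtain e where e0: "\<forall>p\<in>?S. 0 < e p \<and>
    (\<forall>z\<in>ball p (e p). \<forall>\<rho>\<in>A. z \<in> convex hull \<rho> \<longrightarrow> \<rho> = \<sigma>)" by blast
  have e: "0 < e p" if "p \<in> ?S" for p using e0 that by blast
  define H where "H p = ball p (e p) \<inter> {z. \<beta> < a \<bullet> z}" for p
  have conn: "connected (H p)" for p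
    unfolding H_def by (intro convex_connected convex_Int convex_ball convex_halfspace_gt)
  have free: "H p \<subseteq> - body A" if p: "p \<in> ?S" for p
  proof
    fix z assume z: "z \<in> H p"
    show "z \<in> - body A"
    proof
      assume "z \<in> body A"
      then obtain \<rho> where \<rho>: "\<rho> \<in> A" "z \<in> convex hull \<rho>" by (auto simp: body_def)
      then have "\<rho> = \<sigma>" using e0 p z unfolding H_def by blast
      then have "z \<in> affine hull \<sigma>" using \<rho>(2) convex_hull_subset_affine_hull by blast
      then show False using z hyp by (simp add: H_def)
    qed
  qed
  have level: "a \<bullet> p = \<beta>" if "p \<in> ?S" for p
    using that rel_interior_subset[of "convex hull \<sigma>"] convex_hull_subset_affine_hull[of \<sigma>] hyp by blast
  \<comment> \<open>The half-ball at \<open>p\<close> contains short perpendicular pushes of all nearby points \<open>q\<close> of \<open>\<sigma>\<close>.\<close>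
  have push: "q + r *\<^sub>R sgn a \<in> H p" if "q \<in> ?S" "0 < r" "dist p q + r < e p" for p q r
  proof -
    have "dist p (q + r *\<^sub>R sgn a) \<le> dist p q + dist q (q + r *\<^sub>R sgn a)" by (rule dist_triangle)
    also have "dist q (q + r *\<^sub>R sgn a) = r" using that(2) a by (simp add: dist_norm norm_sgn)
    finally have "dist p (q + r *\<^sub>R sgn a) < e p" using that(3) by simp
    moreover have "a \<bullet> sgn a = norm a" using a by (simp add: sgn_div_norm power2_norm_eq_inner[symmetric] power2_eq_square)
    then have "a \<bullet> (q + r *\<^sub>R sgn a) = \<beta> + r * norm a" using level[OF that(1)] by (simp add: inner_add_right)
    ultimately show ?thesis using that(2) a by (simp add: H_def)
  qed
  define h where "h p = region A (p + (e p / 2) *\<^sub>R sgn a)" for p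
  have h: "region A z = h p" if "p \<in> ?S" "z \<in> H p" for p z
    unfolding h_def using e[OF that(1)]
    by (intro region_eq[OF conn free[OF that(1)] that(2)] push) (use that in auto)
  have "h x = h y" if "x \<in> ?S" "y \<in> ?S" for x y
  proof (rule locally_constant_on_dense_imp_constant[where S = ?S and G = ?S])
    show "connected ?S" by (simp add: convex_connected convex_rel_interior)
    show "\<exists>z. z \<in> ?S \<inter> ?S \<inter> ball p e" if "p \<in> ?S" "0 < e" for p e
      using that by (intro exI[of _ p]) auto
    fix p assume p: "p \<in> ?S"
    have "h q = h p" if q: "q \<in> ?S" "dist p q < e p" for q
    proof -
      \<comment> \<open>Small enough for the pushed point to lie in the half-balls at \<open>p\<close> and at \<open>q\<close>.\<close>
      define r where "r = min (e q) (e p - dist p q) / 2"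
      have "0 < r" "r \<le> (e p - dist p q) / 2" "r \<le> e q / 2"
        using q(2) e[OF q(1)] by (auto simp: r_def)
      then have r: "0 < r" "dist p q + r < e p" "dist q q + r < e q"
        using q(2) e[OF q(1)] by (simp_all add: field_simps)
      show ?thesis
        using h[OF p push[OF q(1) r(1,2)]] h[OF q(1) push[OF q(1) r(1,3)]] by simp
    qed
    then show "\<exists>e>0. \<forall>x\<in>?S \<inter> ?S \<inter> ball p e. \<forall>y\<in>?S \<inter> ?S \<inter> ball p e. h x = h y"
      using e[OF p] by (intro exI[of _ "e p"]) auto
  qed (use that in auto)
  then obtain P where P: "\<And>p. p \<in> ?S \<Longrightarrow> h p = P" by (metis (no_types))
  show ?thesis
  proof (intro exI[of _ P] ballI)
    fix p assume p: "p \<in> ?S"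
    have "z \<notin> body A \<and> region A z = P" if "z \<in> ball p (e p)" "\<beta> < a \<bullet> z" for z
    proof -
      have "z \<in> H p" using that by (simp add: H_def)
      then show ?thesis using free[OF p] h[OF p] P[OF p] by auto
    qed
    then show "\<exists>e>0. \<forall>z\<in>ball p e. \<beta> < a \<bullet> z \<longrightarrow> z \<notin> body A \<and> region A z = P"
      using e[OF p] by blast
  qed
qed

lemma sides_exist:
  assumes \<sigma>: "\<sigma> \<in> faces A d"
  shows "\<exists>a \<beta> P Q. sides A \<sigma> a \<beta> P Q"
proof -
  have "aff_dim \<sigma> = DIM('a) - 1"
    using aff_dim_face[OF A, of \<sigma>] faceD[OF \<sigma>] DIM by simp
  then have "\<exists>a \<beta>. a \<noteq> 0 \<and> affine hull \<sigma> = {z. a \<bullet> z = \<beta>}"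
    by (rule iffD1[OF aff_dim_eq_hyperplane])
  then obtain a \<beta> where a: "a \<noteq> 0" "affine hull \<sigma> = {z. a \<bullet> z = \<beta>}" by blast
  have a': "- a \<noteq> 0" "affine hull \<sigma> = {z. - a \<bullet> z = - \<beta>}" using a by auto
  obtain P where P: "\<forall>p\<in>rel_interior (convex hull \<sigma>). \<exists>e>0. \<forall>z\<in>ball p e.
     \<beta> < a \<bullet> z \<longrightarrow> z \<notin> body A \<and> region A z = P" using region_beside[OF \<sigma> a] by blast
  obtain Q where Q: "\<forall>p\<in>rel_interior (convex hull \<sigma>). \<exists>e>0. \<forall>z\<in>ball p e.
     - \<beta> < - a \<bullet> z \<longrightarrow> z \<notin> body A \<and> region A z = Q" using region_beside[OF \<sigma> a'] by blast
  have "\<exists>e>0. \<forall>z\<in>ball p e.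
        (\<forall>\<rho>\<in>A. z \<in> convex hull \<rho> \<longrightarrow> \<rho> = \<sigma>) \<and>
        (a \<bullet> z = \<beta> \<longrightarrow> z \<in> convex hull \<sigma>) \<and>
        (\<beta> < a \<bullet> z \<longrightarrow> z \<notin> body A \<and> region A z = P) \<and>
        (a \<bullet> z < \<beta> \<longrightarrow> z \<notin> body A \<and> region A z = Q)" if p: "p \<in> rel_interior (convex hull \<sigma>)" for p
  proof -
    obtain e1 where e1: "e1 > 0" "\<forall>z\<in>ball p e1. (\<forall>\<rho>\<in>A. z \<in> convex hull \<rho> \<longrightarrow> \<rho> = \<sigma>) \<and>
      (z \<in> affine hull \<sigma> \<longrightarrow> z \<in> convex hull \<sigma>)" using near_top_simplex[OF \<sigma> p] by blast
    obtain e2 where e2: "e2 > 0" "\<forall>z\<in>ball p e2. \<beta> < a \<bullet> z \<longrightarrow> z \<notin> body A \<and> region A z = P"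
      using P p by blast
    obtain e3 where e3: "e3 > 0" "\<forall>z\<in>ball p e3. - \<beta> < - a \<bullet> z \<longrightarrow> z \<notin> body A \<and> region A z = Q"
      using Q p by blast
    show ?thesis
    proof (intro exI[of _ "min e1 (min e2 e3)"] conjI ballI)
      fix z assume "z \<in> ball p (min e1 (min e2 e3))"
      then have z: "z \<in> ball p e1" "z \<in> ball p e2" "z \<in> ball p e3" by auto
      show "z \<in> convex hull \<rho> \<longrightarrow> \<rho> = \<sigma>" if "\<rho> \<in> A" for \<rho>
        using e1(2) z(1) that by blast
      show "a \<bullet> z = \<beta> \<longrightarrow> z \<in> convex hull \<sigma>"
        using e1(2) z(1) a(2) by auto
      show "\<beta> < a \<bullet> z \<longrightarrow> z \<notin> body A \<and> region A z = P" using e2(2) z(2) by blast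
      show "a \<bullet> z < \<beta> \<longrightarrow> z \<notin> body A \<and> region A z = Q" using e3(2) z(3) by simp
    qed (use e1 e2 e3 in auto)
  qed
  then show ?thesis unfolding sides_def using a by blast
qed

text \<open>At most \<open>d + 1\<close> points never span the whole space, which has dimension \<open>d + 1\<close>.\<close>

lemma avoid:
  assumes "open U" "convex U" "U \<noteq> {}" "finite \<T>" "\<And>T. T \<in> \<T> \<Longrightarrow> finite T \<and> card T \<le> d + 1"
  obtains y :: 'a where "y \<in> U" "\<forall>T\<in>\<T>. y \<notin> affine hull T"
proof -
  have "\<exists>y\<in>U. \<forall>G\<in>(\<lambda>T. affine hull T) ` \<T>. y \<notin> G"
  proof (rule general_position)
    fix G assume "G \<in> (\<lambda>T. affine hull T) ` \<T>"
    then obtain T where T: "T \<in> \<T>" "G = affine hull T" by blast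
    then show "affine G" by simp
    have "aff_dim G < int DIM('a)"
      using aff_dim_le_card[of T] assms(5)[OF T(1)] T(2) DIM by simp
    then show "\<not> U \<subseteq> G" using aff_dim_subset[of U G] aff_dim_open[OF assms(1,3)] by auto
  qed (use assms in auto)
  then show ?thesis using that by blast
qed

section \<open>Every cycle is a cut\<close>

text \<open>The adjointness of boundary and coboundary, with the facets of a simplex indexed by the omitted vertex.\<close>

lemma sum_facets_swap:
  fixes c k :: "'a set \<Rightarrow> bit"
  shows "(\<Sum>\<sigma>\<in>faces A d. \<Sum>v\<in>\<sigma>. c \<sigma> * k (\<sigma> - {v})) =
    (\<Sum>\<tau>\<in>{\<tau>\<in>A. card \<tau> = d}. k \<tau> * (\<Sum>\<sigma>\<in>cofaces A d \<tau>. c \<sigma>))"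
proof -
  let ?T = "{\<tau>\<in>A. card \<tau> = d}"
  have "(\<Sum>v\<in>\<sigma>. c \<sigma> * k (\<sigma> - {v})) = (\<Sum>\<tau>\<in>{\<tau>\<in>?T. \<tau> \<subseteq> \<sigma>}. c \<sigma> * k \<tau>)" if \<sigma>: "\<sigma> \<in> faces A d" for \<sigma>
  proof (rule sum.reindex_bij_betw[of "\<lambda>v. \<sigma> - {v}"])
    have \<sigma>': "\<sigma> \<in> A" "card \<sigma> = d + 1" "finite \<sigma>" using faceD[OF \<sigma>] by auto
    show "bij_betw (\<lambda>v. \<sigma> - {v}) \<sigma> {\<tau>\<in>?T. \<tau> \<subseteq> \<sigma>}"
    proof (rule bij_betw_imageI)
      show "inj_on (\<lambda>v. \<sigma> - {v}) \<sigma>" by (auto simp: inj_on_def)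
      show "(\<lambda>v. \<sigma> - {v}) ` \<sigma> = {\<tau>\<in>?T. \<tau> \<subseteq> \<sigma>}"
      proof (intro equalityI subsetI)
        fix \<tau> assume "\<tau> \<in> (\<lambda>v. \<sigma> - {v}) ` \<sigma>"
        then show "\<tau> \<in> {\<tau>\<in>?T. \<tau> \<subseteq> \<sigma>}"
          using \<sigma>' geometric_complexD(4)[OF A \<sigma>'(1)] by auto
      next
        fix \<tau> assume \<tau>: "\<tau> \<in> {\<tau>\<in>?T. \<tau> \<subseteq> \<sigma>}"
        then have "finite \<tau>" using finite_subset \<sigma>'(3) by blast
        then have "card (\<sigma> - \<tau>) = 1" using \<tau> \<sigma>' by (simp add: card_Diff_subset)
        then obtain v where v: "\<sigma> - \<tau> = {v}" by (auto simp: card_1_singleton_iff)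
        then have "v \<in> \<sigma>" "\<tau> = \<sigma> - {v}" using \<tau> by blast+
        then show "\<tau> \<in> (\<lambda>v. \<sigma> - {v}) ` \<sigma>" by blast
      qed
    qed
  qed
  then have "(\<Sum>\<sigma>\<in>faces A d. \<Sum>v\<in>\<sigma>. c \<sigma> * k (\<sigma> - {v})) =
      (\<Sum>\<sigma>\<in>faces A d. \<Sum>\<tau>\<in>{\<tau>\<in>?T. \<tau> \<subseteq> \<sigma>}. c \<sigma> * k \<tau>)" by (rule sum.cong[OF refl])
  also have "\<dots> = (\<Sum>\<tau>\<in>?T. \<Sum>\<sigma>\<in>{\<sigma>\<in>faces A d. \<tau> \<subseteq> \<sigma>}. c \<sigma> * k \<tau>)"
    using finite_faces geometric_complexD(1)[OF A] by (intro sum.swap_restrict) auto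
  also have "\<dots> = (\<Sum>\<tau>\<in>?T. k \<tau> * (\<Sum>\<sigma>\<in>cofaces A d \<tau>. c \<sigma>))"
    by (simp only: cofaces_def sum_distrib_left mult.commute)
  finally show ?thesis .
qed

text \<open>The value of \<open>f\<close> at a region is the indicator of the cone over \<open>c\<close> at any generic point of the region.\<close>

lemma cycle_imp_cut:
  assumes c: "cycle_on A d c"
  obtains f where "\<And>\<sigma> a \<beta> P Q. \<sigma> \<in> faces A d \<Longrightarrow> sides A \<sigma> a \<beta> P Q \<Longrightarrow> c \<sigma> = f P + f Q"
proof -
  have finV: "finite (\<Union>A)" using geometric_complexD(1,3)[OF A] by blast
  obtain x0 where x0: "\<And>T. T \<subseteq> \<Union>A \<Longrightarrow> card T \<le> d + 1 \<Longrightarrow> x0 \<notin> affine hull T"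
  proof (rule avoid[OF open_UNIV convex_UNIV, of "{T. T \<subseteq> \<Union>A \<and> card T \<le> d + 1}"])
    show "finite {T. T \<subseteq> \<Union>A \<and> card T \<le> d + 1}" using finV by simp
    show "finite T \<and> card T \<le> d + 1" if "T \<in> {T. T \<subseteq> \<Union>A \<and> card T \<le> d + 1}" for T
      using that finV finite_subset by blast
  qed auto
  define W where "W = insert x0 (\<Union>A)"
  have finW: "finite W" using finV by (simp add: W_def)
  \<comment> \<open>All the faces of the cones are spanned by subsets of \<open>W\<close>. Good points avoid their hyperplanes, and
    segments between points that miss each other avoid their faces of codimension two.\<close>
  define good where "good x \<longleftrightarrow> (\<forall>T\<subseteq>W. card T \<le> d + 1 \<longrightarrow> x \<notin> affine hull T)" for x
  define miss where "miss x y \<longleftrightarrow> (\<forall>T\<subseteq>W. card T \<le> d \<longrightarrow> affine hull T \<inter> closed_segment x y = {})" for x y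
  have good_exists: "\<exists>y\<in>U. good y \<and> (\<forall>x\<in>X. miss x y)"
    if U: "open U" "convex U" "U \<noteq> {}" and X: "finite X" "\<And>x. x \<in> X \<Longrightarrow> good x" for U X
  proof -
    let ?T = "{T. T \<subseteq> W \<and> card T \<le> d + 1} \<union> (\<Union>x\<in>X. insert x ` {T. T \<subseteq> W \<and> card T \<le> d})"
    have fin: "finite ?T" using finW X(1) by auto
    have small: "finite T \<and> card T \<le> d + 1" if "T \<in> ?T" for T
    proof -
      from that consider "T \<subseteq> W" "card T \<le> d + 1" | x T' where "T = insert x T'" "T' \<subseteq> W" "card T' \<le> d" by blast
      then show ?thesis
      proof cases
        case 1
        then show ?thesis using finW finite_subset by blast
      next
        case 2
        then have "finite T'" using finW finite_subset by blast
        then show ?thesis using 2 by (simp add: card_insert_if)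
      qed
    qed
    obtain y where y: "y \<in> U" "\<forall>T\<in>?T. y \<notin> affine hull T"
      by (rule avoid[OF U fin small])
    have "miss x y" if x: "x \<in> X" for x
      unfolding miss_def
    proof (intro allI impI)
      fix T assume T: "T \<subseteq> W" "card T \<le> d"
      have "x \<notin> affine hull T" using X(2)[OF x] T unfolding good_def by simp
      moreover have "y \<notin> affine hull (insert x T)" using y(2) T x by blast
      ultimately show "affine hull T \<inter> closed_segment x y = {}" by (rule affine_hull_misses_segment)
    qed
    moreover have "good y" using y(2) unfolding good_def by blast
    ultimately show ?thesis using y(1) by blast
  qed
  \<comment> \<open>The indicator modulo 2 of the cone over \<open>c\<close> with apex \<open>x0\<close>.\<close>
  define F where "F x = (\<Sum>\<sigma>\<in>faces A d. c \<sigma> * of_bool (x \<in> convex hull (insert x0 \<sigma>)))" for x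
  have crossing: "F x + F y = (\<Sum>\<sigma>\<in>{\<sigma>\<in>faces A d. convex hull \<sigma> \<inter> closed_segment x y \<noteq> {}}. c \<sigma>)"
    if xy: "good x" "good y" "miss x y" for x y
  proof -
    define m :: "'a set \<Rightarrow> bit" where "m T = of_bool (convex hull T \<inter> closed_segment x y \<noteq> {})" for T
    \<comment> \<open>The facets of a cone are its base and the cones over the facets of the base.\<close>
    have cone: "of_bool (x \<in> convex hull (insert x0 \<sigma>)) + of_bool (y \<in> convex hull (insert x0 \<sigma>)) =
        m \<sigma> + (\<Sum>v\<in>\<sigma>. m (insert x0 (\<sigma> - {v})))" if \<sigma>: "\<sigma> \<in> faces A d" for \<sigma>
    proof -
      have \<sigma>': "\<sigma> \<in> A" "card \<sigma> = d + 1" "finite \<sigma>" using faceD[OF \<sigma>] by auto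
      have "\<sigma> \<subseteq> \<Union>A" using \<sigma>'(1) by blast
      then have x0\<sigma>: "x0 \<notin> affine hull \<sigma>" using x0 \<sigma>'(2) by simp
      then have nin: "x0 \<notin> \<sigma>" using hull_inc by metis
      have card: "card (insert x0 \<sigma>) = d + 2" using nin \<sigma>' by simp
      have adim: "aff_dim (insert x0 \<sigma>) = int (d + 1)"
        using x0\<sigma> aff_dim_face[OF A \<sigma>'(1)] \<sigma>'(2) by (simp add: aff_dim_insert)
      have ind: "\<not> affine_dependent (insert x0 \<sigma>)"
        unfolding affine_independent_iff_card using adim card \<sigma>'(3) by simp
      have full: "affine hull (insert x0 \<sigma>) = UNIV" using adim DIM aff_dim_eq_full by metis
      have sub: "insert x0 \<sigma> \<subseteq> W" using \<open>\<sigma> \<subseteq> \<Union>A\<close> by (auto simp: W_def)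
      have "of_bool (x \<in> convex hull (insert x0 \<sigma>)) + of_bool (y \<in> convex hull (insert x0 \<sigma>)) =
        (\<Sum>v\<in>{v\<in>insert x0 \<sigma>. convex hull (insert x0 \<sigma> - {v}) \<inter> closed_segment x y \<noteq> {}}. 1 :: bit)"
      proof (rule simplex_crossing[OF ind full])
        show "convex hull T \<inter> closed_segment x y = {}" if "T \<subseteq> insert x0 \<sigma>" "card T + 2 \<le> card (insert x0 \<sigma>)" for T
        proof -
          have "affine hull T \<inter> closed_segment x y = {}"
            using xy(3) that sub card unfolding miss_def by auto
          then show ?thesis using convex_hull_subset_affine_hull[of T] by blast
        qed
        have "z \<notin> affine hull (insert x0 \<sigma> - {v})" if "good z" "v \<in> insert x0 \<sigma>" for z v
        proof -
          have "card (insert x0 \<sigma> - {v}) = d + 1" using card that(2) \<sigma>'(3) by simp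
          moreover have "insert x0 \<sigma> - {v} \<subseteq> W" using sub by blast
          ultimately show ?thesis using that(1) unfolding good_def by simp
        qed
        then show "x \<notin> affine hull (insert x0 \<sigma> - {v})" "y \<notin> affine hull (insert x0 \<sigma> - {v})"
          if "v \<in> insert x0 \<sigma>" for v using xy that by blast+
      qed
      also have "\<dots> = (\<Sum>v\<in>insert x0 \<sigma>. m (insert x0 \<sigma> - {v}))"
        using \<sigma>'(3) by (intro sum.mono_neutral_cong_left) (auto simp: m_def)
      also have "\<dots> = m (insert x0 \<sigma> - {x0}) + (\<Sum>v\<in>\<sigma>. m (insert x0 \<sigma> - {v}))"
        by (rule sum.insert[OF \<sigma>'(3) nin])
      also have "insert x0 \<sigma> - {x0} = \<sigma>" using nin by simp
      also have "(\<Sum>v\<in>\<sigma>. m (insert x0 \<sigma> - {v})) = (\<Sum>v\<in>\<sigma>. m (insert x0 (\<sigma> - {v})))"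
        by (rule sum.cong[OF refl]) (metis insert_Diff_if nin singletonD)
      finally show ?thesis .
    qed
    have "F x + F y = (\<Sum>\<sigma>\<in>faces A d. c \<sigma> * (m \<sigma> + (\<Sum>v\<in>\<sigma>. m (insert x0 (\<sigma> - {v})))))"
      unfolding F_def sum.distrib[symmetric] distrib_left[symmetric] by (rule sum.cong[OF refl]) (simp only: cone)
    also have "\<dots> = (\<Sum>\<sigma>\<in>faces A d. c \<sigma> * m \<sigma>) + (\<Sum>\<sigma>\<in>faces A d. \<Sum>v\<in>\<sigma>. c \<sigma> * m (insert x0 (\<sigma> - {v})))"
      by (simp only: distrib_left sum.distrib sum_distrib_left)
    also have "(\<Sum>\<sigma>\<in>faces A d. \<Sum>v\<in>\<sigma>. c \<sigma> * m (insert x0 (\<sigma> - {v}))) =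
        (\<Sum>\<tau>\<in>{\<tau>\<in>A. card \<tau> = d}. m (insert x0 \<tau>) * (\<Sum>\<sigma>\<in>cofaces A d \<tau>. c \<sigma>))"
      by (rule sum_facets_swap)
    also have "\<dots> = 0"
    proof (rule sum.neutral, intro ballI)
      fix \<tau> assume \<tau>: "\<tau> \<in> {\<tau>\<in>A. card \<tau> = d}"
      then have "\<tau> \<noteq> {}" using d by auto
      then have "(\<Sum>\<sigma>\<in>cofaces A d \<tau>. c \<sigma>) = 0" using c \<tau> unfolding cycle_on_def by blast
      then show "m (insert x0 \<tau>) * (\<Sum>\<sigma>\<in>cofaces A d \<tau>. c \<sigma>) = 0" by simp
    qed
    also have "(\<Sum>\<sigma>\<in>faces A d. c \<sigma> * m \<sigma>) + 0 =
        (\<Sum>\<sigma>\<in>{\<sigma>\<in>faces A d. convex hull \<sigma> \<inter> closed_segment x y \<noteq> {}}. c \<sigma>)"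
      unfolding add_0_right using finite_faces
      by (intro sum.mono_neutral_cong_right) (auto simp: m_def)
    finally show ?thesis .
  qed
  have same: "F x = F y" if U: "open U" "connected U" "U \<subseteq> - body A"
    and xy: "x \<in> U" "good x" "y \<in> U" "good y" for U x y
  proof (rule locally_constant_on_dense_imp_constant[where S = U and G = "Collect good"])
    show "connected U" by (rule U)
    show "\<exists>z. z \<in> Collect good \<inter> U \<inter> ball p e" if p: "p \<in> U" "0 < e" for p e
    proof -
      obtain e' where e': "0 < e'" "ball p e' \<subseteq> U" using U(1) p(1) by (rule openE)
      have "ball p (min e e') \<noteq> {}" using p(2) e'(1) by simp
      then obtain z where "z \<in> ball p (min e e')" "good z"
        using good_exists[of "ball p (min e e')" "{}"] by auto
      then show ?thesis using e'(2) by (intro exI[of _ z]) auto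
    qed
    fix p assume p: "p \<in> U"
    obtain e where e: "0 < e" "ball p e \<subseteq> U" using U(1) p by (rule openE)
    have pair: "F a = F b" if ab: "a \<in> ball p e" "b \<in> ball p e" "good a" "good b" "miss a b" for a b
    proof -
      have "closed_segment a b \<subseteq> ball p e" using ab by (intro closed_segment_subset) auto
      then have "closed_segment a b \<inter> body A = {}" using e(2) U(3) by blast
      then have "{\<sigma>\<in>faces A d. convex hull \<sigma> \<inter> closed_segment a b \<noteq> {}} = {}"
        using hull_subset_body faceD by blast
      then have "F a + F b = 0" using crossing[OF ab(3-5)] by (simp only: sum.empty)
      then show ?thesis by (cases "F a"; cases "F b") auto
    qed
    have "F a = F b" if ab: "a \<in> ball p e" "b \<in> ball p e" "good a" "good b" for a b
    proof -
      have "\<exists>z\<in>ball p e. good z \<and> (\<forall>x\<in>{a, b}. miss x z)"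
        by (rule good_exists) (use e(1) ab in auto)
      then obtain z where "z \<in> ball p e" "good z" "miss a z" "miss b z" by blast
      then show ?thesis using pair[of a z] pair[of b z] ab by simp
    qed
    then show "\<exists>e>0. \<forall>x\<in>Collect good \<inter> U \<inter> ball p e. \<forall>y\<in>Collect good \<inter> U \<inter> ball p e. F x = F y"
      using e(1) by blast
  qed (use xy in auto)
  define f where "f R = F (SOME x. x \<in> R \<and> good x)" for R
  have f: "f (region A x) = F x" if x: "x \<notin> body A" "good x" for x
  proof -
    let ?R = "region A x"
    have xR: "x \<in> ?R" using x(1) by (simp add: region_def connected_component_refl_eq)
    define z where "z = (SOME z. z \<in> ?R \<and> good z)"
    have z: "z \<in> ?R \<and> good z" unfolding z_def by (rule someI[of _ x]) (simp add: xR x(2))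
    have "open ?R" unfolding region_def by (intro open_connected_component open_Compl closed_body[OF A])
    moreover have "connected ?R" unfolding region_def by simp
    moreover have "?R \<subseteq> - body A" unfolding region_def by (rule connected_component_subset)
    ultimately have "F z = F x" by (rule same) (use z xR x(2) in simp_all)
    then show ?thesis by (simp add: f_def z_def)
  qed
  show ?thesis
  proof (rule that[of f])
    fix \<sigma> a \<beta> P Q assume \<sigma>: "\<sigma> \<in> faces A d" and s: "sides A \<sigma> a \<beta> P Q"
    have "\<sigma> \<noteq> {}" using faceD[OF \<sigma>] by auto
    then have "rel_interior (convex hull \<sigma>) \<noteq> {}" by (simp add: rel_interior_eq_empty)
    then obtain p where p: "p \<in> rel_interior (convex hull \<sigma>)" by blast
    obtain e where e: "e > 0" and e_only: "\<forall>z\<in>ball p e. \<forall>\<rho>\<in>A. z \<in> convex hull \<rho> \<longrightarrow> \<rho> = \<sigma>"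
      and e_on: "\<forall>z\<in>ball p e. a \<bullet> z = \<beta> \<longrightarrow> z \<in> convex hull \<sigma>"
      and e_P: "\<forall>z\<in>ball p e. \<beta> < a \<bullet> z \<longrightarrow> z \<notin> body A \<and> region A z = P"
      and e_Q: "\<forall>z\<in>ball p e. a \<bullet> z < \<beta> \<longrightarrow> z \<notin> body A \<and> region A z = Q"
      by (rule sidesD[OF s p])
    have a: "a \<noteq> 0" and hyp: "affine hull \<sigma> = {z. a \<bullet> z = \<beta>}" using s by (auto simp: sides_def)
    have ap: "a \<bullet> p = \<beta>"
      using p rel_interior_subset[of "convex hull \<sigma>"] convex_hull_subset_affine_hull[of \<sigma>] hyp by blast
    have asgn: "a \<bullet> sgn a = norm a" using a by (simp add: sgn_div_norm power2_norm_eq_inner[symmetric] power2_eq_square)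
    let ?U = "ball p e \<inter> {z. \<beta> < a \<bullet> z}" and ?V = "ball p e \<inter> {z. a \<bullet> z < \<beta>}"
    have "p + (e/2) *\<^sub>R sgn a \<in> ?U" "p - (e/2) *\<^sub>R sgn a \<in> ?V"
      using e a by (auto simp: dist_norm norm_sgn inner_add_right inner_diff_right ap asgn)
    then have ne: "?U \<noteq> {}" "?V \<noteq> {}" by blast+
    \<comment> \<open>A generic segment across \<open>\<sigma>\<close> near \<open>p\<close>.\<close>
    have "\<exists>x\<in>?U. good x \<and> (\<forall>x'\<in>{}. miss x' x)"
      by (rule good_exists) (use ne in \<open>auto intro!: open_Int convex_Int open_halfspace_gt convex_halfspace_gt\<close>)
    then obtain x where x: "x \<in> ball p e" "\<beta> < a \<bullet> x" "good x" by blast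
    have "\<exists>y\<in>?V. good y \<and> (\<forall>x'\<in>{x}. miss x' y)"
      by (rule good_exists) (use ne x in \<open>auto intro!: open_Int convex_Int open_halfspace_lt convex_halfspace_lt\<close>)
    then obtain y where y: "y \<in> ball p e" "a \<bullet> y < \<beta>" "good y" "miss x y" by blast
    have seg: "closed_segment x y \<subseteq> ball p e" using x y by (intro closed_segment_subset) auto
    have "\<exists>z\<in>closed_segment x y. a \<bullet> z = \<beta>"
      by (rule connected_ivt_hyperplane[of _ y x]) (use x y in auto)
    then obtain z where z: "z \<in> closed_segment x y" "a \<bullet> z = \<beta>" by blast
    have "z \<in> convex hull \<sigma>" using e_on z seg by blast
    then have "{\<rho>\<in>faces A d. convex hull \<rho> \<inter> closed_segment x y \<noteq> {}} = {\<sigma>}"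
      using \<sigma> z(1) seg e_only faceD by blast
    then have "F x + F y = c \<sigma>" using crossing[OF x(3) y(3,4)] by simp
    moreover have "f P = F x" "f Q = F y"
      using f[of x] f[of y] x y e_P e_Q by auto
    ultimately show "c \<sigma> = f P + f Q" by simp
  qed
qed

end

section \<open>Every cut is a cycle\<close>

lemma linear_if_affine:
  fixes f :: "'a::real_vector \<Rightarrow> real"
  assumes f: "\<And>x y s. f ((1 - s) *\<^sub>R x + s *\<^sub>R y) = (1 - s) * f x + s * f y" and b: "f b = 0"
  shows "linear (\<lambda>u. f (b + u))"
proof
  have scale: "f (b + r *\<^sub>R u) = r * f (b + u)" for r u
    using f[of r b "b + u"] b by (simp add: algebra_simps)
  show "f (b + r *\<^sub>R u) = r *\<^sub>R f (b + u)" for r u by (simp add: scale)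
  show "f (b + (u + v)) = f (b + u) + f (b + v)" for u v
  proof -
    have "(1 - 1/2) *\<^sub>R (b + 2 *\<^sub>R u) + (1/2) *\<^sub>R (b + 2 *\<^sub>R v) = b + (u + v)"
      by (simp add: algebra_simps flip: scaleR_left_distrib)
    then show ?thesis using f[of "1/2" "b + 2 *\<^sub>R u" "b + 2 *\<^sub>R v"] by (simp add: scale)
  qed
qed

context hypersurface_complex
begin

text \<open>The functions \<open>\<alpha>\<close> and \<open>\<gamma>\<close> are coordinates on the plane transversal to \<open>\<tau>\<close>, with axes \<open>w1\<close> and \<open>w2\<close>
  chosen in general position, so that no coface of \<open>\<tau>\<close> lies along an axis.\<close>

lemma transversal_coordinates:
  assumes \<tau>: "\<tau> \<in> A" "card \<tau> = d" and b: "b \<in> affine hull \<tau>"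
    and V: "finite V" "\<And>v. v \<in> V \<Longrightarrow> v \<notin> \<tau> \<and> insert v \<tau> \<in> A"
  obtains \<alpha> \<gamma> :: "'a \<Rightarrow> real" and w1 w2 where
    "linear \<alpha>" "linear \<gamma>" "\<alpha> w1 = 1" "\<alpha> w2 = 0" "\<gamma> w1 = 0" "\<gamma> w2 = 1"
    "\<And>u. b + u \<in> affine hull \<tau> \<longleftrightarrow> \<alpha> u = 0 \<and> \<gamma> u = 0"
    "\<And>v. v \<in> V \<Longrightarrow> \<alpha> (v - b) \<noteq> 0 \<and> \<gamma> (v - b) \<noteq> 0"
    "\<And>v. v \<in> V \<Longrightarrow> b + w1 \<notin> affine hull (insert v \<tau>)"
proof -
  have fin\<tau>: "finite \<tau>" using geometric_complexD(3)[OF A \<tau>(1)] .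
  have dim\<tau>: "aff_dim \<tau> = int d - 1" using aff_dim_face[OF A \<tau>(1)] \<tau>(2) by simp
  let ?T = "insert \<tau> ((\<lambda>v. insert v \<tau>) ` V)"
  have finT: "finite ?T" using V(1) by simp
  have smallT: "finite T \<and> card T \<le> d + 1" if "T \<in> ?T" for T
    using that fin\<tau> \<tau>(2) by (auto simp: card_insert_if)
  obtain y1 where y1: "\<forall>T\<in>?T. y1 \<notin> affine hull T"
    by (rule avoid[OF open_UNIV convex_UNIV UNIV_not_empty finT smallT])
  let ?T2 = "insert (insert y1 \<tau>) ?T"
  have finT2: "finite ?T2" using V(1) by simp
  have smallT2: "finite T \<and> card T \<le> d + 1" if "T \<in> ?T2" for T
    using that smallT[of T] fin\<tau> \<tau>(2) by (auto simp: card_insert_if)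
  obtain y2 where y2: "\<forall>T\<in>?T2. y2 \<notin> affine hull T"
    by (rule avoid[OF open_UNIV convex_UNIV UNIV_not_empty finT2 smallT2])
  have y1\<tau>: "y1 \<notin> affine hull \<tau>" and y2\<tau>: "y2 \<notin> affine hull (insert y1 \<tau>)" "y2 \<notin> affine hull \<tau>"
    using y1 y2 by auto
  have nin: "y1 \<notin> \<tau>" "y2 \<notin> insert y1 \<tau>" using y1\<tau> y2\<tau> hull_inc by metis+
  define S where "S = insert y2 (insert y1 \<tau>)"
  have adim: "aff_dim S = int (d + 1)" using y1\<tau> y2\<tau>(1) dim\<tau> by (simp add: S_def aff_dim_insert)
  have "card S = d + 2" using nin fin\<tau> \<tau>(2) by (simp add: S_def)
  then have ind: "\<not> affine_dependent S"
    unfolding affine_independent_iff_card using adim fin\<tau> by (simp add: S_def)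
  have full: "affine hull S = UNIV" using adim DIM aff_dim_eq_full by metis
  obtain \<beta> where \<beta>: "\<And>v x y s. v \<in> S \<Longrightarrow> \<beta> v ((1 - s) *\<^sub>R x + s *\<^sub>R y) = (1 - s) * \<beta> v x + s * \<beta> v y"
    and aff: "\<And>T x. T \<subseteq> S \<Longrightarrow> x \<in> affine hull T \<longleftrightarrow> (\<forall>v\<in>S - T. \<beta> v x = 0)"
    and "\<And>T x. T \<subseteq> S \<Longrightarrow> x \<in> convex hull T \<longleftrightarrow> (\<forall>v\<in>S. 0 \<le> \<beta> v x) \<and> (\<forall>v\<in>S - T. \<beta> v x = 0)"
    and sum1: "\<And>x. (\<Sum>v\<in>S. \<beta> v x) = 1"
    by (rule barycentric_coordinates[OF ind full]; rule that)
  have yS: "y1 \<in> S" "y2 \<in> S" "y1 \<noteq> y2" using nin by (auto simp: S_def)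
  have aff\<tau>: "x \<in> affine hull \<tau> \<longleftrightarrow> \<beta> y1 x = 0 \<and> \<beta> y2 x = 0" for x
    using aff[of \<tau> x] nin by (auto simp: S_def)
  have aff1: "x \<in> affine hull (insert y1 \<tau>) \<longleftrightarrow> \<beta> y2 x = 0" for x
    using aff[of "insert y1 \<tau>" x] nin by (auto simp: S_def)
  have aff2: "x \<in> affine hull (insert y2 \<tau>) \<longleftrightarrow> \<beta> y1 x = 0" for x
    using aff[of "insert y2 \<tau>" x] nin by (auto simp: S_def)
  have vertex: "\<beta> v v = 1 \<and> (\<forall>w\<in>S - {v}. \<beta> w v = 0)" if "v \<in> S" for v
  proof -
    have 0: "\<forall>w\<in>S - {v}. \<beta> w v = 0" using aff[of "{v}" v] that by simp
    then have "(\<Sum>w\<in>S. \<beta> w v) = (\<Sum>w\<in>{v}. \<beta> w v)"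
      using that ind by (intro sum.mono_neutral_right) (auto intro: aff_independent_finite)
    then show ?thesis using 0 sum1[of v] by simp
  qed
  have b0: "\<beta> y1 b = 0" "\<beta> y2 b = 0" using b aff\<tau> by auto
  show ?thesis
  proof (rule that[of "\<lambda>u. \<beta> y1 (b + u)" "\<lambda>u. \<beta> y2 (b + u)" "y1 - b" "y2 - b"])
    show "linear (\<lambda>u. \<beta> y1 (b + u))" by (rule linear_if_affine[OF \<beta>[OF yS(1)] b0(1)])
    show "linear (\<lambda>u. \<beta> y2 (b + u))" by (rule linear_if_affine[OF \<beta>[OF yS(2)] b0(2)])
    show "\<beta> y1 (b + (y1 - b)) = 1" "\<beta> y1 (b + (y2 - b)) = 0"
         "\<beta> y2 (b + (y1 - b)) = 0" "\<beta> y2 (b + (y2 - b)) = 1"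
      using vertex yS by auto
    show "b + u \<in> affine hull \<tau> \<longleftrightarrow> \<beta> y1 (b + u) = 0 \<and> \<beta> y2 (b + u) = 0" for u by (rule aff\<tau>)
    fix v assume v: "v \<in> V"
    have v\<tau>: "v \<notin> affine hull \<tau>" using not_in_affine_hull_insert[OF A] V(2)[OF v] by blast
    \<comment> \<open>Exchange property: \<open>v\<close> cannot lie along an axis through \<open>y\<close> unless \<open>y\<close> lies in the hull of the coface.\<close>
    have exch: "y \<in> affine hull (insert v \<tau>)" if "v \<in> affine hull (insert y \<tau>)" "y \<notin> affine hull \<tau>" for y
    proof -
      have "insert v \<tau> \<subseteq> affine hull (insert y \<tau>)"
        using that(1) hull_subset[of "insert y \<tau>" affine] by auto
      moreover have "aff_dim (insert v \<tau>) = aff_dim (affine hull (insert y \<tau>))"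
        using v\<tau> that(2) by (simp add: aff_dim_insert)
      ultimately have "affine hull (insert v \<tau>) = affine hull (insert y \<tau>)"
        using aff_dim_eq_full_gen[of "insert v \<tau>" "affine hull (insert y \<tau>)"] by simp
      then show ?thesis by (simp add: hull_inc)
    qed
    have "\<beta> y1 v \<noteq> 0" using exch[of y2] aff2[of v] y2\<tau>(2) y2 v by auto
    moreover have "\<beta> y2 v \<noteq> 0" using exch[of y1] aff1[of v] y1\<tau> y1 v by auto
    ultimately show "\<beta> y1 (b + (v - b)) \<noteq> 0 \<and> \<beta> y2 (b + (v - b)) \<noteq> 0" by simp
    show "b + (y1 - b) \<notin> affine hull (insert v \<tau>)" using y1 v by simp
  qed
qed

text \<open>In the transversal coordinates the cofaces of \<open>\<tau>\<close> are rays from the origin, none along an axis. The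
  quadrilateral with corners \<open>\<plusminus>w1\<close>, \<open>\<plusminus>w2\<close>, scaled by a small \<open>\<epsilon>\<close>, is crossed by each ray on one side, namely
  in the quadrant of the ray. Every corner belongs to two sides, so the values of \<open>f\<close> at the corners cancel.\<close>

lemma cut_imp_cycle:
  assumes cut: "\<And>\<sigma>. \<sigma> \<in> faces A d \<Longrightarrow> \<exists>a \<beta> P Q. sides A \<sigma> a \<beta> P Q \<and> c \<sigma> = f P + f Q"
  shows "cycle_on A d c"
  unfolding cycle_on_def
proof (intro ballI impI)
  fix \<tau> assume \<tau>A: "\<tau> \<in> A" and "\<tau> \<noteq> {} \<and> card \<tau> = d"
  then have ne: "\<tau> \<noteq> {}" and \<tau>: "\<tau> \<in> A" "card \<tau> = d" by auto
  then have "rel_interior (convex hull \<tau>) \<noteq> {}" by (simp add: rel_interior_eq_empty)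
  then obtain b where b: "b \<in> rel_interior (convex hull \<tau>)" by blast
  then have baff: "b \<in> affine hull \<tau>"
    using rel_interior_subset convex_hull_subset_affine_hull by blast
  define V where "V = {v. v \<notin> \<tau> \<and> insert v \<tau> \<in> A}"
  have "V \<subseteq> \<Union>A" by (auto simp: V_def)
  moreover have "finite (\<Union>A)" using geometric_complexD(1,3)[OF A] by blast
  ultimately have finV: "finite V" by (rule finite_subset)
  have V: "v \<notin> \<tau> \<and> insert v \<tau> \<in> A" if "v \<in> V" for v using that by (simp add: V_def)
  have Vface: "insert v \<tau> \<in> faces A d" if "v \<in> V" for v
    using V[OF that] \<tau> geometric_complexD(3)[OF A \<tau>(1)] by (simp add: faces_def)
  have cof: "cofaces A d \<tau> = (\<lambda>v. insert v \<tau>) ` V"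
    using mem_cofaces_iff[OF A \<tau>] by (auto simp: V_def)
  have "inj_on (\<lambda>v. insert v \<tau>) V" using V by (auto simp: inj_on_def)
  then have sumcof: "(\<Sum>\<sigma>\<in>cofaces A d \<tau>. c \<sigma>) = (\<Sum>v\<in>V. c (insert v \<tau>))"
    unfolding cof by (simp add: sum.reindex)
  obtain \<alpha> \<gamma> :: "'a \<Rightarrow> real" and w1 w2 where lin: "linear \<alpha>" "linear \<gamma>"
    and w: "\<alpha> w1 = 1" "\<alpha> w2 = 0" "\<gamma> w1 = 0" "\<gamma> w2 = 1"
    and L: "\<And>u. b + u \<in> affine hull \<tau> \<longleftrightarrow> \<alpha> u = 0 \<and> \<gamma> u = 0"
    and nz: "\<And>v. v \<in> V \<Longrightarrow> \<alpha> (v - b) \<noteq> 0 \<and> \<gamma> (v - b) \<noteq> 0"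
    and off: "\<And>v. v \<in> V \<Longrightarrow> b + w1 \<notin> affine hull (insert v \<tau>)"
    by (rule transversal_coordinates[OF \<tau> baff finV V]) blast+
  \<comment> \<open>The ray of the coface with vertex \<open>v\<close> meets the side \<open>(1 - t) s1 w1 + t s2 w2\<close> of the quadrilateral in
    its quadrant at \<open>t = t v\<close>; this point is \<open>dir v\<close>.\<close>
  define den where "den v = \<bar>\<alpha> (v - b)\<bar> + \<bar>\<gamma> (v - b)\<bar>" for v
  define t where "t v = \<bar>\<gamma> (v - b)\<bar> / den v" for v
  have den: "0 < den v" if "v \<in> V" for v using nz[OF that] by (simp add: den_def add_pos_pos)
  have t1: "1 - t v = \<bar>\<alpha> (v - b)\<bar> / den v" if "v \<in> V" for v
    using den[OF that] by (simp add: t_def field_simps den_def)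
  define dir where "dir v = ((1 - t v) * sgn (\<alpha> (v - b))) *\<^sub>R w1 + (t v * sgn (\<gamma> (v - b))) *\<^sub>R w2" for v
  have ray: "\<exists>e>0. \<forall>r. 0 \<le> r \<longrightarrow> r \<le> e \<longrightarrow> b + r *\<^sub>R dir v \<in> convex hull (insert v \<tau>)" if v: "v \<in> V" for v
  proof -
    define l where "l = dir v - (1 / den v) *\<^sub>R (v - b)"
    have "\<alpha> l = (1 - t v) * sgn (\<alpha> (v - b)) - \<alpha> (v - b) / den v"
      unfolding l_def dir_def by (simp add: linear_diff[OF lin(1)] linear_add[OF lin(1)] linear_scale[OF lin(1)] w)
    also have "\<dots> = 0" unfolding t1[OF v] by (simp add: abs_mult_sgn)
    finally have 1: "\<alpha> l = 0" .
    have "\<gamma> l = t v * sgn (\<gamma> (v - b)) - \<gamma> (v - b) / den v"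
      unfolding l_def dir_def by (simp add: linear_diff[OF lin(2)] linear_add[OF lin(2)] linear_scale[OF lin(2)] w)
    also have "\<dots> = 0" unfolding t_def by (simp add: abs_mult_sgn)
    finally have l: "b + l \<in> affine hull \<tau>" using L[of l] 1 by simp
    have "l + (1 / den v) *\<^sub>R (v - b) = dir v" by (simp add: l_def)
    moreover have "0 \<le> 1 / den v" using den[OF v] by simp
    ultimately show ?thesis using rel_interior_ray[OF b l, of "1 / den v" v] by metis
  qed
  then obtain E where E: "\<And>v. v \<in> V \<Longrightarrow> 0 < E v"
    "\<And>v r. v \<in> V \<Longrightarrow> 0 \<le> r \<Longrightarrow> r \<le> E v \<Longrightarrow> b + r *\<^sub>R dir v \<in> convex hull (insert v \<tau>)" by metis
  obtain e0 where e0: "e0 > 0" "\<And>\<rho> y. \<rho> \<in> A \<Longrightarrow> y \<in> convex hull \<rho> \<Longrightarrow> dist b y < e0 \<Longrightarrow> \<tau> \<subseteq> \<rho>"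
    using near_carrier[OF A \<tau>(1) b] by blast
  \<comment> \<open>Small enough for the quadrilateral to meet only simplices that contain \<open>\<tau>\<close> and for the crossing points
    to lie in the cofaces.\<close>
  define \<epsilon> where "\<epsilon> = Min (insert (e0 / (2 * (norm w1 + norm w2 + 1))) (E ` V))"
  have wpos: "0 < norm w1 + norm w2 + 1" using norm_ge_zero[of w1] norm_ge_zero[of w2] by linarith
  have "\<epsilon> \<in> insert (e0 / (2 * (norm w1 + norm w2 + 1))) (E ` V)"
    unfolding \<epsilon>_def using finV by (intro Min_in) auto
  then have \<epsilon>: "0 < \<epsilon>" using e0(1) wpos E(1) by auto
  have \<epsilon>E: "\<epsilon> \<le> E v" if "v \<in> V" for v unfolding \<epsilon>_def using finV that by (intro Min_le) auto
  have "\<epsilon> \<le> e0 / (2 * (norm w1 + norm w2 + 1))" unfolding \<epsilon>_def using finV by (intro Min_le) auto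
  then have "\<epsilon> * (norm w1 + norm w2) \<le> e0 / (2 * (norm w1 + norm w2 + 1)) * (norm w1 + norm w2)"
    by (intro mult_right_mono) auto
  also have "\<dots> < e0" using e0(1) wpos by (simp add: field_simps add_nonneg_pos)
  finally have \<epsilon>0: "\<epsilon> * (norm w1 + norm w2) < e0" .
  define X where "X s = b + (\<epsilon> * s) *\<^sub>R w1" for s :: real
  define Y where "Y s = b + (\<epsilon> * s) *\<^sub>R w2" for s :: real
  define g where "g z = f (region A z)" for z
  have side: "g (X s1) + g (Y s2) =
      (\<Sum>v\<in>{v\<in>V. sgn (\<alpha> (v - b)) = s1 \<and> sgn (\<gamma> (v - b)) = s2}. c (insert v \<tau>))"
    if s12: "s1 \<in> {1, -1}" "s2 \<in> {1, -1}" for s1 s2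
  proof -
    let ?I = "{v\<in>V. sgn (\<alpha> (v - b)) = s1 \<and> sgn (\<gamma> (v - b)) = s2}"
    define p where "p s = (1 - s) *\<^sub>R X s1 + s *\<^sub>R Y s2" for s
    define u where "u s = ((1 - s) * s1) *\<^sub>R w1 + (s * s2) *\<^sub>R w2" for s
    have p: "p s = b + \<epsilon> *\<^sub>R u s" for s
      by (simp add: p_def X_def Y_def u_def algebra_simps)
    have u: "\<alpha> (u s) = (1 - s) * s1" "\<gamma> (u s) = s * s2" for s
      by (simp_all add: u_def linear_add[OF lin(1)] linear_scale[OF lin(1)]
          linear_add[OF lin(2)] linear_scale[OF lin(2)] w)
    have abs1: "\<bar>s1\<bar> = 1" "\<bar>s2\<bar> = 1" "s1 \<noteq> 0" "s2 \<noteq> 0" using s12 by auto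
    have p\<tau>: "p s \<notin> affine hull \<tau>" for s
      using L[of "\<epsilon> *\<^sub>R u s"] \<epsilon> abs1(3,4)
      by (auto simp: p linear_scale[OF lin(1)] linear_scale[OF lin(2)] u)
    have near: "dist b (p s) < e0" if "s \<in> {0..1}" for s
    proof -
      have "norm (u s) \<le> norm (((1 - s) * s1) *\<^sub>R w1) + norm ((s * s2) *\<^sub>R w2)"
        unfolding u_def by (rule norm_triangle_ineq)
      also have "\<dots> = (1 - s) * norm w1 + s * norm w2" using that abs1 by (simp add: abs_mult)
      also have "\<dots> \<le> 1 * norm w1 + 1 * norm w2"
        using that by (intro add_mono mult_right_mono) auto
      finally have "\<epsilon> * norm (u s) \<le> \<epsilon> * (norm w1 + norm w2)"
        using \<epsilon> by (intro mult_left_mono) simp_all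
      then have "\<epsilon> * norm (u s) < e0" using \<epsilon>0 by linarith
      then show ?thesis using \<epsilon> by (simp add: p dist_norm)
    qed
    have carrier: "\<exists>v\<in>V. \<rho> = insert v \<tau>" if s: "s \<in> {0..1}" and \<rho>: "\<rho> \<in> A" "p s \<in> convex hull \<rho>" for s \<rho>
    proof -
      have sub: "\<tau> \<subseteq> \<rho>" by (rule e0(2)[OF \<rho> near[OF s]])
      have "\<rho> \<noteq> \<tau>" using p\<tau>[of s] \<rho>(2) convex_hull_subset_affine_hull by blast
      then obtain v where "v \<notin> \<tau>" "\<rho> = insert v \<tau>"
        by (rule coface_insert[OF geometric_complexD(3)[OF A \<tau>(1)] \<tau>(2) sub _ dim[OF \<rho>(1)] geometric_complexD(3)[OF A \<rho>(1)]])
      then show ?thesis using \<rho>(1) by (auto simp: V_def)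
    qed
    have relint: "p s \<in> rel_interior (convex hull (insert v \<tau>))"
      if s: "s \<in> {0..1}" and v: "v \<in> V" "p s \<in> convex hull (insert v \<tau>)" for s v
    proof -
      have vA: "insert v \<tau> \<in> A" using V[OF v(1)] by blast
      then have "p s \<in> body A" using v(2) hull_subset_body by blast
      then obtain \<rho> where \<rho>: "\<rho> \<in> A" "p s \<in> rel_interior (convex hull \<rho>)" by (rule body_carrier[OF A])
      then obtain v' where v': "v' \<in> V" "\<rho> = insert v' \<tau>"
        using carrier[OF s \<rho>(1)] rel_interior_subset by blast
      have "\<rho> \<subseteq> insert v \<tau>" by (rule carrier_subset[OF A vA \<rho> v(2)])
      then have "v' = v" using v' V[OF v'(1)] by blast
      then show ?thesis using \<rho>(2) v'(2) by simp
    qed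
    have at_t: "p (t v) \<in> convex hull (insert v \<tau>)" if "v \<in> ?I" for v
    proof -
      have "u (t v) = dir v" using that by (simp add: u_def dir_def)
      then show ?thesis using E(2)[of v \<epsilon>] \<epsilon> \<epsilon>E[of v] that by (simp add: p)
    qed
    have t01: "0 < t v \<and> t v < 1" if "v \<in> V" for v
    proof -
      have "0 < t v" "0 < 1 - t v"
        using nz[OF that] den[OF that] unfolding t1[OF that] by (simp_all add: t_def)
      then show ?thesis by simp
    qed
    \<comment> \<open>Comparing coordinates shows that a coface can be met only in its own quadrant and at \<open>t v\<close>.\<close>
    have only_t: "v \<in> ?I \<and> s = t v" if s: "s \<in> {0..1}" and v: "v \<in> V" "p s \<in> convex hull (insert v \<tau>)" for s v
    proof -
      obtain r r' y where r: "0 \<le> r" "0 \<le> r'" "r + r' = 1" "y \<in> convex hull \<tau>" "p s = r *\<^sub>R v + r' *\<^sub>R y"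
        using v(2) unfolding convex_hull_insert[OF ne] by blast
      have "y \<in> affine hull \<tau>" using r(4) convex_hull_subset_affine_hull by blast
      then have y0: "\<alpha> (y - b) = 0" "\<gamma> (y - b) = 0" using L[of "y - b"] by auto
      have r': "r' = 1 - r" using r(3) by simp
      have "\<epsilon> *\<^sub>R u s = p s - b" by (simp add: p)
      also have "\<dots> = r *\<^sub>R (v - b) + r' *\<^sub>R (y - b)" unfolding r(5) r' by (simp add: algebra_simps)
      finally have eq: "\<epsilon> *\<^sub>R u s = r *\<^sub>R (v - b) + r' *\<^sub>R (y - b)" .
      have "\<alpha> (\<epsilon> *\<^sub>R u s) = r * \<alpha> (v - b)" "\<gamma> (\<epsilon> *\<^sub>R u s) = r * \<gamma> (v - b)"
        unfolding eq using y0
        by (simp_all add: linear_add[OF lin(1)] linear_scale[OF lin(1)] linear_add[OF lin(2)] linear_scale[OF lin(2)])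
      then have e1: "\<epsilon> * ((1 - s) * s1) = r * \<alpha> (v - b)" and e2: "\<epsilon> * (s * s2) = r * \<gamma> (v - b)"
        by (simp_all add: linear_scale[OF lin(1)] linear_scale[OF lin(2)] u)
      have a1: "\<epsilon> * (1 - s) = r * \<bar>\<alpha> (v - b)\<bar>" and a2: "\<epsilon> * s = r * \<bar>\<gamma> (v - b)\<bar>"
        using arg_cong[OF e1, of abs] arg_cong[OF e2, of abs] s \<epsilon> r(1) abs1
        by (simp_all add: abs_mult)
      have ed: "\<epsilon> = r * den v" using a1 a2 by (simp add: den_def algebra_simps)
      then have rpos: "0 < r" using \<epsilon> den[OF v(1)] r(1) by (metis less_eq_real_def less_irrefl mult_zero_left)
      have st: "s = t v"
      proof -
        have "r * (den v * s) = r * \<bar>\<gamma> (v - b)\<bar>" using a2 ed by (simp add: mult.assoc)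
        then have "den v * s = \<bar>\<gamma> (v - b)\<bar>" using rpos by simp
        then show ?thesis using den[OF v(1)] by (simp add: t_def field_simps)
      qed
      have s01: "0 < s" "s < 1" using t01[OF v(1)] st by auto
      have "sgn (\<alpha> (v - b)) = sgn (r * \<alpha> (v - b))" using rpos by (simp add: sgn_mult)
      also have "\<dots> = s1" unfolding e1[symmetric] using \<epsilon> s01 s12 by (auto simp: sgn_mult)
      finally have "sgn (\<alpha> (v - b)) = s1" .
      moreover have "sgn (\<gamma> (v - b)) = sgn (r * \<gamma> (v - b))" using rpos by (simp add: sgn_mult)
      then have "sgn (\<gamma> (v - b)) = s2" unfolding e2[symmetric] using \<epsilon> s01 s12 by (auto simp: sgn_mult)
      ultimately show ?thesis using v(1) st by blast
    qed
    have "g (p 0) + g (p 1) = (\<Sum>v\<in>?I. c (insert v \<tau>))"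
    proof (rule jump_sum[where t = t and g = "\<lambda>s. g (p s)"])
      show "finite ?I" using finV by simp
      show "0 < t v \<and> t v < 1" if "v \<in> ?I" for v using t01 that by blast
      show "inj_on t ?I"
      proof (rule inj_onI, rule ccontr)
        fix v v' assume vv: "v \<in> ?I" "v' \<in> ?I" "t v = t v'" "v \<noteq> v'"
        have "insert v \<tau> \<in> A" "insert v' \<tau> \<in> A" using V vv by auto
        then have "p (t v) \<in> convex hull (insert v \<tau> \<inter> insert v' \<tau>)"
          using geometric_complexD(5)[OF A _ _ at_t[OF vv(1)]] at_t[OF vv(2)] vv(3) by simp
        moreover have "insert v \<tau> \<inter> insert v' \<tau> = \<tau>" using vv V by auto
        ultimately show False using p\<tau> convex_hull_subset_affine_hull by auto
      qed
      show "\<exists>e>0. \<exists>l r. l + r = c (insert v \<tau>) \<and>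
        (\<forall>s\<in>{0..1}. \<bar>s - t v\<bar> < e \<longrightarrow> (s < t v \<longrightarrow> g (p s) = l) \<and> (t v < s \<longrightarrow> g (p s) = r))"
        if v: "v \<in> ?I" for v
      proof -
        have vV: "v \<in> V" using v by blast
        have tv: "t v \<in> {0..1}" using t01[OF vV] by simp
        have ri: "p (t v) \<in> rel_interior (convex hull (insert v \<tau>))"
          by (rule relint[OF tv vV at_t[OF v]])
        obtain a \<beta> P Q where sd: "sides A (insert v \<tau>) a \<beta> P Q" and cv: "c (insert v \<tau>) = f P + f Q"
          using cut[OF Vface[OF vV]] by blast
        have hyp: "affine hull (insert v \<tau>) = {z. a \<bullet> z = \<beta>}" using sd by (simp add: sides_def)
        obtain e where e: "e > 0"
          and e_P: "\<And>z. z \<in> ball (p (t v)) e \<Longrightarrow> \<beta> < a \<bullet> z \<Longrightarrow> region A z = P"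
          and e_Q: "\<And>z. z \<in> ball (p (t v)) e \<Longrightarrow> a \<bullet> z < \<beta> \<Longrightarrow> region A z = Q"
          by (rule sidesD[OF sd ri]) blast
        define D where "D = Y s2 - X s1"
        have pd: "p s = p (t v) + (s - t v) *\<^sub>R D" for s
          by (simp add: p_def D_def algebra_simps)
        have "a \<bullet> p (t v) = \<beta>" using at_t[OF v] convex_hull_subset_affine_hull hyp by blast
        then have lev: "a \<bullet> p s = \<beta> + (s - t v) * (a \<bullet> D)" for s
          by (subst pd) (simp add: inner_add_right)
        \<comment> \<open>The side crosses the hyperplane of the coface, because the corner on the first axis is not on it.\<close>
        have k: "a \<bullet> D \<noteq> 0"
        proof
          assume "a \<bullet> D = 0"
          then have "p 0 \<in> affine hull (insert v \<tau>)" using lev[of 0] hyp by simp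
          then have "b + (\<epsilon> * s1) *\<^sub>R w1 \<in> affine hull (insert v \<tau>)" by (simp add: p_def X_def)
          moreover have "b \<in> affine hull (insert v \<tau>)" using baff hull_mono[of \<tau> "insert v \<tau>" affine] by blast
          ultimately have "b + 1 *\<^sub>R w1 \<in> affine hull (insert v \<tau>)"
            using affine_scale_mem[OF affine_affine_hull, of b _ "\<epsilon> * s1" w1 1] \<epsilon> abs1 by auto
          then show False using off[OF vV] by simp
        qed
        define e' where "e' = e / (norm D + 1)"
        have Dpos: "0 < norm D + 1" using norm_ge_zero[of D] by linarith
        have e': "0 < e'" using e Dpos by (simp add: e'_def)
        have inball: "p s \<in> ball (p (t v)) e" if "\<bar>s - t v\<bar> < e'" for s
        proof -
          have "\<bar>s - t v\<bar> * norm D \<le> e' * norm D" using that by (intro mult_right_mono) auto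
          also have "\<dots> < e" using e Dpos by (simp add: e'_def field_simps)
          finally show ?thesis by (subst pd) (simp add: dist_norm)
        qed
        show ?thesis
        proof (cases "0 < a \<bullet> D")
          case True
          have "s < t v \<Longrightarrow> a \<bullet> p s < \<beta>" "t v < s \<Longrightarrow> \<beta> < a \<bullet> p s" for s
            using True unfolding lev by (simp_all add: mult_neg_pos)
          then show ?thesis using e' cv e_P[OF inball] e_Q[OF inball] unfolding g_def
            by (intro exI[of _ e'] exI[of _ "f Q"] exI[of _ "f P"] conjI ballI impI) (auto simp: add.commute)
        next
          case False
          then have "a \<bullet> D < 0" using k by simp
          then have "s < t v \<Longrightarrow> \<beta> < a \<bullet> p s" "t v < s \<Longrightarrow> a \<bullet> p s < \<beta>" for s
            unfolding lev by (simp_all add: mult_neg_neg mult_pos_neg)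
          then show ?thesis using e' cv e_P[OF inball] e_Q[OF inball] unfolding g_def
            by (intro exI[of _ e'] exI[of _ "f P"] exI[of _ "f Q"] conjI ballI impI) auto
        qed
      qed
      show "\<exists>e>0. \<forall>s\<in>{0..1}. \<bar>s - q\<bar> < e \<longrightarrow> g (p s) = g (p q)" if q: "q \<in> {0..1} - t ` ?I" for q
      proof -
        have "p q \<notin> body A"
        proof
          assume "p q \<in> body A"
          then obtain \<rho> where \<rho>: "\<rho> \<in> A" "p q \<in> convex hull \<rho>" unfolding body_def by blast
          then obtain v where "v \<in> V" "\<rho> = insert v \<tau>" using carrier[of q \<rho>] q by blast
          then have "v \<in> ?I \<and> q = t v" using only_t[of q v] q \<rho>(2) by blast
          then show False using q by blast
        qed
        moreover have "open (- body A)" by (rule open_Compl[OF closed_body[OF A]])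
        ultimately obtain e where e: "e > 0" "ball (p q) e \<subseteq> - body A" using openE by blast
        have "continuous_on UNIV p" unfolding p_def by (intro continuous_intros)
        then obtain e' where e': "e' > 0" "\<And>s. dist s q < e' \<Longrightarrow> dist (p s) (p q) < e"
          unfolding continuous_on_iff using e(1) by blast
        have "g (p s) = g (p q)" if "\<bar>s - q\<bar> < e'" for s
        proof -
          have "p s \<in> ball (p q) e" using e'(2)[of s] that by (simp add: dist_real_def dist_commute)
          then show ?thesis unfolding g_def
            using region_eq[OF connected_ball e(2), of "p s" "p q"] e(1) by simp
        qed
        then show ?thesis using e'(1) by blast
      qed
    qed
    then show ?thesis by (simp add: p_def)
  qed
  define N where "N s1 s2 = (\<Sum>v\<in>{v\<in>V. sgn (\<alpha> (v - b)) = s1 \<and> sgn (\<gamma> (v - b)) = s2}. c (insert v \<tau>))" for s1 s2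
  have split: "(\<Sum>v\<in>W. c (insert v \<tau>)) = (\<Sum>v\<in>{v\<in>W. sgn (h v) = 1}. c (insert v \<tau>)) + (\<Sum>v\<in>{v\<in>W. sgn (h v) = -1}. c (insert v \<tau>))"
    if "W \<subseteq> V" "\<And>v. v \<in> V \<Longrightarrow> h v \<noteq> 0" for W and h :: "'a \<Rightarrow> real"
  proof -
    have "W = {v\<in>W. sgn (h v) = 1} \<union> {v\<in>W. sgn (h v) = -1}"
      using that by (auto simp: sgn_if)
    then have "(\<Sum>v\<in>W. c (insert v \<tau>)) = (\<Sum>v\<in>{v\<in>W. sgn (h v) = 1} \<union> {v\<in>W. sgn (h v) = -1}. c (insert v \<tau>))"
      by (rule arg_cong)
    also have "\<dots> = (\<Sum>v\<in>{v\<in>W. sgn (h v) = 1}. c (insert v \<tau>)) + (\<Sum>v\<in>{v\<in>W. sgn (h v) = -1}. c (insert v \<tau>))"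
      using finite_subset[OF that(1) finV] by (intro sum.union_disjoint) auto
    finally show ?thesis .
  qed
  have N_eq: "(\<Sum>v\<in>{v\<in>{v\<in>V. sgn (\<alpha> (v - b)) = s1}. sgn (\<gamma> (v - b)) = s2}. c (insert v \<tau>)) = N s1 s2" for s1 s2
    unfolding N_def by (rule sum.cong) auto
  have "(\<Sum>v\<in>V. c (insert v \<tau>)) = (N 1 1 + N 1 (-1)) + (N (-1) 1 + N (-1) (-1))"
    using split[of V "\<lambda>v. \<alpha> (v - b)"] split[of "{v\<in>V. sgn (\<alpha> (v - b)) = 1}" "\<lambda>v. \<gamma> (v - b)"]
      split[of "{v\<in>V. sgn (\<alpha> (v - b)) = -1}" "\<lambda>v. \<gamma> (v - b)"] nz
    by (simp only: N_eq) auto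
  also have "\<dots> = ((g (X 1) + g (Y 1)) + (g (X 1) + g (Y (-1)))) + ((g (X (-1)) + g (Y 1)) + (g (X (-1)) + g (Y (-1))))"
    using side by (simp add: N_def)
  also have "\<dots> = 0"
    by (cases "g (X 1)"; cases "g (X (-1))"; cases "g (Y 1)"; cases "g (Y (-1))") simp_all
  finally show "(\<Sum>\<sigma>\<in>cofaces A d \<tau>. c \<sigma>) = 0" using sumcof by simp
qed

text \<open>The regions \<open>P \<sigma>\<close> and \<open>Q \<sigma>\<close> beside each simplex do not depend on the chain.\<close>

theorem cycles_are_cuts:
  obtains P Q :: "'a set \<Rightarrow> 'a set" where
    "\<And>c. cycle_on A d c \<longleftrightarrow> (\<exists>f :: 'a set \<Rightarrow> bit. \<forall>\<sigma>\<in>faces A d. c \<sigma> = f (P \<sigma>) + f (Q \<sigma>))"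
proof -
  have "\<forall>\<sigma>. \<exists>P Q. \<sigma> \<in> faces A d \<longrightarrow> (\<exists>a \<beta>. sides A \<sigma> a \<beta> P Q)" using sides_exist by blast
  then obtain P Q where PQ: "\<And>\<sigma>. \<sigma> \<in> faces A d \<Longrightarrow> \<exists>a \<beta>. sides A \<sigma> a \<beta> (P \<sigma>) (Q \<sigma>)" by metis
  show ?thesis
  proof (rule that[of P Q])
    fix c
    show "cycle_on A d c \<longleftrightarrow> (\<exists>f :: 'a set \<Rightarrow> bit. \<forall>\<sigma>\<in>faces A d. c \<sigma> = f (P \<sigma>) + f (Q \<sigma>))"
    proof
      assume "cycle_on A d c"
      then obtain f where f: "\<And>\<sigma> a \<beta> P Q. \<sigma> \<in> faces A d \<Longrightarrow> sides A \<sigma> a \<beta> P Q \<Longrightarrow> c \<sigma> = f P + f Q"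
        by (rule cycle_imp_cut) blast
      then show "\<exists>f :: 'a set \<Rightarrow> bit. \<forall>\<sigma>\<in>faces A d. c \<sigma> = f (P \<sigma>) + f (Q \<sigma>)" using PQ by blast
    next
      assume "\<exists>f :: 'a set \<Rightarrow> bit. \<forall>\<sigma>\<in>faces A d. c \<sigma> = f (P \<sigma>) + f (Q \<sigma>)"
      then obtain f :: "'a set \<Rightarrow> bit" where "\<forall>\<sigma>\<in>faces A d. c \<sigma> = f (P \<sigma>) + f (Q \<sigma>)" by blast
      then show "cycle_on A d c" using PQ by (intro cut_imp_cycle[of c f]) blast
    qed
  qed
qed

end

section \<open>From cuts to a basis\<close>

text \<open>What \<open>cycles_are_cuts\<close> provides, freed from geometry: the type \<open>'r\<close> of regions is arbitrary, so that the
  property can be carried along isomorphisms and subdivisions.\<close>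

definition cut_representation ::
    "'v set set \<Rightarrow> nat \<Rightarrow> ('v set \<Rightarrow> 'r) \<Rightarrow> ('v set \<Rightarrow> 'r) \<Rightarrow> bool" where
  "cut_representation K d P Q \<longleftrightarrow>
     (\<forall>c. cycle_on K d c \<longleftrightarrow> (\<exists>f :: 'r \<Rightarrow> bit. \<forall>\<sigma>\<in>faces K d. c \<sigma> = f (P \<sigma>) + f (Q \<sigma>)))"

lemma cycle_on_cong:
  assumes "\<And>\<sigma>. \<sigma> \<in> faces K d \<Longrightarrow> c \<sigma> = c' \<sigma>"
  shows "cycle_on K d c \<longleftrightarrow> cycle_on K d c'"
proof -
  have "(\<Sum>\<sigma>\<in>cofaces K d \<tau>. c \<sigma>) = (\<Sum>\<sigma>\<in>cofaces K d \<tau>. c' \<sigma>)" for \<tau>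
    by (rule sum.cong) (auto simp: cofaces_def assms)
  then show ?thesis by (simp add: cycle_on_def)
qed

context subdivided_complex
begin

text \<open>The regions beside a simplex of \<open>B\<close> are those beside any chosen piece \<open>s \<sigma>\<close> of it.\<close>

lemma cut_representation_coarsen:
  fixes P Q :: "'a set \<Rightarrow> 'r"
  assumes d: "0 < d" and rep: "cut_representation A d P Q"
  shows "\<exists>P' Q' :: 'a set \<Rightarrow> 'r. cut_representation B d P' Q'"
proof -
  have "\<forall>\<sigma>. \<exists>\<rho>. \<sigma> \<in> faces B d \<longrightarrow> \<rho> \<in> faces A d \<and> coarse \<rho> = \<sigma>" using coarse_surj by metis
  then obtain s where s: "\<And>\<sigma>. \<sigma> \<in> faces B d \<Longrightarrow> s \<sigma> \<in> faces A d" "\<And>\<sigma>. \<sigma> \<in> faces B d \<Longrightarrow> coarse (s \<sigma>) = \<sigma>"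
    by metis
  have "cut_representation B d (P \<circ> s) (Q \<circ> s)"
    unfolding cut_representation_def
  proof (intro allI iffI)
    fix c assume "cycle_on B d c"
    then have "cycle_on A d (c \<circ> coarse)" using d by (rule cycle_on_refine)
    then obtain f where f: "\<forall>\<rho>\<in>faces A d. (c \<circ> coarse) \<rho> = f (P \<rho>) + f (Q \<rho>)"
      using rep unfolding cut_representation_def by blast
    have "c \<sigma> = f ((P \<circ> s) \<sigma>) + f ((Q \<circ> s) \<sigma>)" if "\<sigma> \<in> faces B d" for \<sigma>
      using bspec[OF f s(1)[OF that]] s(2)[OF that] by simp
    then show "\<exists>f :: 'r \<Rightarrow> bit. \<forall>\<sigma>\<in>faces B d. c \<sigma> = f ((P \<circ> s) \<sigma>) + f ((Q \<circ> s) \<sigma>)" by blast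
  next
    fix c assume "\<exists>f :: 'r \<Rightarrow> bit. \<forall>\<sigma>\<in>faces B d. c \<sigma> = f ((P \<circ> s) \<sigma>) + f ((Q \<circ> s) \<sigma>)"
    then obtain f :: "'r \<Rightarrow> bit" where f: "\<forall>\<sigma>\<in>faces B d. c \<sigma> = f ((P \<circ> s) \<sigma>) + f ((Q \<circ> s) \<sigma>)" by blast
    have "cycle_on A d (\<lambda>\<rho>. f (P \<rho>) + f (Q \<rho>))"
      using rep unfolding cut_representation_def by blast
    then obtain c' where c': "cycle_on B d c'" "\<And>\<rho>. \<rho> \<in> faces A d \<Longrightarrow> f (P \<rho>) + f (Q \<rho>) = c' (coarse \<rho>)"
      by (rule cycle_on_coarsen[OF _ d]) blast
    have "c \<sigma> = c' \<sigma>" if "\<sigma> \<in> faces B d" for \<sigma>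
      using bspec[OF f that] c'(2)[OF s(1)[OF that]] s(2)[OF that] by simp
    then show "cycle_on B d c" using c'(1) cycle_on_cong[of B d c c'] by blast
  qed
  then show ?thesis by blast
qed

end

lemma complex_isomorphic_card_le:
  assumes "complex_isomorphic K L" "\<forall>\<sigma>\<in>K. card \<sigma> \<le> n" "\<sigma> \<in> L"
  shows "card \<sigma> \<le> n"
proof -
  obtain h where h: "inj_on h (\<Union>K)" "L = (\<lambda>\<sigma>. h ` \<sigma>) ` K"
    using assms(1) unfolding complex_isomorphic_def by blast
  then obtain \<rho> where \<rho>: "\<rho> \<in> K" "\<sigma> = h ` \<rho>" using assms(3) by blast
  have "inj_on h \<rho>" using h(1) by (rule inj_on_subset) (use \<rho>(1) in blast)
  then show ?thesis using assms(2) \<rho> by (simp add: card_image)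
qed

lemma cut_representation_isomorphic:
  fixes K :: "'a set set" and L :: "'b set set" and P Q :: "'b set \<Rightarrow> 'r"
  assumes iso: "complex_isomorphic K L" and rep: "cut_representation L d P Q"
  shows "\<exists>P' Q' :: 'a set \<Rightarrow> 'r. cut_representation K d P' Q'"
proof -
  obtain h where h: "inj_on h (\<Union>K)" "L = (\<lambda>\<sigma>. h ` \<sigma>) ` K"
    using iso unfolding complex_isomorphic_def by blast
  have card: "card (h ` \<sigma>) = card \<sigma>" if "\<sigma> \<in> K" for \<sigma>
    by (rule card_image[OF inj_on_subset[OF h(1)]]) (use that in blast)
  have facesL: "faces L d = (\<lambda>\<sigma>. h ` \<sigma>) ` faces K d"
    using card by (auto simp: faces_def h(2))
  have inj: "inj_on (\<lambda>\<sigma>. h ` \<sigma>) K"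
    by (rule inj_onI) (use h(1) inj_on_image_eq_iff[OF h(1)] in blast)
  have sub: "h ` \<tau> \<subseteq> h ` \<sigma> \<longleftrightarrow> \<tau> \<subseteq> \<sigma>" if "\<tau> \<in> K" "\<sigma> \<in> K" for \<tau> \<sigma>
    using inj_on_image_subset_iff[OF h(1), of \<tau> \<sigma>] that by blast
  have cof: "cofaces L d (h ` \<tau>) = (\<lambda>\<sigma>. h ` \<sigma>) ` cofaces K d \<tau>" if "\<tau> \<in> K" for \<tau>
    using sub[OF that] unfolding cofaces_def facesL by (auto simp: faces_def)
  have transfer: "cycle_on L d c' \<longleftrightarrow> cycle_on K d (\<lambda>\<sigma>. c' (h ` \<sigma>))" for c'
  proof -
    have "(\<Sum>\<sigma>\<in>cofaces L d (h ` \<tau>). c' \<sigma>) = (\<Sum>\<sigma>\<in>cofaces K d \<tau>. c' (h ` \<sigma>))" if "\<tau> \<in> K" for \<tau>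
      unfolding cof[OF that]
      by (rule sum.reindex[unfolded comp_def], rule inj_on_subset[OF inj]) (auto simp: cofaces_def faces_def)
    then show ?thesis using card by (auto simp: cycle_on_def h(2))
  qed
  have "cut_representation K d (\<lambda>\<sigma>. P (h ` \<sigma>)) (\<lambda>\<sigma>. Q (h ` \<sigma>))"
    unfolding cut_representation_def
  proof
    fix c :: "'a set \<Rightarrow> bit"
    define c' where "c' \<rho> = c (inv_into K (\<lambda>\<sigma>. h ` \<sigma>) \<rho>)" for \<rho>
    have c': "c' (h ` \<sigma>) = c \<sigma>" if "\<sigma> \<in> K" for \<sigma>
      using inv_into_f_f[OF inj that] by (simp add: c'_def)
    have "cycle_on K d c \<longleftrightarrow> cycle_on L d c'"
      unfolding transfer by (rule cycle_on_cong) (simp add: c' faces_def)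
    also have "\<dots> \<longleftrightarrow> (\<exists>f. \<forall>\<rho>\<in>faces L d. c' \<rho> = f (P \<rho>) + f (Q \<rho>))"
      using rep unfolding cut_representation_def by blast
    also have "\<dots> \<longleftrightarrow> (\<exists>f. \<forall>\<sigma>\<in>faces K d. c \<sigma> = f (P (h ` \<sigma>)) + f (Q (h ` \<sigma>)))"
      unfolding facesL by (simp add: c' faces_def)
    finally show "cycle_on K d c \<longleftrightarrow> (\<exists>f. \<forall>\<sigma>\<in>faces K d. c \<sigma> = f (P (h ` \<sigma>)) + f (Q (h ` \<sigma>)))" .
  qed
  then show ?thesis by blast
qed

lemma mem_cycles_iff:
  assumes K: "abstract_complex K"
  shows "c \<in> cycles K d \<longleftrightarrow> (\<forall>\<sigma>. \<sigma> \<notin> faces K d \<longrightarrow> c $ \<sigma> = 0) \<and> cycle_on K d (\<lambda>\<sigma>. c $ \<sigma>)"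
proof -
  have "c \<in> chains K d \<longleftrightarrow> (\<forall>\<sigma>. \<sigma> \<notin> faces K d \<longrightarrow> c $ \<sigma> = 0)"
    unfolding chains_def by blast
  moreover have "bdry K d c = 0 \<longleftrightarrow> cycle_on K d (\<lambda>\<sigma>. c $ \<sigma>)"
  proof -
    have "(\<Sum>\<sigma>\<in>cofaces K d \<tau>. c $ \<sigma>) = 0" if "\<tau> \<notin> K" for \<tau>
    proof -
      have "cofaces K d \<tau> = {}"
        using K that by (auto simp: cofaces_def faces_def abstract_complex_def)
      then show ?thesis by simp
    qed
    moreover have "bdry K d c = 0 \<longleftrightarrow> (\<forall>\<tau>. \<tau> \<noteq> {} \<and> card \<tau> = d \<longrightarrow> (\<Sum>\<sigma>\<in>cofaces K d \<tau>. c $ \<sigma>) = 0)"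
      unfolding bdry_def vec_eq_iff cofaces_def by simp
    ultimately show ?thesis unfolding cycle_on_def by blast
  qed
  ultimately show ?thesis unfolding cycles_def by blast
qed

text \<open>The spanning set consists of the cuts \<open>z r\<close> of single regions. If \<open>r\<close> lies on both sides of a simplex, the
  two contributions cancel, as they should.\<close>

lemma complete_basis_if_cut_representation:
  fixes K :: "'v::finite set set" and P Q :: "'v set \<Rightarrow> 'r"
  assumes K: "abstract_complex K" and rep: "cut_representation K d P Q"
  shows "\<exists>B. complete_basis 2 K d B"
proof -
  define R where "R = P ` faces K d \<union> Q ` faces K d"
  define z :: "'r \<Rightarrow> bit ^ 'v set" where
    "z r = (\<chi> \<sigma>. if \<sigma> \<in> faces K d then of_bool (P \<sigma> = r) + of_bool (Q \<sigma> = r) else 0)" for r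
  have finR: "finite R" by (simp add: R_def)
  have z_cycle: "z r \<in> cycles K d" for r
  proof -
    have "cycle_on K d (\<lambda>\<sigma>. z r $ \<sigma>)"
      using rep unfolding cut_representation_def
      by (elim allE[of _ "\<lambda>\<sigma>. z r $ \<sigma>"] iffD2) (intro exI[of _ "\<lambda>r'. of_bool (r' = r)"] ballI, simp only: z_def vec_lambda_beta if_True)
    moreover have "\<forall>\<sigma>. \<sigma> \<notin> faces K d \<longrightarrow> z r $ \<sigma> = 0" by (simp add: z_def)
    ultimately show ?thesis unfolding mem_cycles_iff[OF K] by blast
  qed
  have sub: "vec.subspace (cycles K d)"
  proof -
    let ?Z = "{c :: bit ^ 'v set. (\<forall>\<sigma>. \<sigma> \<notin> faces K d \<longrightarrow> c $ \<sigma> = 0) \<and>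
        (\<forall>\<tau>\<in>K. \<tau> \<noteq> {} \<and> card \<tau> = d \<longrightarrow> (\<Sum>\<sigma>\<in>cofaces K d \<tau>. c $ \<sigma>) = 0)}"
    have "cycles K d = ?Z"
      by (rule set_eqI) (simp only: mem_cycles_iff[OF K] cycle_on_def mem_Collect_eq)
    moreover have "vec.subspace ?Z"
    proof (rule vec.subspaceI)
      show "0 \<in> ?Z" by simp
      show "x + y \<in> ?Z" if x: "x \<in> ?Z" and y: "y \<in> ?Z" for x y
      proof (intro CollectI conjI allI ballI impI)
        show "(x + y) $ \<sigma> = 0" if "\<sigma> \<notin> faces K d" for \<sigma> using x y that by simp
        fix \<tau> assume "\<tau> \<in> K" "\<tau> \<noteq> {} \<and> card \<tau> = d"
        then have "(\<Sum>\<sigma>\<in>cofaces K d \<tau>. x $ \<sigma>) = 0" "(\<Sum>\<sigma>\<in>cofaces K d \<tau>. y $ \<sigma>) = 0"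
          using x y by blast+
        then show "(\<Sum>\<sigma>\<in>cofaces K d \<tau>. (x + y) $ \<sigma>) = 0"
          by (simp only: vector_add_component sum.distrib add_0_left)
      qed
      show "k *s x \<in> ?Z" if x: "x \<in> ?Z" for k x
      proof (intro CollectI conjI allI ballI impI)
        show "(k *s x) $ \<sigma> = 0" if "\<sigma> \<notin> faces K d" for \<sigma> using x that by simp
        fix \<tau> assume "\<tau> \<in> K" "\<tau> \<noteq> {} \<and> card \<tau> = d"
        then have "(\<Sum>\<sigma>\<in>cofaces K d \<tau>. x $ \<sigma>) = 0" using x by blast
        then show "(\<Sum>\<sigma>\<in>cofaces K d \<tau>. (k *s x) $ \<sigma>) = 0"
          by (simp only: vector_smult_component sum_distrib_left[symmetric] mult_zero_right)
      qed
    qed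
    ultimately show ?thesis by (simp only:)
  qed
  have span: "vec.span (z ` R) = cycles K d"
  proof
    show "vec.span (z ` R) \<subseteq> cycles K d" using z_cycle sub by (intro vec.span_minimal) auto
    show "cycles K d \<subseteq> vec.span (z ` R)"
    proof
      fix c assume "c \<in> cycles K d"
      then have c: "\<And>\<sigma>. \<sigma> \<notin> faces K d \<Longrightarrow> c $ \<sigma> = 0" "cycle_on K d (\<lambda>\<sigma>. c $ \<sigma>)"
        unfolding mem_cycles_iff[OF K] by auto
      obtain f where f: "\<forall>\<sigma>\<in>faces K d. c $ \<sigma> = f (P \<sigma>) + f (Q \<sigma>)"
        using rep c(2) unfolding cut_representation_def by blast
      have "c = (\<Sum>r\<in>R. f r *s z r)"
        unfolding vec_eq_iff
      proof
        fix \<sigma>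
        show "c $ \<sigma> = (\<Sum>r\<in>R. f r *s z r) $ \<sigma>"
        proof (cases "\<sigma> \<in> faces K d")
          case True
          then have PQ: "P \<sigma> \<in> R" "Q \<sigma> \<in> R" by (auto simp: R_def)
          have pick: "(\<Sum>r\<in>R. f r * of_bool (x = r)) = f x" if "x \<in> R" for x
          proof -
            have "(\<Sum>r\<in>R. f r * of_bool (x = r)) = (\<Sum>r\<in>R. if x = r then f r else 0)"
              by (rule sum.cong) auto
            then show ?thesis using that finR by simp
          qed
          have "(\<Sum>r\<in>R. f r *s z r) $ \<sigma> = (\<Sum>r\<in>R. f r * (of_bool (P \<sigma> = r) + of_bool (Q \<sigma> = r)))"
            unfolding sum_component vector_smult_component z_def vec_lambda_beta using True by (simp only: if_True)
          also have "\<dots> = f (P \<sigma>) + f (Q \<sigma>)"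
            unfolding distrib_left sum.distrib by (simp only: pick PQ)
          finally show ?thesis using f True by simp
        next
          case False
          then have "z r $ \<sigma> = 0" for r by (simp add: z_def)
          then show ?thesis using c(1)[OF False] by simp
        qed
      qed
      also have "\<dots> \<in> vec.span (z ` R)"
        by (intro vec.span_sum vec.span_scale vec.span_base) auto
      finally show "c \<in> vec.span (z ` R)" .
    qed
  qed
  obtain B where B: "B \<subseteq> z ` R" "vec.independent B" "z ` R \<subseteq> vec.span B"
    using vec.maximal_independent_subset[of "z ` R"] by blast
  have "vec.span B = cycles K d"
    unfolding span[symmetric] using B(1,3) by (metis vec.span_eq vec.span_superset subset_trans)
  moreover have "card {c \<in> B. \<sigma> \<in> chain_support c} \<le> 2" if \<sigma>: "\<sigma> \<in> faces K d" for \<sigma>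
  proof -
    have "{c \<in> B. \<sigma> \<in> chain_support c} \<subseteq> {z (P \<sigma>), z (Q \<sigma>)}"
    proof
      fix c assume "c \<in> {c \<in> B. \<sigma> \<in> chain_support c}"
      then obtain r where r: "c = z r" "z r $ \<sigma> = 1" using B(1) by (auto simp: chain_support_def)
      have "P \<sigma> = r \<or> Q \<sigma> = r"
      proof (rule ccontr)
        assume "\<not> (P \<sigma> = r \<or> Q \<sigma> = r)"
        then have "z r $ \<sigma> = 0" by (simp add: z_def)
        then show False using r(2) by simp
      qed
      then show "c \<in> {z (P \<sigma>), z (Q \<sigma>)}" using r(1) by auto
    qed
    then have "card {c \<in> B. \<sigma> \<in> chain_support c} \<le> card {z (P \<sigma>), z (Q \<sigma>)}"
      by (intro card_mono) auto
    also have "\<dots> \<le> 2" by (simp add: card_insert_if)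
    finally show ?thesis .
  qed
  ultimately show ?thesis
    using B(2) unfolding complete_basis_def top_homology_basis_def by blast
qed

text \<open>Every function on nonempty sets is a cut if each point has a region of its own and they all share the
  region \<open>{}\<close> on the other side.\<close>

lemma cut_representation_dimension_0:
  fixes K :: "'v set set"
  assumes "abstract_complex K"
  shows "cut_representation K 0 (\<lambda>\<sigma>. \<sigma>) (\<lambda>\<sigma>. {})"
  unfolding cut_representation_def
proof (intro allI iffI)
  fix c :: "'v set \<Rightarrow> bit"
  show "\<exists>f :: 'v set \<Rightarrow> bit. \<forall>\<sigma>\<in>faces K 0. c \<sigma> = f \<sigma> + f {}"
    by (intro exI[of _ "\<lambda>\<sigma>. if \<sigma> = {} then 0 else c \<sigma>"]) (auto simp: faces_def)
  have "finite \<tau>" if "\<tau> \<in> K" for \<tau> using assms that by (simp add: abstract_complex_def)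
  then show "cycle_on K 0 c" by (auto simp: cycle_on_def)
qed

theorem theorem1:
  fixes K :: "'v::finite set set" and d :: nat
  assumes "abstract_complex K"
    and "has_dimension K d"
    and "DIM('a::euclidean_space) = d + 1"
    and "pl_embeddable K TYPE('a)"
  shows "\<exists>B. complete_basis 2 K d B"
proof (cases "d = 0")
  case True
  then show ?thesis
    using complete_basis_if_cut_representation[OF assms(1) cut_representation_dimension_0[OF assms(1)]] by simp
next
  case False
  then have d: "0 < d" by simp
  obtain C and C' :: "'a set set" where C: "subdivision_of C (standard_realisation K)"
    and C': "simplicial_complex C'" "complex_isomorphic (vertex_scheme C) (vertex_scheme C')"
    using assms(4) unfolding pl_embeddable_def linearly_embeddable_def geometric_realisation_def by blast
  have std: "simplicial_complex (standard_realisation K)"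
      "complex_isomorphic K (vertex_scheme (standard_realisation K))"
    using geometric_realisation_standard[OF assms(1)] unfolding geometric_realisation_def by auto
  have sC: "simplicial_complex C" using C by (simp add: subdivision_of_def)
  let ?A = "vertex_scheme C" and ?A' = "vertex_scheme C'" and ?B = "vertex_scheme (standard_realisation K)"
  \<comment> \<open>The complexes are linked by \<open>K \<cong> ?B\<close>, subdivided by \<open>?A \<cong> ?A'\<close>, and \<open>?A'\<close> lies in the target space.\<close>
  interpret subdivided_complex ?A ?B d
  proof
    show "geometric_complex ?A" by (rule geometric_complex_vertex_scheme[OF sC])
    show "geometric_complex ?B" by (rule geometric_complex_vertex_scheme[OF std(1)])
    show "card \<sigma> \<le> d + 1" if "\<sigma> \<in> ?B" for \<sigma>
      using complex_isomorphic_card_le[OF std(2) _ that] assms(2) by (simp add: has_dimension_def)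
    show "body ?A = body ?B"
      using C by (simp add: body_vertex_scheme[OF sC] body_vertex_scheme[OF std(1)] subdivision_of_def)
    fix \<rho> assume "\<rho> \<in> ?A"
    then obtain S where S: "S \<in> C" "\<rho> = {v. v extreme_point_of S}" by (auto simp: vertex_scheme_def)
    then obtain T where T: "T \<in> standard_realisation K" "S \<subseteq> T" using C by (auto simp: subdivision_of_def)
    have "{v. v extreme_point_of T} \<in> ?B" using T(1) by (simp add: vertex_scheme_def)
    then show "\<exists>\<sigma>\<in>?B. convex hull \<rho> \<subseteq> convex hull \<sigma>"
      using T simplicial_complex_vertices(2)[OF sC S(1)] simplicial_complex_vertices(2)[OF std(1) T(1)] S(2)
      by metis
  qed
  interpret E: hypersurface_complex ?A' d
  proof
    show "geometric_complex ?A'" by (rule geometric_complex_vertex_scheme[OF C'(1)])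
    show "card \<sigma> \<le> d + 1" if "\<sigma> \<in> ?A'" for \<sigma>
      using complex_isomorphic_card_le[OF C'(2) _ that] dimA by blast
  qed (use assms(3) d in auto)
  obtain P Q :: "'a set \<Rightarrow> 'a set" where "cut_representation ?A' d P Q"
    unfolding cut_representation_def using E.cycles_are_cuts by metis
  from cut_representation_isomorphic[OF C'(2) this]
  obtain P1 Q1 :: "_ \<Rightarrow> 'a set" where "cut_representation ?A d P1 Q1" by blast
  from cut_representation_coarsen[OF d this]
  obtain P2 Q2 :: "_ \<Rightarrow> 'a set" where "cut_representation ?B d P2 Q2" by blast
  from cut_representation_isomorphic[OF std(2) this]
  obtain P3 Q3 :: "_ \<Rightarrow> 'a set" where "cut_representation K d P3 Q3" by blast
  then show ?thesis by (rule complete_basis_if_cut_representation[OF assms(1)])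
qed

end
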